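(* Let $T=[T_1,\ldots,T_n]\in[B(\mathcal H)^n]_1^-$ be a row contraction. Then: (i) $T$ is a pure isometry if and only if $\Gamma(T)\in\mathbb N_\infty\times\{0\}\times\{0\}$. (ii) If $T,T'\in[B(\mathcal H)^n]_1^-$ and $\Gamma(T)=\Gamma(T')=(p,0,0)$ for some $p\in\mathbb N_\infty$, then $T$ is unitarily equivalent to $T'$ and $p=\operatorname{rank}\Delta_T=\operatorname{rank}\Delta_{T'}$.
   Context: $n\ge1$ is an integer, $\mathbb N=\{0,1,2,\ldots\}$, $\mathbb N_\infty=\mathbb N\cup\{\infty\}$; dimensions and ranks are regarded as elements of $\mathbb N_\infty$. Hilbert spaces are complex. $\mathbb F_n^+$ is the unital free semigroup on $g_1,\ldots,g_n$ with identity $g_0$; $|g_0|=0$, $|g_{i_1}\cdots g_{i_k}|=k$; for $X=(X_1,\ldots,X_n)\in B(\mathcal H)^n$ put $X_{g_0}=I$ and $X_\alpha=X_{i_1}\cdots X_{i_k}$ if $\alpha=g_{i_1}\cdots g_{i_k}$. $[B(\mathcal H)^n]_1^-$ is the set of row contractions, i.e. $(X_1,\ldots,X_n)\in B(\mathcal H)^n$ with $\sum_iX_iX_i^*\le I$; an $n$-tuple is identified with the row operator $[X_1,\ldots,X_n]:\mathcal H^{(n)}\to\mathcal H$, where $\mathcal H^{(n)}$ is the direct sum of $n$ copies of $\mathcal H$. Two $n$-tuples $X\in B(\mathcal H)^n$, $X'\in B(\mathcal H')^n$ are unitarily equivalent if there is a unitary $U:\mathcal H\to\mathcal H'$ with $UX_i=X_i'U$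 for all $i$. A row contraction $T$ is pure if $\lim_{k\to\infty}\sum_{|\alpha|=k}\|T_\alpha^*h\|^2=0$ for all $h\in\mathcal H$; it is an isometry if $T_i^*T_j=\delta_{ij}I$ for all $i,j$, and a pure isometry if it is both. Defect operators: $\Delta_T=(I-\sum_iT_iT_i^* )^{1/2}\in B(\mathcal H)$, $\Delta_{T^*}=(I-T^*T)^{1/2}\in B(\mathcal H^{(n)})$; defect spaces $\mathcal D_T=\overline{\Delta_T\mathcal H}$, $\mathcal D_{T^*}=\overline{\Delta_{T^*}\mathcal H^{(n)}}$. The characteristic function of $T$ is the function defined, for any Hilbert space $\mathcal G$ and $X\in B(\mathcal G)^n$ with $\|\sum_iX_iX_i^*\|<1$, by $$\Theta_T(X)=-I_{\mathcal G}\otimes(T|_{\mathcal D_{T^*}})+(I_{\mathcal G}\otimes\Delta_T)\Big(I-\sum_{i=1}^nX_i\otimes T_i^*\Big)^{-1}[X_1\otimes I_{\mathcal H},\ldots,X_n\otimes I_{\mathcal H}](I_{\mathcal G}\otimes\Delta_{T^*}|_{\mathcal D_{T^*}}).$$ It has a unique expansion $\Theta_T(X)=\sum_{k\ge0}\sum_{|\alpha|=k}X_\alpha\otimes A_{(\alpha)}$ with $A_{(\alpha)}\in B(\mathcal D_{T^*},\mathcal D_T)$. It is a noncommutative polynomial if only finitely many $A_{(\alpha)}$ are nonzero; its degree $\deg(\Theta_T)$ is then the largest $|\alpha|$ with $A_{(\alpha)}\ne0$, with the convention that constants (including zero) have degree $0$; $\deg(\Theta_T)=\infty$ if $\Theta_T$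 is not a polynomial. $F^2(H_n)=\mathbb C1\oplus\bigoplus_{k\ge1}(\mathbb C^n)^{\otimes k}$ is the full Fock space with orthonormal basis $\{e_\alpha\}_{\alpha\in\mathbb F_n^+}$, $e_{g_0}=1$, $e_\alpha=e_{i_1}\otimes\cdots\otimes e_{i_k}$. The noncommutative Poisson kernel of $T$ is $K_T:\mathcal H\to F^2(H_n)\otimes\mathcal D_T$, $K_Th=\sum_{\alpha\in\mathbb F_n^+}e_\alpha\otimes\Delta_TT_\alpha^*h$. The map $\Gamma:[B(\mathcal H)^n]_1^-\to\mathbb N_\infty\times\mathbb N_\infty\times\mathbb N_\infty$ is $\Gamma(T)=(p,m,q)$ with $m=\deg(\Theta_T)$, $q=\dim\ker K_T$, and $p=\dim(\mathcal D_m\ominus\mathcal D_{m+1})$ if $m\in\mathbb N$, $p=\dim\overline{\Delta_T\mathcal H}$ if $m=\infty$, where $\mathcal D_k=\overline{\mathrm{span}}\{T_\beta\Delta_Th:h\in\mathcal H,|\beta|\ge k\}$. *)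

theory Defs
  imports "HOL-Analysis.Analysis"
begin

section \<open>Complex Hilbert spaces\<close>

class complex_vector = real_vector +
  fixes scaleC :: "complex \<Rightarrow> 'a \<Rightarrow> 'a"  (infixr "*\<^sub>C" 75)
  assumes scaleC_add_right: "a *\<^sub>C (x + y) = a *\<^sub>C x + a *\<^sub>C y"
    and scaleC_add_left: "(a + b) *\<^sub>C x = a *\<^sub>C x + b *\<^sub>C x"
    and scaleC_scaleC [simp]: "a *\<^sub>C (b *\<^sub>C x) = (a * b) *\<^sub>C x"
    and scaleC_one [simp]: "1 *\<^sub>C x = x"
    and scaleR_scaleC: "r *\<^sub>R x = complex_of_real r *\<^sub>C x"

global_interpretation complex_vector: vector_space "scaleC :: complex \<Rightarrow> 'a \<Rightarrow> 'a::complex_vector"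
  by standard (simp_all add: scaleC_add_right scaleC_add_left)

text \<open>The complex inner product is linear in the first argument. The norm and the topology are those
  of \<^class>\<open>real_inner\<close>; the last axiom ties them to the complex inner product, so that positive
  definiteness is inherited and \<open>norm x = sqrt (Re (cinner x x))\<close>.\<close>

class complex_inner = complex_vector + real_inner +
  fixes cinner :: "'a \<Rightarrow> 'a \<Rightarrow> complex"
  assumes cinner_commute: "cinner x y = cnj (cinner y x)"
    and cinner_add_left: "cinner (x + y) z = cinner x z + cinner y z"
    and cinner_scaleC_left: "cinner (c *\<^sub>C x) y = c * cinner x y"
    and inner_eq_Re_cinner: "inner x y = Re (cinner x y)"

class chilbert_space = complex_inner + complete_space

lemma norm_scaleC [simp]: "norm (c *\<^sub>C (x::'a::complex_inner)) = cmod c * norm x"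
proof -
  have "cinner (c *\<^sub>C x) (c *\<^sub>C x) = c * cnj (cinner (c *\<^sub>C x) x)"
    by (metis cinner_scaleC_left cinner_commute)
  also have "\<dots> = c * cnj c * cnj (cinner x x)"
    by (simp add: cinner_scaleC_left)
  also have "\<dots> = complex_of_real ((cmod c)\<^sup>2) * cinner x x"
    by (metis complex_norm_square cinner_commute)
  finally have "inner (c *\<^sub>C x) (c *\<^sub>C x) = (cmod c)\<^sup>2 * inner x x"
    by (simp add: inner_eq_Re_cinner)
  then show ?thesis
    by (simp add: norm_eq_sqrt_inner real_sqrt_mult)
qed

lemma norm_cinner_le: "cmod (cinner x y) \<le> 2 * (norm (x::'a::complex_inner) * norm y)"
proof -
  have "Im (cinner x y) = - inner (\<i> *\<^sub>C x) y"
    by (simp add: inner_eq_Re_cinner cinner_scaleC_left)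
  then have "\<bar>Im (cinner x y)\<bar> \<le> norm x * norm y"
    using Cauchy_Schwarz_ineq2[of "\<i> *\<^sub>C x" y] by simp
  moreover have "\<bar>Re (cinner x y)\<bar> \<le> norm x * norm y"
    using Cauchy_Schwarz_ineq2[of x y] by (simp add: inner_eq_Re_cinner)
  ultimately show ?thesis
    using cmod_le[of "cinner x y"] by linarith
qed

instantiation complex :: chilbert_space
begin
definition "scaleC_complex (c::complex) (x::complex) = c * x"
definition "cinner_complex (x::complex) (y::complex) = x * cnj y"
instance
  by standard (auto simp: scaleC_complex_def cinner_complex_def inner_complex_def
      algebra_simps scaleR_conv_of_real)
end

text \<open>The Hilbert space direct sum of \<open>n = CARD('n)\<close> copies of \<open>'h\<close> is \<open>'h ^ 'n\<close>.\<close>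

instantiation vec :: (chilbert_space, finite) chilbert_space
begin
definition "scaleC_vec c (x::'a^'b) = (\<chi> i. c *\<^sub>C (x $ i))"
definition "cinner_vec (x::'a^'b) y = (\<Sum>i\<in>UNIV. cinner (x $ i) (y $ i))"
instance
proof
  fix x y z :: "'a^'b" and a b c :: complex and r :: real
  show "cinner x y = cnj (cinner y x)"
    unfolding cinner_vec_def cnj_sum by (rule sum.cong[OF refl], rule cinner_commute)
qed (simp_all add: scaleC_vec_def cinner_vec_def vec_eq_iff scaleC_add_right scaleC_add_left
      scaleR_scaleC cinner_add_left sum.distrib cinner_scaleC_left sum_distrib_left inner_vec_def
      inner_eq_Re_cinner)
end


section \<open>Square-summable families\<close>

text \<open>\<open>('s, 'a) ell2\<close> is the Hilbert space of square-summable families of vectors of \<open>'a\<close> indexed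
  by \<open>'s\<close>.\<close>

typedef (overloaded) ('s, 'a::real_normed_vector) ell2 =
  "{f :: 's \<Rightarrow> 'a. (\<lambda>s. (norm (f s))\<^sup>2) summable_on UNIV}"
  by (rule exI[of _ "\<lambda>_. 0"]) simp

setup_lifting type_definition_ell2

lemma ell2_add_summable:
  fixes f g :: "'s \<Rightarrow> 'a::real_normed_vector"
  assumes "(\<lambda>s. (norm (f s))\<^sup>2) summable_on UNIV" "(\<lambda>s. (norm (g s))\<^sup>2) summable_on UNIV"
  shows "(\<lambda>s. (norm (f s + g s))\<^sup>2) summable_on UNIV"
proof (rule summable_on_comparison_test)
  show "(\<lambda>s. 2 * ((norm (f s))\<^sup>2 + (norm (g s))\<^sup>2)) summable_on UNIV"
    by (intro summable_on_cmult_right summable_on_add assms)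
  fix s
  have "(norm (f s + g s))\<^sup>2 \<le> (norm (f s) + norm (g s))\<^sup>2"
    by (intro power_mono norm_triangle_ineq) auto
  also have "\<dots> \<le> 2 * ((norm (f s))\<^sup>2 + (norm (g s))\<^sup>2)"
    using sum_squares_bound[of "norm (f s)" "norm (g s)"] by (simp add: power2_sum)
  finally show "(norm (f s + g s))\<^sup>2 \<le> 2 * ((norm (f s))\<^sup>2 + (norm (g s))\<^sup>2)" .
qed auto

lemma ell2_prod_summable:
  fixes f g :: "'s \<Rightarrow> 'a::real_normed_vector"
  assumes "(\<lambda>s. (norm (f s))\<^sup>2) summable_on UNIV" "(\<lambda>s. (norm (g s))\<^sup>2) summable_on UNIV"
  shows "(\<lambda>s. norm (f s) * norm (g s)) summable_on UNIV"
proof (rule summable_on_comparison_test)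
  show "(\<lambda>s. (norm (f s))\<^sup>2 + (norm (g s))\<^sup>2) summable_on UNIV"
    by (intro summable_on_add assms)
  fix s
  have "0 \<le> norm (f s) * norm (g s)" by simp
  then show "norm (f s) * norm (g s) \<le> (norm (f s))\<^sup>2 + (norm (g s))\<^sup>2"
    using sum_squares_bound[of "norm (f s)" "norm (g s)"] by linarith
qed auto

lemma ell2_inner_summable:
  fixes f g :: "'s \<Rightarrow> 'a::real_inner"
  assumes "(\<lambda>s. (norm (f s))\<^sup>2) summable_on UNIV" "(\<lambda>s. (norm (g s))\<^sup>2) summable_on UNIV"
  shows "(\<lambda>s. inner (f s) (g s)) summable_on UNIV"
  by (rule abs_summable_summable, rule summable_on_comparison_test[OF ell2_prod_summable[OF assms]])
    (auto simp: Cauchy_Schwarz_ineq2)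

lemma ell2_cinner_summable:
  fixes f g :: "'s \<Rightarrow> 'a::complex_inner"
  assumes "(\<lambda>s. (norm (f s))\<^sup>2) summable_on UNIV" "(\<lambda>s. (norm (g s))\<^sup>2) summable_on UNIV"
  shows "(\<lambda>s. cinner (f s) (g s)) summable_on UNIV"
  by (rule abs_summable_summable, rule summable_on_comparison_test
        [OF summable_on_cmult_right[OF ell2_prod_summable[OF assms], of 2]])
    (auto simp: norm_cinner_le)

instantiation ell2 :: (type, real_normed_vector) real_vector
begin
lift_definition zero_ell2 :: "('a, 'b) ell2" is "\<lambda>_. 0" by simp
lift_definition plus_ell2 :: "('a, 'b) ell2 \<Rightarrow> ('a, 'b) ell2 \<Rightarrow> ('a, 'b) ell2"
  is "\<lambda>f g s. f s + g s" by (rule ell2_add_summable)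
lift_definition uminus_ell2 :: "('a, 'b) ell2 \<Rightarrow> ('a, 'b) ell2"
  is "\<lambda>f s. - f s" by simp
lift_definition minus_ell2 :: "('a, 'b) ell2 \<Rightarrow> ('a, 'b) ell2 \<Rightarrow> ('a, 'b) ell2"
  is "\<lambda>f g s. f s - g s"
  using ell2_add_summable[of _ "\<lambda>s. - _ s"] by simp
lift_definition scaleR_ell2 :: "real \<Rightarrow> ('a, 'b) ell2 \<Rightarrow> ('a, 'b) ell2"
  is "\<lambda>r f s. r *\<^sub>R f s"
  by (simp add: power_mult_distrib summable_on_cmult_right)
instance
  by standard (transfer; simp add: fun_eq_iff algebra_simps)+
end

instantiation ell2 :: (type, real_inner) real_inner
begin
lift_definition inner_ell2 :: "('a, 'b) ell2 \<Rightarrow> ('a, 'b) ell2 \<Rightarrow> real"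
  is "\<lambda>f g. \<Sum>\<^sub>\<infinity>s. inner (f s) (g s)" .
definition "norm_ell2 (x::('a, 'b) ell2) = sqrt (inner x x)"
definition "dist_ell2 (x::('a, 'b) ell2) y = norm (x - y)"
definition "sgn_ell2 (x::('a, 'b) ell2) = inverse (norm x) *\<^sub>R x"
definition "uniformity_ell2 = (INF e\<in>{0<..}. principal {(x::('a, 'b) ell2, y). dist x y < e})"
definition "open_ell2 (U::('a, 'b) ell2 set)
  \<longleftrightarrow> (\<forall>x\<in>U. eventually (\<lambda>(x', y). x' = x \<longrightarrow> y \<in> U) uniformity)"
instance
proof
  fix x y z :: "('a, 'b) ell2" and r :: real
  show "inner x y = inner y x"
    by transfer (simp add: inner_commute)
  show "inner (x + y) z = inner x z + inner y z"
    by transfer (simp add: inner_add_left infsum_add ell2_inner_summable)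
  show "inner (r *\<^sub>R x) y = r * inner x y"
    by transfer (simp add: infsum_cmult_right')
  show "0 \<le> inner x x"
    by transfer (simp add: infsum_nonneg)
  show "inner x x = 0 \<longleftrightarrow> x = 0"
  proof
    show "inner x x = 0 \<Longrightarrow> x = 0"
    proof transfer
      fix f :: "'a \<Rightarrow> 'b"
      assume f: "(\<lambda>s. (norm (f s))\<^sup>2) summable_on UNIV" and 0: "(\<Sum>\<^sub>\<infinity>s. inner (f s) (f s)) = 0"
      have "inner (f s) (f s) = 0" for s
        by (rule nonneg_infsum_le_0D[of "\<lambda>s. inner (f s) (f s)" UNIV])
          (use 0 ell2_inner_summable[OF f f] in auto)
      then show "f = (\<lambda>_. 0)" by auto
    qed
  qed (transfer, simp)
qed (simp_all only: norm_ell2_def dist_ell2_def sgn_ell2_def uniformity_ell2_def open_ell2_def)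
end

lemma ell2_finite_norm_le:
  "finite F \<Longrightarrow> (\<Sum>s\<in>F. (norm (Rep_ell2 (x::('s, 'a::real_inner) ell2) s))\<^sup>2) \<le> (norm x)\<^sup>2"
  by (simp add: power2_norm_eq_inner, transfer)
    (rule finite_sum_le_infsum, auto simp: ell2_inner_summable)

lemma ell2_norm_leI:
  assumes "e \<ge> 0" and "\<And>F. finite F \<Longrightarrow> (\<Sum>s\<in>F. (norm (Rep_ell2 x s))\<^sup>2) \<le> e\<^sup>2"
  shows "norm (x::('s, 'a::real_inner) ell2) \<le> e"
proof -
  have "inner x x \<le> e\<^sup>2"
    using assms(2)
    by (transfer) (rule infsum_le_finite_sums, auto simp: ell2_inner_summable power2_norm_eq_inner)
  then show ?thesis
    using assms(1) by (metis power2_le_imp_le power2_norm_eq_inner)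
qed

instance ell2 :: (type, "{real_inner, complete_space}") complete_space
proof
  fix X :: "nat \<Rightarrow> ('a, 'b) ell2"
  assume X: "Cauchy X"
  have coord: "norm (Rep_ell2 x s) \<le> norm x" for x :: "('a, 'b) ell2" and s
    using ell2_finite_norm_le[of "{s}" x] by (rule_tac power2_le_imp_le) simp_all
  have "Cauchy (\<lambda>n. Rep_ell2 (X n) s)" for s
  proof (rule CauchyI)
    fix e :: real assume "e > 0"
    then obtain M where M: "norm (X m - X n) < e" if "m \<ge> M" "n \<ge> M" for m n
      using CauchyD[OF X] by blast
    have "norm (Rep_ell2 (X m) s - Rep_ell2 (X n) s) < e" if "m \<ge> M" "n \<ge> M" for m n
      using coord[of "X m - X n" s] M[OF that] by (simp add: minus_ell2.rep_eq)
    then show "\<exists>M. \<forall>m\<ge>M. \<forall>n\<ge>M. norm (Rep_ell2 (X m) s - Rep_ell2 (X n) s) < e"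
      by blast
  qed
  then have L: "(\<lambda>n. Rep_ell2 (X n) s) \<longlonglongrightarrow> lim (\<lambda>n. Rep_ell2 (X n) s)" for s
    by (simp add: Cauchy_convergent_iff convergent_LIMSEQ_iff)
  define L where "L s = lim (\<lambda>n. Rep_ell2 (X n) s)" for s
  note L = L[folded L_def]
  have fin: "\<exists>M. \<forall>n\<ge>M. \<forall>F. finite F \<longrightarrow> (\<Sum>s\<in>F. (norm (Rep_ell2 (X n) s - L s))\<^sup>2) \<le> e\<^sup>2"
    if "e > 0" for e
  proof -
    obtain M where M: "norm (X m - X n) < e" if "m \<ge> M" "n \<ge> M" for m n
      using CauchyD[OF X \<open>e > 0\<close>] by blast
    have "(\<Sum>s\<in>F. (norm (Rep_ell2 (X n) s - L s))\<^sup>2) \<le> e\<^sup>2" if "n \<ge> M" "finite F" for n F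
    proof (rule LIMSEQ_le_const2)
      show "(\<lambda>m. \<Sum>s\<in>F. (norm (Rep_ell2 (X n) s - Rep_ell2 (X m) s))\<^sup>2)
          \<longlonglongrightarrow> (\<Sum>s\<in>F. (norm (Rep_ell2 (X n) s - L s))\<^sup>2)"
        by (intro tendsto_intros L)
      have "(\<Sum>s\<in>F. (norm (Rep_ell2 (X n) s - Rep_ell2 (X m) s))\<^sup>2) \<le> e\<^sup>2" if "m \<ge> M" for m
      proof -
        have "(\<Sum>s\<in>F. (norm (Rep_ell2 (X n - X m) s))\<^sup>2) \<le> (norm (X n - X m))\<^sup>2"
          by (rule ell2_finite_norm_le) fact
        also have "\<dots> \<le> e\<^sup>2"
          using M[of n m] \<open>n \<ge> M\<close> \<open>m \<ge> M\<close> by (intro power_mono) auto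
        finally show ?thesis by (simp add: minus_ell2.rep_eq)
      qed
      then show "\<exists>N. \<forall>m\<ge>N. (\<Sum>s\<in>F. (norm (Rep_ell2 (X n) s - Rep_ell2 (X m) s))\<^sup>2) \<le> e\<^sup>2"
        by blast
    qed
    then show ?thesis by blast
  qed
  obtain M where M: "\<And>F. finite F \<Longrightarrow> (\<Sum>s\<in>F. (norm (Rep_ell2 (X M) s - L s))\<^sup>2) \<le> 1\<^sup>2"
    using fin[of 1] by auto
  have "(\<lambda>s. (norm (Rep_ell2 (X M) s - L s))\<^sup>2) summable_on UNIV"
    using M by (intro nonneg_bdd_above_summable_on bdd_aboveI[of _ 1]) auto
  then have "(\<lambda>s. (norm (Rep_ell2 (X M) s + - (Rep_ell2 (X M) s - L s)))\<^sup>2) summable_on UNIV"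
    using Rep_ell2[of "X M"] by (intro ell2_add_summable) (auto simp: norm_minus_commute)
  then have "Rep_ell2 (Abs_ell2 L) = L"
    by (subst Abs_ell2_inverse) auto
  then have "\<exists>M. \<forall>n\<ge>M. norm (X n - Abs_ell2 L) \<le> e" if "e > 0" for e
  proof -
    obtain M where M: "\<And>n F. n \<ge> M \<Longrightarrow> finite F
        \<Longrightarrow> (\<Sum>s\<in>F. (norm (Rep_ell2 (X n) s - L s))\<^sup>2) \<le> e\<^sup>2"
      using fin[OF \<open>e > 0\<close>] by blast
    have "norm (X n - Abs_ell2 L) \<le> e" if "n \<ge> M" for n
      using M[OF that] \<open>e > 0\<close> \<open>Rep_ell2 (Abs_ell2 L) = L\<close>
      by (intro ell2_norm_leI) (simp_all add: minus_ell2.rep_eq)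
    then show ?thesis by blast
  qed
  then have "\<exists>M. \<forall>n\<ge>M. norm (X n - Abs_ell2 L) < e" if "e > 0" for e
  proof -
    obtain M where "\<forall>n\<ge>M. norm (X n - Abs_ell2 L) \<le> e / 2"
      using \<open>\<And>e. e > 0 \<Longrightarrow> \<exists>M. \<forall>n\<ge>M. norm (X n - Abs_ell2 L) \<le> e\<close>[of "e / 2"] \<open>e > 0\<close> by auto
    then show ?thesis
      using \<open>e > 0\<close> by (intro exI[of _ M]) force
  qed
  then have "X \<longlonglongrightarrow> Abs_ell2 L"
    by (auto intro: LIMSEQ_I)
  then show "convergent X"
    by (auto simp: convergent_def)
qed

instantiation ell2 :: (type, chilbert_space) chilbert_space
begin
lift_definition scaleC_ell2 :: "complex \<Rightarrow> ('a, 'b) ell2 \<Rightarrow> ('a, 'b) ell2"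
  is "\<lambda>c f s. c *\<^sub>C f s"
  by (simp add: power_mult_distrib summable_on_cmult_right)
lift_definition cinner_ell2 :: "('a, 'b) ell2 \<Rightarrow> ('a, 'b) ell2 \<Rightarrow> complex"
  is "\<lambda>f g. \<Sum>\<^sub>\<infinity>s. cinner (f s) (g s)" .
instance
proof
  fix x y z :: "('a, 'b) ell2" and c :: complex
  show "cinner x y = cnj (cinner y x)"
  proof transfer
    fix f g :: "'a \<Rightarrow> 'b"
    show "(\<Sum>\<^sub>\<infinity>s. cinner (f s) (g s)) = cnj (\<Sum>\<^sub>\<infinity>s. cinner (g s) (f s))"
      unfolding infsum_cnj[symmetric] by (rule infsum_cong, rule cinner_commute)
  qed
  show "cinner (x + y) z = cinner x z + cinner y z"
    by transfer (simp add: cinner_add_left infsum_add ell2_cinner_summable)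
  show "cinner (c *\<^sub>C x) y = c * cinner x y"
    by transfer (simp add: cinner_scaleC_left infsum_cmult_right')
  show "inner x y = Re (cinner x y)"
    by transfer (simp add: inner_eq_Re_cinner infsum_Re ell2_cinner_summable)
qed (transfer; simp add: fun_eq_iff scaleC_add_right scaleC_add_left scaleR_scaleC)+
end


section \<open>Operators and subspaces\<close>

definition bounded_clinear :: "('a::complex_inner \<Rightarrow> 'b::complex_inner) \<Rightarrow> bool" where
  "bounded_clinear A \<longleftrightarrow> bounded_linear A \<and> (\<forall>c x. A (c *\<^sub>C x) = c *\<^sub>C A x)"

definition cadj :: "('a::complex_inner \<Rightarrow> 'b::complex_inner) \<Rightarrow> 'b \<Rightarrow> 'a" where
  "cadj A = (THE B. \<forall>x y. cinner (A x) y = cinner x (B y))"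

text \<open>On complex numbers, \<open>0 \<le> z\<close> means that \<open>z\<close> is real and nonnegative.\<close>

definition positive_op :: "('a::complex_inner \<Rightarrow> 'a) \<Rightarrow> bool" where
  "positive_op A \<longleftrightarrow> bounded_clinear A \<and> (\<forall>x. 0 \<le> cinner (A x) x)"

definition op_sqrt :: "('a::complex_inner \<Rightarrow> 'a) \<Rightarrow> 'a \<Rightarrow> 'a" where
  "op_sqrt A = (THE B. positive_op B \<and> B \<circ> B = A)"

definition unitary_op :: "('a::complex_inner \<Rightarrow> 'b::complex_inner) \<Rightarrow> bool" where
  "unitary_op U \<longleftrightarrow> bounded_clinear U \<and> surj U \<and> (\<forall>x y. cinner (U x) (U y) = cinner x y)"

definition orth_compl :: "'a::complex_inner set \<Rightarrow> 'a set" where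
  "orth_compl S = {x. \<forall>y\<in>S. cinner x y = 0}"

definition orth_proj :: "'a::complex_inner set \<Rightarrow> 'a \<Rightarrow> 'a" where
  "orth_proj S x = (THE y. y \<in> S \<and> x - y \<in> orth_compl S)"

definition hdim :: "'a::complex_inner set \<Rightarrow> enat" where
  "hdim S = (if \<exists>B. finite B \<and> complex_vector.span B = S
             then enat (complex_vector.dim S) else \<infinity>)"

definition op_rank :: "('a::complex_inner \<Rightarrow> 'b::complex_inner) \<Rightarrow> enat" where
  "op_rank A = hdim (closure (range A))"

text \<open>For closed subspaces \<open>D\<close>, \<open>E\<close>, the space \<open>B(D, E)\<close> is identified with the set of bounded
  operators between the ambient spaces that have range in \<open>E\<close> and vanish on the orthogonal
  complement of \<open>D\<close>.  Under this identification, the restriction of \<open>A\<close> to \<open>D\<close> is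
  \<open>A \<circ> orth_proj D\<close>.\<close>

definition ops_between :: "'a::complex_inner set \<Rightarrow> 'b::complex_inner set \<Rightarrow> ('a \<Rightarrow> 'b) set" where
  "ops_between D E = {A. bounded_clinear A \<and> range A \<subseteq> E \<and> (\<forall>x\<in>orth_compl D. A x = 0)}"

definition op_restrict :: "('a::complex_inner \<Rightarrow> 'b) \<Rightarrow> 'a set \<Rightarrow> 'a \<Rightarrow> 'b" where
  "op_restrict A D = A \<circ> orth_proj D"


section \<open>Tensor products\<close>

text \<open>\<open>hilbert_tensor t\<close>: the Hilbert space \<open>'e\<close>, together with the map \<open>t\<close> sending \<open>(g, k)\<close> to the
  elementary tensor, is a realisation of the Hilbert tensor product of \<open>'g\<close> and \<open>'k\<close>.
  (Bilinearity of \<open>t\<close> follows from the inner product identity.)\<close>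

definition hilbert_tensor ::
    "('g::chilbert_space \<Rightarrow> 'k::chilbert_space \<Rightarrow> 'e::chilbert_space) \<Rightarrow> bool" where
  "hilbert_tensor t \<longleftrightarrow>
     (\<forall>g g' k k'. cinner (t g k) (t g' k') = cinner g g' * cinner k k') \<and>
     closure (complex_vector.span {t g k |g k. True}) = UNIV"

text \<open>The operator \<open>X \<otimes> A\<close>, relative to realisations \<open>t\<close>, \<open>u\<close> of the two tensor products.\<close>

definition op_tensor ::
    "('g \<Rightarrow> 'k \<Rightarrow> 'e::complex_inner) \<Rightarrow> ('g' \<Rightarrow> 'l \<Rightarrow> 'f::complex_inner)
      \<Rightarrow> ('g \<Rightarrow> 'g') \<Rightarrow> ('k \<Rightarrow> 'l) \<Rightarrow> 'e \<Rightarrow> 'f" where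
  "op_tensor t u X A = (THE B. bounded_clinear B \<and> (\<forall>g k. B (t g k) = u (X g) (A k)))"

text \<open>A realisation of \<open>G \<otimes> H\<close> on \<open>'e\<close> yields one of \<open>G \<otimes> H\<^sup>(\<^sup>n\<^sup>)\<close> on \<open>'e ^ 'n\<close>; this is the canonical
  identification of \<open>G \<otimes> H\<^sup>(\<^sup>n\<^sup>)\<close> with \<open>(G \<otimes> H)\<^sup>(\<^sup>n\<^sup>)\<close>.\<close>

definition tensor_vec :: "('g \<Rightarrow> 'h \<Rightarrow> 'e) \<Rightarrow> 'g \<Rightarrow> 'h ^ 'n \<Rightarrow> 'e ^ 'n" where
  "tensor_vec t g v = (\<chi> i. t g (v $ i))"

lemma hilbert_tensor_tensor_vec:
  fixes t :: "'g::chilbert_space \<Rightarrow> 'h::chilbert_space \<Rightarrow> 'e::chilbert_space"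
  assumes t: "hilbert_tensor t"
  shows "hilbert_tensor (tensor_vec t :: 'g \<Rightarrow> 'h ^ 'n::finite \<Rightarrow> 'e ^ 'n)"
  unfolding hilbert_tensor_def
proof (intro conjI allI)
  fix g g' :: 'g and k k' :: "'h ^ 'n"
  show "cinner (tensor_vec t g k) (tensor_vec t g' k') = cinner g g' * cinner k k'"
    using t by (simp add: hilbert_tensor_def tensor_vec_def cinner_vec_def sum_distrib_left)
next
  let ?B = "{tensor_vec t g k |g (k :: 'h ^ 'n). True}"
  let ?S = "complex_vector.span ?B"
  have t0: "t g 0 = 0" for g
  proof -
    have "cinner (t g 0) (t g 0) = cinner g g * cinner (0::'h) 0"
      using t by (simp add: hilbert_tensor_def)
    also have "cinner (0::'h) 0 = 0"
      by (metis cinner_scaleC_left complex_vector.scale_zero_left mult_zero_left)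
    finally show ?thesis
      using inner_eq_zero_iff[of "t g 0"] by (simp add: inner_eq_Re_cinner)
  qed
  have axis_span: "axis i z \<in> ?S" if "z \<in> complex_vector.span {t g k |g k. True}" for i z
    using that
  proof (induction rule: complex_vector.span_induct_alt)
    case base
    have "axis i (0::'e) = (0 :: 'e ^ 'n)" by (simp add: axis_def vec_eq_iff)
    then show ?case by (simp only: complex_vector.span_zero)
  next
    case (step c x y)
    then obtain g k where x: "x = t g k" by blast
    have "axis i (c *\<^sub>C x + y) = c *\<^sub>C tensor_vec t g (axis i k) + (axis i y :: 'e ^ 'n)"
      by (auto simp: x axis_def vec_eq_iff tensor_vec_def scaleC_vec_def t0)
    moreover have "tensor_vec t g (axis i k) \<in> ?S"
      by (intro complex_vector.span_base) blast
    ultimately show ?case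
      using step by (simp add: complex_vector.span_add complex_vector.span_scale)
  qed
  have "y \<in> closure ?S" for y :: "'e ^ 'n"
    unfolding closure_approachable
  proof (intro allI impI)
    fix e :: real assume "e > 0"
    define d where "d = e / (2 * real CARD('n))"
    have "d > 0" using \<open>e > 0\<close> by (simp add: d_def)
    have "\<exists>w \<in> complex_vector.span {t g k |g k. True}. dist w (y $ i) < d" for i
    proof -
      have "y $ i \<in> closure (complex_vector.span {t g k |g k. True})"
        using t unfolding hilbert_tensor_def by blast
      then show ?thesis
        using \<open>d > 0\<close> unfolding closure_approachable by blast
    qed
    then obtain w where w: "\<And>i. w i \<in> complex_vector.span {t g k |g k. True}"
        "\<And>i. dist (w i) (y $ i) < d"
      by (metis (no_types))
    define z where "z = (\<Sum>i\<in>UNIV. axis i (w i) :: 'e ^ 'n)"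
    have "z $ j = w j" for j
      by (simp add: z_def axis_def if_distrib cong: if_cong)
    then have "norm ((z - y) $ i) \<le> d" for i
      using w(2)[of i] by (simp add: dist_norm)
    then have "(\<Sum>i\<in>UNIV. norm ((z - y) $ i)) \<le> real CARD('n) * d"
      using sum_bounded_above[of "UNIV :: 'n set" "\<lambda>i. norm ((z - y) $ i)" d] by simp
    then have "norm (z - y) \<le> real CARD('n) * d"
      unfolding norm_vec_def by (rule order_trans[rotated]) (rule L2_set_le_sum, simp)
    also have "\<dots> < e" using \<open>e > 0\<close> by (simp add: d_def)
    finally have "dist z y < e" by (simp add: dist_norm)
    moreover have "z \<in> ?S"
      unfolding z_def by (intro complex_vector.span_sum axis_span w)
    ultimately show "\<exists>z\<in>?S. dist z y < e" by blast
  qed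
  then show "closure ?S = UNIV" by blast
qed

text \<open>The tensor product of \<open>\<ell>\<^sup>2(S)\<close> and \<open>K\<close>, realised as \<open>\<ell>\<^sup>2(S; K)\<close>.\<close>

lift_definition ell2_tensor :: "('s, complex) ell2 \<Rightarrow> 'k::chilbert_space \<Rightarrow> ('s, 'k) ell2"
  is "\<lambda>f k s. f s *\<^sub>C k"
  by (simp add: power_mult_distrib summable_on_cmult_left)

lift_definition ell2_unit :: "'s \<Rightarrow> ('s, complex) ell2" is "\<lambda>s r. if r = s then 1 else 0"
proof -
  fix s :: 's
  have "(\<lambda>r. (cmod (if r = s then 1 else 0))\<^sup>2) summable_on {s}" by simp
  then show "(\<lambda>r. (cmod (if r = s then 1 else 0))\<^sup>2) summable_on UNIV"
    by (subst summable_on_cong_neutral[where T = "{s}"]) auto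
qed

lemma hilbert_tensor_ell2_tensor:
  "hilbert_tensor (ell2_tensor :: ('s, complex) ell2 \<Rightarrow> 'k::chilbert_space \<Rightarrow> ('s, 'k) ell2)"
  unfolding hilbert_tensor_def
proof (intro conjI allI)
  fix f f' :: "('s, complex) ell2" and k k' :: 'k
  show "cinner (ell2_tensor f k) (ell2_tensor f' k') = cinner f f' * cinner k k'"
  proof transfer
    fix f f' :: "'s \<Rightarrow> complex" and k k' :: 'k
    have "cinner (f s *\<^sub>C k) (f' s *\<^sub>C k') = cinner (f s) (f' s) * cinner k k'" for s
      using cinner_commute[of k "f' s *\<^sub>C k'"] cinner_commute[of k k']
      by (simp add: cinner_scaleC_left cinner_complex_def)
    then show "(\<Sum>\<^sub>\<infinity>s. cinner (f s *\<^sub>C k) (f' s *\<^sub>C k'))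
        = (\<Sum>\<^sub>\<infinity>s. cinner (f s) (f' s)) * cinner k k'"
      by (simp add: infsum_cmult_left')
  qed
next
  let ?S = "complex_vector.span {ell2_tensor (f :: ('s, complex) ell2) (k::'k) |f k. True}"
  have "x \<in> closure ?S" for x :: "('s, 'k) ell2"
    unfolding closure_approachable
  proof (intro allI impI)
    fix e :: real assume "e > 0"
    define y where "y F = (\<Sum>s\<in>F. ell2_tensor (ell2_unit s) (Rep_ell2 x s))" for F
    have Rep_sum: "Rep_ell2 (sum g F) r = (\<Sum>s\<in>F. Rep_ell2 (g s) r)"
      if "finite F" for g :: "'s \<Rightarrow> ('s, 'k) ell2" and F r
      using that by induction (simp_all add: zero_ell2.rep_eq plus_ell2.rep_eq)
    have Rep_y: "Rep_ell2 (y F) r = (if r \<in> F then Rep_ell2 x r else 0)" if "finite F" for F r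
    proof -
      have "Rep_ell2 (y F) r = (\<Sum>s\<in>F. if r = s then Rep_ell2 x s else 0)"
        unfolding y_def Rep_sum[OF that]
        by (intro sum.cong) (auto simp: ell2_tensor.rep_eq ell2_unit.rep_eq)
      then show ?thesis using that by simp
    qed
    have smb: "(\<lambda>s. (norm (Rep_ell2 x s))\<^sup>2) summable_on UNIV"
      using Rep_ell2[of x] by simp
    define I where "I = (\<Sum>\<^sub>\<infinity>s. (norm (Rep_ell2 x s))\<^sup>2)"
    have "(sum (\<lambda>s. (norm (Rep_ell2 x s))\<^sup>2) \<longlongrightarrow> I) (finite_subsets_at_top UNIV)"
      using has_sum_infsum[OF smb] by (simp add: has_sum_def I_def)
    then have "eventually (\<lambda>F. sum (\<lambda>s. (norm (Rep_ell2 x s))\<^sup>2) F > I - (e / 2)\<^sup>2)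
        (finite_subsets_at_top UNIV)"
      by (rule order_tendstoD) (use \<open>e > 0\<close> in simp)
    then obtain F where F: "finite F" "sum (\<lambda>s. (norm (Rep_ell2 x s))\<^sup>2) F > I - (e / 2)\<^sup>2"
      by (auto simp: eventually_finite_subsets_at_top)
    have "norm (y F - x) \<le> e / 2"
    proof (rule ell2_norm_leI)
      fix G :: "'s set" assume "finite G"
      have "(\<Sum>s\<in>G. (norm (Rep_ell2 (y F - x) s))\<^sup>2) = (\<Sum>s\<in>G - F. (norm (Rep_ell2 x s))\<^sup>2)"
        using \<open>finite G\<close> F(1)
        by (intro sum.mono_neutral_cong_right) (auto simp: minus_ell2.rep_eq Rep_y)
      also have "\<dots> = (\<Sum>s\<in>G \<union> F. (norm (Rep_ell2 x s))\<^sup>2) - (\<Sum>s\<in>F. (norm (Rep_ell2 x s))\<^sup>2)"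
        using \<open>finite G\<close> F(1) by (subst sum_diff[symmetric]) (auto intro: sum.cong)
      also have "\<dots> \<le> I - (\<Sum>s\<in>F. (norm (Rep_ell2 x s))\<^sup>2)"
        unfolding I_def using \<open>finite G\<close> F(1)
        by (intro diff_right_mono finite_sum_le_infsum smb) auto
      finally show "(\<Sum>s\<in>G. (norm (Rep_ell2 (y F - x) s))\<^sup>2) \<le> (e / 2)\<^sup>2"
        using F(2) by linarith
    qed (use \<open>e > 0\<close> in simp)
    moreover have "y F \<in> ?S"
      unfolding y_def by (intro complex_vector.span_sum complex_vector.span_base) blast
    ultimately show "\<exists>y\<in>?S. dist y x < e"
      using \<open>e > 0\<close> by (intro bexI[of _ "y F"]) (simp_all add: dist_norm)
  qed
  then show "closure ?S = UNIV" by blast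
qed


section \<open>Row contractions\<close>

text \<open>An \<open>n\<close>-tuple of operators is a family indexed by a finite type \<open>'n\<close>, \<open>n = CARD('n)\<close>; the free
  semigroup on \<open>n\<close> generators consists of the words \<open>'n list\<close>.\<close>

primrec word_op :: "('n \<Rightarrow> 'h \<Rightarrow> 'h) \<Rightarrow> 'n list \<Rightarrow> 'h \<Rightarrow> 'h" where
  "word_op X [] = id"
| "word_op X (i # \<alpha>) = X i \<circ> word_op X \<alpha>"

definition row_op :: "('n::finite \<Rightarrow> 'h \<Rightarrow> 'k::comm_monoid_add) \<Rightarrow> 'h ^ 'n \<Rightarrow> 'k" where
  "row_op X v = (\<Sum>i\<in>UNIV. X i (v $ i))"

definition row_contraction :: "('n::finite \<Rightarrow> 'h::chilbert_space \<Rightarrow> 'h) \<Rightarrow> bool" where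
  "row_contraction T \<longleftrightarrow>
     (\<forall>i. bounded_clinear (T i)) \<and> positive_op (\<lambda>h. h - (\<Sum>i\<in>UNIV. T i (cadj (T i) h)))"

definition strict_row_contraction :: "('n::finite \<Rightarrow> 'g::chilbert_space \<Rightarrow> 'g) \<Rightarrow> bool" where
  "strict_row_contraction X \<longleftrightarrow>
     (\<forall>i. bounded_clinear (X i)) \<and> onorm (\<lambda>g. \<Sum>i\<in>UNIV. X i (cadj (X i) g)) < 1"

definition unitarily_equivalent ::
    "('n \<Rightarrow> 'h::chilbert_space \<Rightarrow> 'h) \<Rightarrow> ('n \<Rightarrow> 'k::chilbert_space \<Rightarrow> 'k) \<Rightarrow> bool" where
  "unitarily_equivalent X X' \<longleftrightarrow>
     (\<exists>U :: 'h \<Rightarrow> 'k. unitary_op U \<and> (\<forall>i. U \<circ> X i = X' i \<circ> U))"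

definition pure_row :: "('n::finite \<Rightarrow> 'h::chilbert_space \<Rightarrow> 'h) \<Rightarrow> bool" where
  "pure_row T \<longleftrightarrow>
     (\<forall>h. (\<lambda>k. \<Sum>\<alpha> | length \<alpha> = k. (norm (cadj (word_op T \<alpha>) h))\<^sup>2) \<longlonglongrightarrow> 0)"

definition row_isometry :: "('n::finite \<Rightarrow> 'h::chilbert_space \<Rightarrow> 'h) \<Rightarrow> bool" where
  "row_isometry T \<longleftrightarrow> (\<forall>i j. cadj (T i) \<circ> T j = (if i = j then id else (\<lambda>_. 0)))"

definition pure_isometry :: "('n::finite \<Rightarrow> 'h::chilbert_space \<Rightarrow> 'h) \<Rightarrow> bool" where
  "pure_isometry T \<longleftrightarrow> row_contraction T \<and> pure_row T \<and> row_isometry T"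

definition defect :: "('n::finite \<Rightarrow> 'h::chilbert_space \<Rightarrow> 'h) \<Rightarrow> 'h \<Rightarrow> 'h" where
  "defect T = op_sqrt (\<lambda>h. h - (\<Sum>i\<in>UNIV. T i (cadj (T i) h)))"

definition defect_star :: "('n::finite \<Rightarrow> 'h::chilbert_space \<Rightarrow> 'h) \<Rightarrow> 'h ^ 'n \<Rightarrow> 'h ^ 'n" where
  "defect_star T = op_sqrt (\<lambda>v. v - cadj (row_op T) (row_op T v))"

definition defect_space :: "('n::finite \<Rightarrow> 'h::chilbert_space \<Rightarrow> 'h) \<Rightarrow> 'h set" where
  "defect_space T = closure (range (defect T))"

definition defect_star_space ::
    "('n::finite \<Rightarrow> 'h::chilbert_space \<Rightarrow> 'h) \<Rightarrow> ('h ^ 'n) set" where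
  "defect_star_space T = closure (range (defect_star T))"


section \<open>The characteristic function\<close>

text \<open>\<open>t\<close> is a realisation of \<open>G \<otimes> H\<close> on \<open>'e\<close>, for an arbitrary Hilbert space \<open>G = 'g\<close> and \<open>H = 'h\<close>. The
  spaces \<open>G \<otimes> D\<close>, with \<open>D\<close> the defect space of \<open>T\<close> or of its adjoint, are regarded as subspaces
  of \<open>G \<otimes> H\<close> and \<open>(G \<otimes> H)\<^sup>(\<^sup>n\<^sup>)\<close>, and operators on them are extended by \<open>0\<close> as for
  \<^const>\<open>ops_between\<close>.\<close>

definition char_fun ::
    "('g::chilbert_space \<Rightarrow> 'h::chilbert_space \<Rightarrow> 'e::chilbert_space)
      \<Rightarrow> ('n::finite \<Rightarrow> 'h \<Rightarrow> 'h) \<Rightarrow> ('n \<Rightarrow> 'g \<Rightarrow> 'g) \<Rightarrow> 'e ^ 'n \<Rightarrow> 'e" where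
  "char_fun t T X y =
     - op_tensor (tensor_vec t) t id (op_restrict (row_op T) (defect_star_space T)) y
     + op_tensor t t id (defect T)
         (inv (\<lambda>z. z - (\<Sum>i\<in>UNIV. op_tensor t t (X i) (cadj (T i)) z))
           (row_op (\<lambda>i. op_tensor t t (X i) id)
             (op_tensor (tensor_vec t) (tensor_vec t) id
               (op_restrict (defect_star T) (defect_star_space T)) y)))"

text \<open>\<open>A\<close> is a family of coefficients of the characteristic function over the Hilbert space \<open>'g\<close>;
  the series \<open>\<Sum>k. \<Sum>|\<alpha>|=k. X\<^sub>\<alpha> \<otimes> A\<^sub>\<alpha>\<close> converges in operator norm.\<close>

definition char_expansion ::
    "('g::chilbert_space \<Rightarrow> 'h::chilbert_space \<Rightarrow> 'e::chilbert_space)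
      \<Rightarrow> ('n::finite \<Rightarrow> 'h \<Rightarrow> 'h) \<Rightarrow> ('n list \<Rightarrow> 'h ^ 'n \<Rightarrow> 'h) \<Rightarrow> bool" where
  "char_expansion t T A \<longleftrightarrow>
     (\<forall>\<alpha>. A \<alpha> \<in> ops_between (defect_star_space T) (defect_space T)) \<and>
     (\<forall>X. strict_row_contraction X \<longrightarrow>
        (\<lambda>N. onorm (\<lambda>y. char_fun t T X y
           - (\<Sum>k<N. \<Sum>\<alpha> | length \<alpha> = k. op_tensor (tensor_vec t) t (word_op X \<alpha>) (A \<alpha>) y)))
        \<longlonglongrightarrow> 0)"

text \<open>The full Fock space, with orthonormal basis \<open>ell2_unit \<alpha>\<close>.\<close>

type_synonym 'n fock = "('n list, complex) ell2"

text \<open>The coefficients do not depend on the auxiliary Hilbert space. The Fock space is large enough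
  to determine them: at \<open>X\<^sub>i = r S\<^sub>i\<close> with the left creation operators \<open>S\<^sub>i\<close> and \<open>0 < r < 1\<close>, one has
  \<open>X\<^sub>\<alpha> 1 = r\<^bsup>|\<alpha>|\<^esup> e\<^sub>\<alpha>\<close>.\<close>

definition char_coeff ::
    "('n::finite \<Rightarrow> 'h::chilbert_space \<Rightarrow> 'h) \<Rightarrow> 'n list \<Rightarrow> 'h ^ 'n \<Rightarrow> 'h" where
  "char_coeff T = (THE A. char_expansion (ell2_tensor :: 'n fock \<Rightarrow> 'h \<Rightarrow> ('n list, 'h) ell2) T A)"

definition char_degree :: "('n::finite \<Rightarrow> 'h::chilbert_space \<Rightarrow> 'h) \<Rightarrow> enat" where
  "char_degree T =
     (let S = {\<alpha>. char_coeff T \<alpha> \<noteq> (\<lambda>_. 0)}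
      in if finite S then enat (Max (insert 0 (length ` S))) else \<infinity>)"


section \<open>The Poisson kernel and the map \<open>\<Gamma>\<close>\<close>

definition poisson_kernel ::
    "('n::finite \<Rightarrow> 'h::chilbert_space \<Rightarrow> 'h) \<Rightarrow> 'h \<Rightarrow> ('n list, 'h) ell2" where
  "poisson_kernel T h = (\<Sum>\<^sub>\<infinity>\<alpha>. ell2_tensor (ell2_unit \<alpha>) (defect T (cadj (word_op T \<alpha>) h)))"

definition defect_tail :: "('n::finite \<Rightarrow> 'h::chilbert_space \<Rightarrow> 'h) \<Rightarrow> nat \<Rightarrow> 'h set" where
  "defect_tail T k =
     closure (complex_vector.span {word_op T \<beta> (defect T h) |\<beta> h. k \<le> length \<beta>})"

definition Gamma_map ::
    "('n::finite \<Rightarrow> 'h::chilbert_space \<Rightarrow> 'h) \<Rightarrow> enat \<times> enat \<times> enat" where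
  "Gamma_map T =
     ((case char_degree T of
         enat m \<Rightarrow> hdim (defect_tail T m \<inter> orth_compl (defect_tail T (Suc m)))
       | \<infinity> \<Rightarrow> hdim (defect_space T)),
      char_degree T,
      hdim {h. poisson_kernel T h = 0})"

end

theory Submission
  imports Defs
begin

text \<open>
  Everything rests on the explicit form of the coefficients of \<open>\<Theta>\<^sub>T\<close>. With \<open>W = \<Sum>i. X\<^sub>i \<otimes> T\<^sub>i\<^sup>*\<close>, a strict
  contraction, the Neumann series of \<open>(I - W)\<^sup>-\<^sup>1\<close> expands \<open>\<Theta>\<^sub>T(X)\<close> over words: the coefficient of the
  word \<open>\<alpha> i\<close> is \<open>\<Delta>\<^sub>T T\<^sup>*\<^sub>\<alpha> P\<^sub>i \<Delta>\<^sub>T\<^sub>*\<close>, where \<open>T\<^sup>*\<^sub>\<alpha>\<close> is the product of the adjoints in the order of the letters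
  of \<open>\<alpha>\<close> and \<open>P\<^sub>i\<close> the projection to the component \<open>i\<close>. Creation operators on the Fock space show that
  no other coefficients are possible (\<open>char_coeff_eq\<close>). On the other side \<open>K\<^sub>T h = 0\<close> means that
  \<open>\<Delta>\<^sub>T T\<^sub>\<alpha>\<^sup>*h = 0\<close> for all \<open>\<alpha>\<close> (\<open>poisson_kernel_eq_0_iff\<close>). Hence \<open>\<Theta>\<^sub>T\<close> has degree \<open>0\<close> if and only if \<open>K\<^sub>T\<close>
  annihilates all components of vectors in the range of \<open>\<Delta>\<^sub>T\<^sub>*\<close>.

  If \<open>K\<^sub>T\<close> is injective and \<open>\<Theta>\<^sub>T\<close> has degree \<open>0\<close>, then \<open>\<Delta>\<^sub>T\<^sub>* = 0\<close>, so \<open>T\<close> is an isometry. For an isometry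
  \<open>\<Delta>\<^sub>T = I - TT\<^sup>*\<close> is the projection to the wandering space \<open>\<Inter>i. ker T\<^sub>i\<^sup>*\<close>; injectivity of \<open>K\<^sub>T\<close> says that the
  vectors \<open>T\<^sub>\<alpha>\<Delta>\<^sub>T h\<close> are total, and on these \<open>\<Sum>|\<alpha>|=k. \<parallel>T\<^sub>\<alpha>\<^sup>*x\<parallel>\<^sup>2\<close> is eventually zero, so \<open>T\<close> is pure.
  Conversely an isometry has \<open>\<Delta>\<^sub>T\<^sub>* = 0\<close>, hence degree \<open>0\<close>, and the identity
  \<open>\<parallel>h\<parallel>\<^sup>2 = \<Sum>|\<alpha>|<N. \<parallel>\<Delta>\<^sub>T T\<^sub>\<alpha>\<^sup>*h\<parallel>\<^sup>2 + \<Sum>|\<alpha>|=N. \<parallel>T\<^sub>\<alpha>\<^sup>*h\<parallel>\<^sup>2\<close> (\<open>defect_words_sum\<close>) shows that purity makes \<open>K\<^sub>T\<close>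
  injective. This is \<open>pure_isometry_iff\<close>.

  For a pure isometry \<open>\<D>\<^sub>0 \<ominus> \<D>\<^sub>1\<close> is the wandering space, so \<open>p\<close> is the rank of \<open>\<Delta>\<^sub>T\<close>. If \<open>E\<close> is an
  orthonormal basis of the wandering space, the vectors \<open>T\<^sub>\<alpha> e\<close> form an orthonormal basis of the whole
  space, and a bijection of such bases \<open>E\<close>, \<open>E'\<close> of \<open>T\<close> and \<open>T'\<close> induces a unitary equivalence. For
  finite \<open>p\<close> the bijection exists by counting. For \<open>p = \<infinity>\<close> the value of \<open>p\<close> does not distinguish infinite
  cardinals; here it matters that \<open>T\<close> and \<open>T'\<close> act on the same space. The basis \<open>T\<^sub>\<alpha> e\<close> has the
  cardinality of \<open>E\<close>, since there are only countably many words, and this is an upper bound for the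
  cardinality of every orthonormal set of the space, in particular of \<open>E'\<close>; the roles are symmetric.

  The other ingredients are adjoints (from the Riesz representation), the square root of a positive
  operator as the limit of an iteration with a monotone real majorant, and the norm bound
  \<open>\<parallel>X \<otimes> A\<parallel> \<le> \<parallel>X\<parallel> \<parallel>A\<parallel>\<close>, obtained by expanding finite sums of elementary tensors in orthonormal sets.
\<close>


section \<open>Complex inner products\<close>

instance chilbert_space \<subseteq> banach ..

lemma cinner_add_right: "cinner x (y + z) = cinner x y + cinner x z"
  by (metis cinner_add_left cinner_commute complex_cnj_add)

lemma cinner_scaleC_right: "cinner x (c *\<^sub>C y) = cnj c * cinner x y"
  by (metis cinner_commute cinner_scaleC_left complex_cnj_mult)

lemma cinner_scaleR_left: "cinner (r *\<^sub>R x) y = r *\<^sub>R cinner x y"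
  by (simp add: scaleR_scaleC cinner_scaleC_left scaleC_complex_def)

lemma cinner_scaleR_right: "cinner x (r *\<^sub>R y) = r *\<^sub>R cinner x y"
  by (simp add: scaleR_scaleC cinner_scaleC_right scaleC_complex_def)

lemma bounded_bilinear_cinner: "bounded_bilinear cinner"
  by (rule bounded_bilinear.intro)
    (auto simp: cinner_add_left cinner_add_right cinner_scaleR_left cinner_scaleR_right
      intro!: exI[of _ 2] order_trans[OF norm_cinner_le])

interpretation cinner: bounded_bilinear cinner
  by (rule bounded_bilinear_cinner)

lemmas [simp] = cinner.zero_left cinner.zero_right

lemma bounded_linear_scaleC: "bounded_linear (\<lambda>x. c *\<^sub>C (x::'a::complex_inner))"
  by (rule bounded_linear_intro[of _ "cmod c"])
    (auto simp: scaleC_add_right scaleR_scaleC mult.commute)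

lemmas tendsto_scaleC = bounded_linear.tendsto[OF bounded_linear_scaleC]

lemma scaleC_minus_right: "c *\<^sub>C (- x) = - (c *\<^sub>C (x::'a::complex_vector))"
  and scaleC_diff_right: "c *\<^sub>C (x - y) = c *\<^sub>C x - c *\<^sub>C (y::'a::complex_vector)"
  by (simp_all add: complex_vector.scale_right_diff_distrib)

lemma cinner_self: "cinner x x = complex_of_real ((norm x)\<^sup>2)"
proof -
  have "Im (cinner x x) = 0"
    using cinner_commute[of x x] by (metis Reals_cnj_iff complex_is_Real_iff)
  then show ?thesis
    by (simp add: complex_eq_iff power2_norm_eq_inner inner_eq_Re_cinner del: of_real_power)
qed

lemma norm_sq_eq_Re_cinner: "(norm x)\<^sup>2 = Re (cinner x x)"
  by (simp add: power2_norm_eq_inner inner_eq_Re_cinner)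

lemma cinner_self_eq_0: "cinner x x = 0 \<longleftrightarrow> x = 0"
  by (simp add: cinner_self)

text \<open>Multiplying \<open>x\<close> by a phase makes \<open>cinner x y\<close> real and nonnegative; then this is the inequality for
  the real inner product.\<close>

lemma cinner_Cauchy_Schwarz: "cmod (cinner x y) \<le> norm x * norm y"
proof (cases "cinner x y = 0")
  case False
  define c where "c = cnj (cinner x y) / cmod (cinner x y)"
  have "cmod c = 1" using False by (simp add: c_def norm_divide)
  have "cinner (c *\<^sub>C x) y = cmod (cinner x y)"
    using False complex_norm_square[of "cinner x y"]
    by (simp add: cinner_scaleC_left c_def power2_eq_square field_simps)
  then have "cmod (cinner x y) = inner (c *\<^sub>C x) y"
    by (simp add: inner_eq_Re_cinner)
  also have "\<dots> \<le> norm (c *\<^sub>C x) * norm y" by (rule norm_cauchy_schwarz)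
  finally show ?thesis using \<open>cmod c = 1\<close> by simp
qed simp

lemma cinner_eqI:
  assumes "\<And>z. cinner x z = cinner y z" shows "x = y"
proof -
  have "cinner (x - y) (x - y) = 0"
    using assms[of "x - y"] by (simp add: cinner.diff_left)
  then show ?thesis by (simp add: cinner_self_eq_0)
qed

lemma cinner_eqI_right:
  assumes "\<And>z. cinner z x = cinner z y" shows "x = y"
  by (rule cinner_eqI) (use assms in \<open>simp add: cinner_commute[of x] cinner_commute[of y]\<close>)

lemma norm_eq_if_cinner_eq:
  assumes "cinner x x = cinner y y" shows "norm x = norm y"
  using assms norm_sq_eq_Re_cinner[of x] norm_sq_eq_Re_cinner[of y]
  by (metis norm_ge_zero power2_eq_iff_nonneg)

lemma norm_add_orth:
  assumes "cinner x y = 0"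
  shows "(norm (x + y))\<^sup>2 = (norm x)\<^sup>2 + (norm y)\<^sup>2"
proof -
  have "cinner y x = 0" using assms by (metis cinner_commute complex_cnj_zero)
  then show ?thesis using assms
    by (simp add: norm_sq_eq_Re_cinner cinner_add_left cinner_add_right)
qed

lemma norm_sum_orth:
  assumes "finite F" "\<And>i j. i \<in> F \<Longrightarrow> j \<in> F \<Longrightarrow> i \<noteq> j \<Longrightarrow> cinner (f i) (f j) = 0"
  shows "(norm (sum f F))\<^sup>2 = (\<Sum>i\<in>F. (norm (f i))\<^sup>2)"
  using assms
proof (induction F rule: finite_induct)
  case (insert a F)
  have "cinner (f a) (sum f F) = 0"
    using insert by (auto simp: cinner.sum_right intro!: sum.neutral)
  then show ?case using insert by (simp add: norm_add_orth)
qed simp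


section \<open>Bounded complex-linear maps\<close>

lemma bounded_clinearI:
  assumes "\<And>x y. A (x + y) = A x + A y" "\<And>c x. A (c *\<^sub>C x) = c *\<^sub>C A x"
    "\<And>x. norm (A x) \<le> K * norm x"
  shows "bounded_clinear A"
  unfolding bounded_clinear_def
  by (intro conjI bounded_linear_intro[of A K])
    (auto simp: assms scaleR_scaleC mult.commute[of _ K])

lemma bounded_clinear_bounded_linear: "bounded_clinear A \<Longrightarrow> bounded_linear A"
  and bounded_clinear_scaleC: "bounded_clinear A \<Longrightarrow> A (c *\<^sub>C x) = c *\<^sub>C A x"
  by (auto simp: bounded_clinear_def)

lemma bounded_clinear_linear: "bounded_clinear A \<Longrightarrow> linear A"
  by (simp add: bounded_clinear_bounded_linear bounded_linear.linear)

lemmas bounded_clinear_add = linear_add[OF bounded_clinear_linear]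
lemmas bounded_clinear_diff = linear_diff[OF bounded_clinear_linear]
lemmas bounded_clinear_zero = linear_0[OF bounded_clinear_linear]
lemmas bounded_clinear_sum = linear_sum[OF bounded_clinear_linear]
lemmas bounded_clinear_tendsto = bounded_linear.tendsto[OF bounded_clinear_bounded_linear]

lemma bounded_clinear_nonneg_bound:
  assumes "bounded_clinear A"
  obtains K where "K \<ge> 0" "\<And>x. norm (A x) \<le> K * norm x"
  using bounded_linear.nonneg_bounded[OF bounded_clinear_bounded_linear[OF assms]]
  by (metis mult.commute)

lemma bounded_clinear_id: "bounded_clinear id" "bounded_clinear (\<lambda>x. x)"
  by (auto simp: bounded_clinear_def id_def bounded_linear_ident)

lemma bounded_clinear_0: "bounded_clinear (\<lambda>x. 0)"
  by (auto simp: bounded_clinear_def)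

lemma bounded_clinear_compose:
  "bounded_clinear A \<Longrightarrow> bounded_clinear B \<Longrightarrow> bounded_clinear (\<lambda>x. A (B x))"
  by (auto simp: bounded_clinear_def bounded_linear_compose)

lemma bounded_clinear_comp:
  "bounded_clinear A \<Longrightarrow> bounded_clinear B \<Longrightarrow> bounded_clinear (A \<circ> B)"
  by (simp add: o_def bounded_clinear_compose)

lemma bounded_clinear_plus:
  "bounded_clinear A \<Longrightarrow> bounded_clinear B \<Longrightarrow> bounded_clinear (\<lambda>x. A x + B x)"
  by (auto simp: bounded_clinear_def bounded_linear_add scaleC_add_right)

lemma bounded_clinear_uminus:
  "bounded_clinear A \<Longrightarrow> bounded_clinear (\<lambda>x. - A x)"
  by (auto simp: bounded_clinear_def bounded_linear_minus scaleC_minus_right)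

lemma bounded_clinear_minus:
  "bounded_clinear A \<Longrightarrow> bounded_clinear B \<Longrightarrow> bounded_clinear (\<lambda>x. A x - B x)"
  by (auto simp: bounded_clinear_def bounded_linear_sub scaleC_diff_right)

lemma bounded_clinear_setsum:
  "(\<And>i. i \<in> F \<Longrightarrow> bounded_clinear (A i)) \<Longrightarrow> bounded_clinear (\<lambda>x. \<Sum>i\<in>F. A i x)"
  by (auto simp: bounded_clinear_def bounded_linear_sum complex_vector.scale_sum_right)

lemma bounded_clinear_scale:
  "bounded_clinear A \<Longrightarrow> bounded_clinear (\<lambda>x. c *\<^sub>C A x)"
  by (auto simp: bounded_clinear_def mult.commute
      intro!: bounded_linear_compose[OF bounded_linear_scaleC])

lemma vec_nth_scaleC: "(c *\<^sub>C v) $ i = c *\<^sub>C (v $ i)"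
  by (simp add: scaleC_vec_def)

lemma bounded_clinear_vec_nth: "bounded_clinear (\<lambda>v::'a::chilbert_space ^ 'n. v $ i)"
  by (auto simp: bounded_clinear_def vec_nth_scaleC bounded_linear_vec_nth)

lemma bounded_clinear_row_op:
  "(\<And>i. bounded_clinear (T i)) \<Longrightarrow> bounded_clinear (row_op T)"
  unfolding row_op_def[abs_def]
  by (intro bounded_clinear_setsum bounded_clinear_compose[OF _ bounded_clinear_vec_nth])

lemma bounded_clinear_word_op:
  "(\<And>i. bounded_clinear (X i)) \<Longrightarrow> bounded_clinear (word_op X \<alpha>)"
  by (induction \<alpha>) (auto simp: bounded_clinear_id intro: bounded_clinear_comp)

text \<open>Operators on tensor products are compared by means of this lemma, on elementary tensors only.\<close>

lemma bounded_clinear_eq_on_dense: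
  assumes A: "bounded_clinear A" and B: "bounded_clinear B"
    and dense: "closure (complex_vector.span S) = UNIV"
    and eq: "\<And>x. x \<in> S \<Longrightarrow> A x = B x"
  shows "A = B"
proof
  fix x
  have eqs: "A y = B y" if "y \<in> complex_vector.span S" for y
    using that
  proof (induction rule: complex_vector.span_induct_alt)
    case base show ?case by (simp add: bounded_clinear_zero A B)
  next
    case (step c x y)
    then show ?case
      by (simp add: bounded_clinear_add bounded_clinear_scaleC A B eq)
  qed
  obtain y where y: "\<And>n::nat. y n \<in> complex_vector.span S" "y \<longlonglongrightarrow> x"
    using closure_sequential[of x "complex_vector.span S"] unfolding dense by blast
  have "(\<lambda>n. A (y n)) \<longlonglongrightarrow> A x" "(\<lambda>n. B (y n)) \<longlonglongrightarrow> B x"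
    by (rule bounded_clinear_tendsto[OF A y(2)], rule bounded_clinear_tendsto[OF B y(2)])
  then show "A x = B x"
    unfolding eqs[OF y(1)] by (rule LIMSEQ_unique)
qed


section \<open>Orthogonal projections, the Riesz representation and adjoints\<close>

lemma closure_csubspace:
  fixes S :: "'a::complex_inner set"
  assumes "complex_vector.subspace S"
  shows "complex_vector.subspace (closure S)"
  unfolding complex_vector.subspace_def
proof (intro conjI ballI allI)
  show "0 \<in> closure S"
    using assms closure_subset complex_vector.subspace_0 by blast
next
  fix x y assume "x \<in> closure S" "y \<in> closure S"
  then obtain f g where "\<And>n::nat. f n \<in> S" "f \<longlonglongrightarrow> x" "\<And>n::nat. g n \<in> S" "g \<longlonglongrightarrow> y"
    unfolding closure_sequential by blast
  then show "x + y \<in> closure S"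
    unfolding closure_sequential
    by (intro exI[of _ "\<lambda>n. f n + g n"])
      (auto intro: tendsto_add complex_vector.subspace_add[OF assms])
next
  fix c x assume "x \<in> closure S"
  then obtain f where "\<And>n::nat. f n \<in> S" "f \<longlonglongrightarrow> x"
    unfolding closure_sequential by blast
  then show "c *\<^sub>C x \<in> closure S"
    unfolding closure_sequential
    by (intro exI[of _ "\<lambda>n. c *\<^sub>C f n"])
      (auto intro: tendsto_scaleC complex_vector.subspace_scale[OF assms])
qed

lemma csubspace_imp_subspace:
  "complex_vector.subspace (S::'a::complex_vector set) \<Longrightarrow> subspace S"
  by (auto simp: complex_vector.subspace_def subspace_def scaleR_scaleC)

text \<open>The distance from \<open>x\<close> to a closed subspace is attained, because by the parallelogram law a
  minimising sequence is Cauchy; the difference vector at the minimum is orthogonal to the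
  subspace.\<close>

lemma orthogonal_decomposition:
  fixes S :: "'a::chilbert_space set"
  assumes S: "complex_vector.subspace S" and "closed S"
  shows "\<exists>y\<in>S. x - y \<in> orth_compl S"
proof -
  define d where "d = infdist x S"
  have "S \<noteq> {}" using complex_vector.subspace_0[OF S] by blast
  have dle: "d \<le> norm (x - y)" if "y \<in> S" for y
    using infdist_le[OF that, of x] by (simp add: d_def dist_norm)
  have "d \<ge> 0" by (simp add: d_def infdist_nonneg)
  have "\<exists>y\<in>S. norm (x - y) < d + 1 / Suc n" for n
  proof (rule ccontr)
    assume "\<not> ?thesis"
    then have "d + 1 / Suc n \<le> dist x y" if "y \<in> S" for y
      using that by (force simp: dist_norm)
    then have "d + 1 / Suc n \<le> infdist x S"
      using \<open>S \<noteq> {}\<close> by (auto simp: infdist_def intro!: cINF_greatest)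
    then show False by (simp add: d_def)
  qed
  then obtain y where y: "\<And>n. y n \<in> S" "\<And>n. norm (x - y n) < d + 1 / Suc n"
    by metis
  have near: "(norm (y m - y n))\<^sup>2 \<le> 4 * (2 * d + 1) / Suc N" if "m \<ge> N" "n \<ge> N" for m n N
  proof -
    have le: "norm (x - y k) \<le> d + 1 / Suc N" if "k \<ge> N" for k
      using y(2)[of k] that by (smt (verit) frac_le of_nat_0_less_iff of_nat_mono Suc_le_mono zero_less_Suc)
    have sq: "(norm (x - y k))\<^sup>2 \<le> d\<^sup>2 + (2 * d + 1) / Suc N" if "k \<ge> N" for k
    proof -
      have "(norm (x - y k))\<^sup>2 \<le> (d + 1 / Suc N)\<^sup>2"
        by (intro power_mono le that) simp
      also have "\<dots> = d\<^sup>2 + (2 * d + 1 / Suc N) / Suc N"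
        by (simp add: power2_sum add_divide_distrib) (simp add: power2_eq_square)
      also have "\<dots> \<le> d\<^sup>2 + (2 * d + 1) / Suc N"
        by (intro add_left_mono divide_right_mono) auto
      finally show ?thesis .
    qed
    have mid: "(1/2) *\<^sub>R (y m + y n) \<in> S"
      using csubspace_imp_subspace[OF S] y(1) by (simp add: subspace_add subspace_scale)
    have "d\<^sup>2 \<le> (norm (x - (1/2) *\<^sub>R (y m + y n)))\<^sup>2"
      using dle[OF mid] \<open>d \<ge> 0\<close> by (intro power_mono)
    also have "x - (1/2) *\<^sub>R (y m + y n) = (1/2) *\<^sub>R ((x - y m) + (x - y n))"
    proof -
      have "(x - y m) + (x - y n) = (x + x) - (y m + y n)" by simp
      then show ?thesis by (simp only: scaleR_diff_right scaleR_half_double)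
    qed
    finally have "4 * d\<^sup>2 \<le> (norm ((x - y m) + (x - y n)))\<^sup>2"
      by (simp add: power2_eq_square)
    moreover have "(norm ((x - y m) + (x - y n)))\<^sup>2 + (norm (y m - y n))\<^sup>2
        = 2 * (norm (x - y m))\<^sup>2 + 2 * (norm (x - y n))\<^sup>2"
      by (simp add: power2_norm_eq_inner algebra_simps inner_commute)
    ultimately have "(norm (y m - y n))\<^sup>2 \<le> 4 * ((2 * d + 1) / Suc N)"
      using sq[OF that(1)] sq[OF that(2)] by argo
    then show ?thesis by simp
  qed
  have "Cauchy y"
  proof (rule CauchyI)
    fix e :: real assume "e > 0"
    obtain N where N: "4 * (2 * d + 1) / e\<^sup>2 < real N" using reals_Archimedean2 by blast
    then have "4 * (2 * d + 1) / e\<^sup>2 < Suc N" by simp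
    then have "4 * (2 * d + 1) / Suc N < e\<^sup>2"
      using \<open>e > 0\<close> by (simp add: field_simps)
    then have "norm (y m - y n) < e" if "m \<ge> N" "n \<ge> N" for m n
      using order.strict_trans1[OF near[OF that]] \<open>e > 0\<close>
      by (metis less_imp_le power_less_imp_less_base)
    then show "\<exists>M. \<forall>m\<ge>M. \<forall>n\<ge>M. norm (y m - y n) < e" by blast
  qed
  then obtain z where z: "y \<longlonglongrightarrow> z"
    by (auto simp: Cauchy_convergent_iff convergent_def)
  have "z \<in> S" using \<open>closed S\<close> y(1) z by (metis closed_sequentially)
  have lim: "(\<lambda>n. norm (x - y n)) \<longlonglongrightarrow> norm (x - z)" by (intro tendsto_intros z)
  moreover have "(\<lambda>n. d + 1 / Suc n) \<longlonglongrightarrow> d + 0"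
    using LIMSEQ_inverse_real_of_nat by (intro tendsto_add tendsto_const) (simp add: inverse_eq_divide)
  ultimately have "norm (x - z) \<le> d + 0"
    by (rule LIMSEQ_le) (use y(2) less_imp_le in blast)
  have "cinner (x - z) w = 0" if "w \<in> S" for w
  proof (rule ccontr)
    assume ne: "cinner (x - z) w \<noteq> 0"
    define v where "v = cinner (x - z) w *\<^sub>C w"
    have "v \<in> S" unfolding v_def by (intro complex_vector.subspace_scale S that)
    have "cinner (x - z) v = complex_of_real ((cmod (cinner (x - z) w))\<^sup>2)"
      unfolding v_def cinner_scaleC_right by (metis complex_norm_square mult.commute)
    then have pos: "inner (x - z) v > 0" using ne by (simp add: inner_eq_Re_cinner)
    \<comment> \<open>Moving \<open>z\<close> by \<open>t *\<^sub>R v\<close> changes the squared distance to \<open>x\<close> by \<open>t\<^sup>2 \<parallel>v\<parallel>\<^sup>2 - 2 t inner (x - z) v\<close>, which is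
      negative for this \<open>t\<close>; the summand \<open>1\<close> avoids a case distinction on \<open>v\<close>.\<close>
    define t where "t = inner (x - z) v / (inner v v + 1)"
    have "t > 0" using pos by (simp add: t_def add_nonneg_pos)
    have "t * inner v v < 2 * inner (x - z) v"
    proof -
      have "t * inner v v \<le> inner (x - z) v"
        using pos inner_ge_zero[of v] by (simp add: t_def divide_simps not_less)
      then show ?thesis using pos by simp
    qed
    then have "t * (t * inner v v) < t * (2 * inner (x - z) v)"
      using \<open>t > 0\<close> by simp
    moreover have "(norm (x - (z + t *\<^sub>R v)))\<^sup>2 = (norm (x - z))\<^sup>2 - t * (2 * inner (x - z) v) + t * (t * inner v v)"
      by (simp add: power2_norm_eq_inner algebra_simps inner_commute)
    ultimately have "(norm (x - (z + t *\<^sub>R v)))\<^sup>2 < (norm (x - z))\<^sup>2" by linarith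
    then have "norm (x - (z + t *\<^sub>R v)) < norm (x - z)" by (rule power_less_imp_less_base) simp
    moreover have "z + t *\<^sub>R v \<in> S"
      using csubspace_imp_subspace[OF S] \<open>z \<in> S\<close> \<open>v \<in> S\<close> by (simp add: subspace_add subspace_scale)
    ultimately show False using dle \<open>norm (x - z) \<le> d + 0\<close> by fastforce
  qed
  then show ?thesis using \<open>z \<in> S\<close> by (auto simp: orth_compl_def)
qed

lemma orth_compl_self: "x \<in> S \<Longrightarrow> x \<in> orth_compl S \<Longrightarrow> x = 0"
  by (auto simp: orth_compl_def cinner_self_eq_0)

lemma csubspace_orth_compl: "complex_vector.subspace (orth_compl S)"
  by (auto simp: complex_vector.subspace_def orth_compl_def cinner_add_left cinner_scaleC_left)

lemma orth_proj_eqI: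
  assumes "complex_vector.subspace S" "y \<in> S" "x - y \<in> orth_compl S"
  shows "orth_proj S x = y"
  unfolding orth_proj_def
proof (rule the_equality)
  fix z assume z: "z \<in> S \<and> x - z \<in> orth_compl S"
  have "z - y \<in> S" using z assms complex_vector.subspace_diff by blast
  moreover have "(x - y) - (x - z) \<in> orth_compl S"
    using z assms csubspace_orth_compl complex_vector.subspace_diff by blast
  ultimately show "z = y" using orth_compl_self[of "z - y" S] by simp
qed (use assms in auto)

lemma
  fixes S :: "'a::chilbert_space set"
  assumes "complex_vector.subspace S" "closed S"
  shows orth_proj_in: "orth_proj S x \<in> S"
    and orth_proj_compl: "x - orth_proj S x \<in> orth_compl S"
  using orthogonal_decomposition[OF assms, of x] orth_proj_eqI[OF assms(1)] by metis+

lemma bounded_clinear_orth_proj: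
  fixes S :: "'a::chilbert_space set"
  assumes S: "complex_vector.subspace S" "closed S"
  shows "bounded_clinear (orth_proj S)"
proof (rule bounded_clinearI[where K = 1])
  note sub = complex_vector.subspace_add[OF S(1)] complex_vector.subspace_scale[OF S(1)]
  note P = orth_proj_in[OF S] orth_proj_compl[OF S]
  show "orth_proj S (x + y) = orth_proj S x + orth_proj S y" for x y
    by (rule orth_proj_eqI[OF S(1)]) (use sub P in \<open>simp_all add: add_diff_add csubspace_orth_compl complex_vector.subspace_add\<close>)
  show "orth_proj S (c *\<^sub>C x) = c *\<^sub>C orth_proj S x" for c x
    by (rule orth_proj_eqI[OF S(1)]) (use sub P in \<open>simp_all add: csubspace_orth_compl complex_vector.subspace_scale flip: scaleC_diff_right\<close>)
  fix x
  have "cinner (x - orth_proj S x) (orth_proj S x) = 0"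
    using P by (auto simp: orth_compl_def)
  then have "(norm (x - orth_proj S x + orth_proj S x))\<^sup>2 = (norm (x - orth_proj S x))\<^sup>2 + (norm (orth_proj S x))\<^sup>2"
    by (rule norm_add_orth)
  then show "norm (orth_proj S x) \<le> 1 * norm x"
    by (metis diff_add_cancel le_add_same_cancel2 mult_1 norm_ge_zero power2_le_imp_le zero_le_power2)
qed

text \<open>The component of any vector orthogonal to the closed span of \<open>S\<close> vanishes.\<close>

lemma dense_span_if_orth_compl_trivial:
  fixes S :: "'a::chilbert_space set"
  assumes "\<And>x. (\<And>y. y \<in> S \<Longrightarrow> cinner x y = 0) \<Longrightarrow> x = 0"
  shows "closure (complex_vector.span S) = UNIV"
proof -
  let ?M = "closure (complex_vector.span S)"
  have sub: "complex_vector.subspace ?M"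
    by (simp add: closure_csubspace)
  have "x \<in> ?M" for x
  proof -
    obtain y where y: "y \<in> ?M" "x - y \<in> orth_compl ?M"
      using orthogonal_decomposition[OF sub closed_closure] by blast
    have "x - y = 0"
    proof (rule assms)
      fix z assume "z \<in> S"
      then have "z \<in> ?M" by (rule subsetD[OF closure_subset complex_vector.span_base])
      then show "cinner (x - y) z = 0" using y(2) by (auto simp: orth_compl_def)
    qed
    then have "x = y" by simp
    then show ?thesis by (simp only: y(1))
  qed
  then show ?thesis by (intro equalityI subset_UNIV subsetI)
qed

text \<open>If \<open>w\<close> is orthogonal to the kernel of \<open>f\<close>, then it is orthogonal to \<open>f w *\<^sub>C x - f x *\<^sub>C w\<close>, which lies
  in the kernel; this expresses \<open>f x\<close> as a multiple of \<open>cinner x w\<close>.\<close>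

lemma Riesz_representation:
  fixes f :: "'a::chilbert_space \<Rightarrow> complex"
  assumes add: "\<And>x y. f (x + y) = f x + f y" and scale: "\<And>c x. f (c *\<^sub>C x) = c * f x"
    and bound: "\<And>x. cmod (f x) \<le> K * norm x"
  shows "\<exists>y. \<forall>x. f x = cinner x y"
proof -
  have fb: "bounded_clinear f"
    using assms by (intro bounded_clinearI[where K=K]) (auto simp: scaleC_complex_def)
  have lin: "bounded_linear f" by (rule bounded_clinear_bounded_linear[OF fb])
  let ?N = "{x. f x = 0}"
  have f0: "f 0 = 0" by (rule bounded_clinear_zero[OF fb])
  have sub: "complex_vector.subspace ?N"
    by (auto simp: complex_vector.subspace_def add scale f0)
  have cl: "closed ?N"
    by (rule closed_Collect_eq) (auto intro: linear_continuous_on lin)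
  show ?thesis
  proof (cases "\<forall>x. f x = 0")
    case True then show ?thesis by (intro exI[of _ 0]) simp
  next
    case False
    then obtain a where "f a \<noteq> 0" by blast
    obtain p where p: "f p = 0" "a - p \<in> orth_compl ?N"
      using orthogonal_decomposition[OF sub cl, of a] by blast
    define w where "w = a - p"
    have fw: "f w \<noteq> 0" using \<open>f a \<noteq> 0\<close> p(1) bounded_clinear_diff[OF fb] by (simp add: w_def)
    then have "w \<noteq> 0" using f0 by auto
    define y where "y = (cnj (f w) / complex_of_real ((norm w)\<^sup>2)) *\<^sub>C w"
    have "f x = cinner x y" for x
    proof -
      have "f (f w *\<^sub>C x - f x *\<^sub>C w) = 0"
        by (simp add: bounded_clinear_diff[OF fb] scale)
      then have "cinner w (f w *\<^sub>C x - f x *\<^sub>C w) = 0"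
        using p(2) by (auto simp: orth_compl_def w_def)
      then have "cinner (f w *\<^sub>C x - f x *\<^sub>C w) w = 0"
        by (metis cinner_commute complex_cnj_zero)
      then have "f w * cinner x w = f x * complex_of_real ((norm w)\<^sup>2)"
        by (simp add: cinner.diff_left cinner_scaleC_left cinner_self)
      moreover have "complex_of_real ((norm w)\<^sup>2) \<noteq> 0" using \<open>w \<noteq> 0\<close> by simp
      ultimately have "f x = f w * cinner x w / complex_of_real ((norm w)\<^sup>2)"
        by (metis nonzero_mult_div_cancel_right)
      then show ?thesis by (simp add: y_def cinner_scaleC_right)
    qed
    then show ?thesis by blast
  qed
qed

lemma cadj_unique:
  assumes "\<And>x y. cinner (A x) y = cinner x (B y)"
  shows "cadj A = B"
  unfolding cadj_def
proof (rule the_equality)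
  fix B' assume B': "\<forall>x y. cinner (A x) y = cinner x (B' y)"
  show "B' = B"
  proof
    fix y
    have "cinner z (B' y) = cinner z (B y)" for z
      using B'[rule_format, of z y] assms[of z y] by (rule subst)
    then show "B' y = B y" by (rule cinner_eqI_right)
  qed
qed (intro allI assms)

text \<open>The description that defines \<open>cadj A y\<close> denotes, because the functional \<open>x \<mapsto> cinner (A x) y\<close> has a
  Riesz representation.\<close>

lemma cinner_cadj_right:
  fixes A :: "'a::chilbert_space \<Rightarrow> 'b::complex_inner"
  assumes A: "bounded_clinear A"
  shows "cinner x (cadj A y) = cinner (A x) y"
proof -
  obtain K where K: "K \<ge> 0" "\<And>x. norm (A x) \<le> K * norm x"
    by (rule bounded_clinear_nonneg_bound[OF A]) (rule that)
  have "\<exists>z. \<forall>x. cinner (A x) y = cinner x z" for y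
  proof (rule Riesz_representation)
    show "cmod (cinner (A x) y) \<le> (K * norm y) * norm x" for x
    proof -
      have "cmod (cinner (A x) y) \<le> norm (A x) * norm y" by (rule cinner_Cauchy_Schwarz)
      also have "\<dots> \<le> (K * norm x) * norm y" by (intro mult_right_mono K) simp
      finally show ?thesis by (simp add: mult_ac)
    qed
  qed (simp_all add: bounded_clinear_add[OF A] bounded_clinear_scaleC[OF A] cinner_add_left
      cinner_scaleC_left)
  then obtain B where "\<And>x y. cinner (A x) y = cinner x (B y)" by metis
  with cadj_unique[of A B] show ?thesis by simp
qed

lemma cinner_cadj_left:
  fixes A :: "'a::chilbert_space \<Rightarrow> 'b::complex_inner"
  assumes "bounded_clinear A"
  shows "cinner (cadj A y) x = cinner y (A x)"
  using cinner_cadj_right[OF assms] by (simp add: cinner_commute[of "cadj A y"] cinner_commute[of y])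

lemma norm_cadj_le:
  fixes A :: "'a::chilbert_space \<Rightarrow> 'b::complex_inner"
  assumes A: "bounded_clinear A" and K: "\<And>x. norm (A x) \<le> K * norm x" and "K \<ge> 0"
  shows "norm (cadj A y) \<le> K * norm y"
proof (cases "cadj A y = 0")
  case False
  have "(norm (cadj A y))\<^sup>2 = Re (cinner (A (cadj A y)) y)"
    by (simp add: norm_sq_eq_Re_cinner cinner_cadj_right[OF A])
  also have "\<dots> \<le> cmod (cinner (A (cadj A y)) y)" by (rule complex_Re_le_cmod)
  also have "\<dots> \<le> norm (A (cadj A y)) * norm y" by (rule cinner_Cauchy_Schwarz)
  also have "\<dots> \<le> (K * norm (cadj A y)) * norm y" by (intro mult_right_mono K) simp
  finally show ?thesis using False by (simp add: power2_eq_square)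
qed (use \<open>K \<ge> 0\<close> in simp)

lemma bounded_clinear_cadj:
  fixes A :: "'a::chilbert_space \<Rightarrow> 'b::complex_inner"
  assumes A: "bounded_clinear A"
  shows "bounded_clinear (cadj A)"
proof -
  obtain K where K: "K \<ge> 0" "\<And>x. norm (A x) \<le> K * norm x"
    by (rule bounded_clinear_nonneg_bound[OF A]) (rule that)
  show ?thesis
  proof (rule bounded_clinearI)
    show "norm (cadj A y) \<le> K * norm y" for y by (rule norm_cadj_le[OF A K(2,1)])
    show "cadj A (x + y) = cadj A x + cadj A y" for x y
      by (rule cinner_eqI) (simp add: cinner_cadj_left[OF A] cinner_add_left)
    show "cadj A (c *\<^sub>C x) = c *\<^sub>C cadj A x" for c x
      by (rule cinner_eqI) (simp add: cinner_cadj_left[OF A] cinner_scaleC_left)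
  qed
qed

lemma cadj_cadj:
  fixes A :: "'a::chilbert_space \<Rightarrow> 'b::chilbert_space"
  assumes A: "bounded_clinear A"
  shows "cadj (cadj A) = A"
  by (rule cadj_unique) (simp add: cinner_cadj_left[OF A])

lemma cadj_word_op:
  fixes X :: "'n \<Rightarrow> 'a::chilbert_space \<Rightarrow> 'a"
  assumes X: "\<And>i. bounded_clinear (X i)"
  shows "cadj (word_op X \<alpha>) = word_op (\<lambda>i. cadj (X i)) (rev \<alpha>)"
proof (rule cadj_unique)
  have app: "word_op Y (\<beta> @ \<gamma>) = word_op Y \<beta> \<circ> word_op Y \<gamma>" for Y :: "'n \<Rightarrow> 'a \<Rightarrow> 'a" and \<beta> \<gamma>
    by (induction \<beta>) auto
  show "cinner (word_op X \<alpha> x) y = cinner x (word_op (\<lambda>i. cadj (X i)) (rev \<alpha>) y)" for x y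
    by (induction \<alpha> arbitrary: x y) (simp_all add: app flip: cinner_cadj_right[OF X])
qed


section \<open>Positive operators and their square roots\<close>

lemma complex_nonneg_iff: "(0::complex) \<le> z \<longleftrightarrow> 0 \<le> Re z \<and> Im z = 0"
  by (auto simp: less_eq_complex_def)

lemma positive_op_bounded_clinear: "positive_op A \<Longrightarrow> bounded_clinear A"
  and positive_op_Re: "positive_op A \<Longrightarrow> 0 \<le> Re (cinner (A x) x)"
  and positive_op_Im: "positive_op A \<Longrightarrow> Im (cinner (A x) x) = 0"
  by (auto simp: positive_op_def complex_nonneg_iff)

text \<open>By polarisation: the forms at \<open>x + y\<close> and at \<open>x + \<i> y\<close> are real.\<close>

lemma positive_op_selfadjoint:
  assumes A: "positive_op A"
  shows "cinner (A x) y = cinner x (A y)"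
proof -
  note lin = positive_op_bounded_clinear[OF A]
  note im = positive_op_Im[OF A]
  have "Im (cinner (A x) y) + Im (cinner (A y) x) = 0"
    using im[of "x + y"] im[of x] im[of y]
    by (simp add: bounded_clinear_add[OF lin] cinner_add_left cinner_add_right)
  moreover have "Re (cinner (A x) y) = Re (cinner (A y) x)"
    using im[of "x + \<i> *\<^sub>C y"] im[of x] im[of y]
    by (simp add: bounded_clinear_add[OF lin] bounded_clinear_scaleC[OF lin]
        cinner_add_left cinner_add_right cinner_scaleC_left cinner_scaleC_right)
  ultimately have "cinner (A x) y = cnj (cinner (A y) x)"
    by (simp add: complex_eq_iff)
  also have "\<dots> = cinner x (A y)" by (rule cinner_commute[symmetric])
  finally show ?thesis .
qed

text \<open>The form of \<open>S\<close> is nonnegative at \<open>y - t *\<^sub>R S y\<close> for every real \<open>t\<close>. For small \<open>t > 0\<close> the linear term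
  \<open>- 2 t \<parallel>S y\<parallel>\<^sup>2\<close> would dominate the quadratic one.\<close>

lemma positive_op_eq_0:
  assumes S: "positive_op S" and 0: "cinner (S y) y = 0"
  shows "S y = 0"
proof (rule ccontr)
  note lin = positive_op_bounded_clinear[OF S]
  define z where "z = S y"
  assume "S y \<noteq> 0"
  then have "(norm z)\<^sup>2 > 0" by (simp add: z_def)
  define b where "b = Re (cinner (S z) z)"
  have "b \<ge> 0" unfolding b_def by (rule positive_op_Re[OF S])
  define t where "t = (norm z)\<^sup>2 / (b + 1)"
  have "t > 0" using \<open>(norm z)\<^sup>2 > 0\<close> \<open>b \<ge> 0\<close> by (simp add: t_def)
  have zy: "cinner (S z) y = complex_of_real ((norm z)\<^sup>2)"
    by (simp add: positive_op_selfadjoint[OF S] cinner_self flip: z_def)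
  have "0 \<le> Re (cinner (S (y - t *\<^sub>R z)) (y - t *\<^sub>R z))" by (rule positive_op_Re[OF S])
  also have "\<dots> = - 2 * t * (norm z)\<^sup>2 + t * (t * b)"
    using 0
    by (simp add: bounded_clinear_diff[OF lin] linear_scale[OF bounded_clinear_linear[OF lin]]
        cinner.diff_left cinner.diff_right cinner_scaleR_left cinner_scaleR_right zy b_def
        cinner_self algebra_simps flip: z_def)
  finally have "t * (2 * (norm z)\<^sup>2) \<le> t * (t * b)" by simp
  then have "2 * (norm z)\<^sup>2 \<le> t * b" using \<open>t > 0\<close> by simp
  also have "t * b \<le> (norm z)\<^sup>2"
    using \<open>b \<ge> 0\<close> by (simp add: t_def divide_le_eq mult_left_mono)
  finally show False using \<open>(norm z)\<^sup>2 > 0\<close> by simp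
qed

text \<open>The square root of \<open>I - C\<close> is \<open>I - Y\<close>, where \<open>Y\<close> is the limit of the iteration
  \<open>Y \<mapsto> (C + Y\<^sup>2) / 2\<close> started at \<open>0\<close>. For \<open>C = 1\<close> the same iteration in the reals increases and is
  bounded by \<open>1\<close>, and its increments dominate those of the iteration for any contraction \<open>C\<close>.\<close>

primrec sqrt_iter :: "('a \<Rightarrow>\<^sub>L 'a) \<Rightarrow> nat \<Rightarrow> ('a::real_normed_vector \<Rightarrow>\<^sub>L 'a)" where
  "sqrt_iter C 0 = 0"
| "sqrt_iter C (Suc k) = (1/2) *\<^sub>R (C + (sqrt_iter C k o\<^sub>L sqrt_iter C k))"

primrec sqrt_majorant :: "nat \<Rightarrow> real" where
  "sqrt_majorant 0 = 0"
| "sqrt_majorant (Suc k) = (1 + (sqrt_majorant k)\<^sup>2) / 2"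

lemma sqrt_majorant_bounds: "0 \<le> sqrt_majorant k \<and> sqrt_majorant k \<le> 1"
proof (induction k)
  case (Suc k)
  then have "(sqrt_majorant k)\<^sup>2 \<le> 1" by (simp add: power_le_one)
  then show ?case by simp
qed simp

text \<open>In the limit this makes the square root commute with everything that commutes with the given
  operator, which the uniqueness proof needs. Applied to multiplication by complex scalars, it gives
  the complex linearity of the limit.\<close>

lemma sqrt_iter_commute:
  assumes "D o\<^sub>L C = C o\<^sub>L D"
  shows "D o\<^sub>L sqrt_iter C k = sqrt_iter C k o\<^sub>L D"
proof (induction k)
  case (Suc k)
  have DC: "D (C x) = C (D x)" for x
    using assms by (metis blinfun_apply_blinfun_compose)
  have DY: "D (sqrt_iter C k x) = sqrt_iter C k (D x)" for x
    using Suc by (metis blinfun_apply_blinfun_compose)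
  show ?case
    by (rule blinfun_eqI) (simp add: blinfun.bilinear_simps DC DY)
qed simp

lemma norm_sqrt_iter:
  assumes "norm C \<le> 1"
  shows "norm (sqrt_iter C k) \<le> sqrt_majorant k"
proof (induction k)
  case (Suc k)
  have "norm (C + (sqrt_iter C k o\<^sub>L sqrt_iter C k)) \<le> 1 + sqrt_majorant k * sqrt_majorant k"
    using assms norm_blinfun_compose[of "sqrt_iter C k" "sqrt_iter C k"]
      mult_mono[OF Suc Suc] sqrt_majorant_bounds[of k] norm_triangle_ineq[of C "sqrt_iter C k o\<^sub>L sqrt_iter C k"]
    by simp
  then show ?case by (simp add: power2_eq_square)
qed simp

text \<open>Successive iterates commute, so that the difference of their squares factors. The same
  factorisation in the reals computes the next increment of the majorant.\<close>

lemma norm_sqrt_iter_step: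
  assumes "norm C \<le> 1"
  shows "norm (sqrt_iter C (Suc k) - sqrt_iter C k) \<le> sqrt_majorant (Suc k) - sqrt_majorant k"
proof (induction k)
  case 0
  then show ?case using assms by simp
next
  case (Suc k)
  let ?Y = "sqrt_iter C" and ?y = sqrt_majorant
  have "?Y k o\<^sub>L C = C o\<^sub>L ?Y k" by (rule sqrt_iter_commute[symmetric]) simp
  then have "?Y k o\<^sub>L ?Y (Suc k) = ?Y (Suc k) o\<^sub>L ?Y k" by (rule sqrt_iter_commute)
  then have comm: "?Y k (?Y (Suc k) x) = ?Y (Suc k) (?Y k x)" for x
    by (metis blinfun_apply_blinfun_compose)
  have "?Y (Suc (Suc k)) - ?Y (Suc k) = (1/2) *\<^sub>R ((?Y (Suc k) o\<^sub>L ?Y (Suc k)) - (?Y k o\<^sub>L ?Y k))"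
  proof -
    have "(1/2) *\<^sub>R (C + P) - (1/2) *\<^sub>R (C + Q) = (1/2) *\<^sub>R (P - Q)" for P Q
      by (simp flip: scaleR_diff_right)
    then show ?thesis by (metis sqrt_iter.simps(2))
  qed
  also have "(?Y (Suc k) o\<^sub>L ?Y (Suc k)) - (?Y k o\<^sub>L ?Y k)
      = (?Y (Suc k) - ?Y k) o\<^sub>L (?Y (Suc k) + ?Y k)"
    by (rule blinfun_eqI) (simp add: blinfun.bilinear_simps comm del: sqrt_iter.simps(2))
  finally have "norm (?Y (Suc (Suc k)) - ?Y (Suc k))
      = norm ((?Y (Suc k) - ?Y k) o\<^sub>L (?Y (Suc k) + ?Y k)) / 2"
    by (simp del: sqrt_iter.simps(2))
  also have "norm ((?Y (Suc k) - ?Y k) o\<^sub>L (?Y (Suc k) + ?Y k))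
      \<le> norm (?Y (Suc k) - ?Y k) * norm (?Y (Suc k) + ?Y k)"
    by (rule norm_blinfun_compose)
  also have "\<dots> \<le> (?y (Suc k) - ?y k) * (?y (Suc k) + ?y k)"
    using Suc norm_sqrt_iter[OF assms] order_trans[OF norm_ge_zero Suc]
    by (intro mult_mono norm_triangle_mono) (auto simp del: sqrt_iter.simps(2) sqrt_majorant.simps(2))
  also have "\<dots> / 2 = ?y (Suc (Suc k)) - ?y (Suc k)"
    unfolding sqrt_majorant.simps(2)[of "Suc k"] sqrt_majorant.simps(2)[of k, THEN arg_cong, of "\<lambda>z. _ - z"]
    by (simp add: field_simps power2_eq_square del: sqrt_majorant.simps(2))
  finally show ?case by simp
qed

lemma norm_sqrt_iter_diff:
  assumes "norm C \<le> 1" "k \<le> m"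
  shows "norm (sqrt_iter C m - sqrt_iter C k) \<le> sqrt_majorant m - sqrt_majorant k"
  using assms(2)
proof (induction m rule: dec_induct)
  case (step m)
  show ?case
    using norm_triangle_le[of "sqrt_iter C (Suc m) - sqrt_iter C m" "sqrt_iter C m - sqrt_iter C k"
        "sqrt_majorant (Suc m) - sqrt_majorant k"] step.IH norm_sqrt_iter_step[OF assms(1), of m]
    by (simp del: sqrt_iter.simps sqrt_majorant.simps)
qed simp

lemma sqrt_iter_convergent:
  fixes C :: "'a::banach \<Rightarrow>\<^sub>L 'a"
  assumes C: "norm C \<le> 1"
  shows "convergent (sqrt_iter C)"
proof -
  have "sqrt_majorant k \<le> sqrt_majorant (Suc k)" for k
    using norm_sqrt_iter_step[OF C, of k] norm_ge_zero order_trans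
    by (metis diff_ge_0_iff_ge)
  then have "convergent sqrt_majorant"
    using sqrt_majorant_bounds
    by (intro Bseq_mono_convergent BseqI'[of _ 1]) (auto simp del: sqrt_majorant.simps intro: lift_Suc_mono_le)
  then have cau: "Cauchy sqrt_majorant" by (simp add: Cauchy_convergent_iff)
  have "Cauchy (sqrt_iter C)"
  proof (rule CauchyI)
    fix e :: real assume "e > 0"
    then obtain M where M: "\<And>m n. m \<ge> M \<Longrightarrow> n \<ge> M \<Longrightarrow> norm (sqrt_majorant m - sqrt_majorant n) < e"
      using CauchyD[OF cau] by blast
    have le: "norm (sqrt_iter C m - sqrt_iter C n) < e" if "m \<ge> n" "n \<ge> M" for m n
      using norm_sqrt_iter_diff[OF C that(1)] M[of m n] that by simp
    have "norm (sqrt_iter C m - sqrt_iter C n) < e" if "m \<ge> M" "n \<ge> M" for m n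
      using le[of m n] le[of n m] that by (cases "m \<ge> n") (auto simp: norm_minus_commute)
    then show "\<exists>M. \<forall>m\<ge>M. \<forall>n\<ge>M. norm (sqrt_iter C m - sqrt_iter C n) < e" by blast
  qed
  then show ?thesis by (simp add: Cauchy_convergent_iff)
qed

lemma blinfun_tendsto_apply: "X \<longlonglongrightarrow> Z \<Longrightarrow> (\<lambda>k. blinfun_apply (X k) x) \<longlonglongrightarrow> blinfun_apply Z x"
  by (intro tendsto_intros)

lemma positive_sqrt_exists:
  fixes A :: "'a::chilbert_space \<Rightarrow> 'a"
  assumes A: "positive_op A" and contr: "\<And>x. norm (x - A x) \<le> norm x"
  shows "\<exists>S. positive_op S \<and> S \<circ> S = A \<and> (\<forall>D. bounded_clinear D \<longrightarrow> D \<circ> A = A \<circ> D \<longrightarrow> D \<circ> S = S \<circ> D)"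
proof -
  note linA = positive_op_bounded_clinear[OF A]
  have linC: "bounded_clinear (\<lambda>x. x - A x)"
    by (intro bounded_clinear_minus bounded_clinear_id linA)
  define C where "C = Blinfun (\<lambda>x. x - A x)"
  have C: "blinfun_apply C x = x - A x" for x
    unfolding C_def by (simp add: bounded_linear_Blinfun_apply bounded_clinear_bounded_linear linC)
  have normC: "norm C \<le> 1" by (rule norm_blinfun_bound) (auto simp: C contr)
  obtain Z where Z: "sqrt_iter C \<longlonglongrightarrow> Z"
    using sqrt_iter_convergent[OF normC] by (auto simp: convergent_def)
  have fixpoint: "Z = (1/2) *\<^sub>R (C + (Z o\<^sub>L Z))"
  proof (rule LIMSEQ_unique)
    show "(\<lambda>k. sqrt_iter C (Suc k)) \<longlonglongrightarrow> Z" by (rule LIMSEQ_Suc[OF Z])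
    show "(\<lambda>k. sqrt_iter C (Suc k)) \<longlonglongrightarrow> (1/2) *\<^sub>R (C + (Z o\<^sub>L Z))"
      unfolding sqrt_iter.simps
      by (intro tendsto_intros Z bounded_bilinear.tendsto[OF bounded_bilinear_blinfun_compose])
  qed
  have "norm Z \<le> 1"
  proof (rule LIMSEQ_le_const2[OF tendsto_norm[OF Z]])
    show "\<exists>N. \<forall>n\<ge>N. norm (sqrt_iter C n) \<le> 1"
      using norm_sqrt_iter[OF normC] sqrt_majorant_bounds order_trans by blast
  qed
  have comm: "D (Z x) = Z (D x)" if D: "bounded_linear D" "\<And>x. D (A x) = A (D x)" for D x
  proof (rule LIMSEQ_unique)
    have "Blinfun D o\<^sub>L C = C o\<^sub>L Blinfun D"
      by (rule blinfun_eqI)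
        (simp add: C bounded_linear_Blinfun_apply D linear_diff[OF bounded_linear.linear])
    then have "Blinfun D o\<^sub>L sqrt_iter C k = sqrt_iter C k o\<^sub>L Blinfun D" for k
      by (rule sqrt_iter_commute)
    then have eq: "D (sqrt_iter C k x) = sqrt_iter C k (D x)" for k
      by (metis blinfun_apply_blinfun_compose bounded_linear_Blinfun_apply D(1))
    show "(\<lambda>k. D (sqrt_iter C k x)) \<longlonglongrightarrow> D (Z x)"
      by (rule bounded_linear.tendsto[OF D(1) blinfun_tendsto_apply[OF Z]])
    show "(\<lambda>k. D (sqrt_iter C k x)) \<longlonglongrightarrow> Z (D x)"
      unfolding eq by (rule blinfun_tendsto_apply[OF Z])
  qed
  have "cinner (sqrt_iter C k x) y = cinner x (sqrt_iter C k y)" for k x y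
  proof (induction k arbitrary: x y)
    case (Suc k)
    then show ?case
      by (simp add: blinfun.bilinear_simps C cinner_scaleR_left cinner_scaleR_right cinner_add_left
          cinner_add_right cinner.diff_left cinner.diff_right positive_op_selfadjoint[OF A])
  qed simp
  note sa = this
  have saZ: "cinner (Z x) y = cinner x (Z y)" for x y
  proof (rule LIMSEQ_unique)
    show "(\<lambda>k. cinner (sqrt_iter C k x) y) \<longlonglongrightarrow> cinner (Z x) y"
      by (intro cinner.tendsto tendsto_const blinfun_tendsto_apply[OF Z])
    show "(\<lambda>k. cinner (sqrt_iter C k x) y) \<longlonglongrightarrow> cinner x (Z y)"
      unfolding sa by (intro cinner.tendsto tendsto_const blinfun_tendsto_apply[OF Z])
  qed
  define S where "S x = x - Z x" for x
  have Zle: "norm (Z x) \<le> norm x" for x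
    using norm_blinfun[of Z x] \<open>norm Z \<le> 1\<close>
    by (metis mult_left_le_one_le norm_ge_zero order_trans)
  have linS: "bounded_clinear S"
  proof -
    have "Z (c *\<^sub>C x) = c *\<^sub>C Z x" for c x
      by (rule comm[symmetric, OF bounded_linear_scaleC]) (simp add: bounded_clinear_scaleC[OF linA])
    then have "bounded_clinear (blinfun_apply Z)"
      by (simp add: bounded_clinear_def blinfun.bounded_linear_right)
    then show ?thesis unfolding S_def by (intro bounded_clinear_minus bounded_clinear_id)
  qed
  have "0 \<le> cinner (S x) x" for x
  proof -
    have "cinner (Z x) x = cnj (cinner (Z x) x)"
      using saZ[of x x] cinner_commute by metis
    then have "Im (cinner (Z x) x) = 0" by (simp add: complex_eq_iff)
    moreover have "Re (cinner (Z x) x) \<le> (norm x)\<^sup>2"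
    proof -
      have "Re (cinner (Z x) x) \<le> norm (Z x) * norm x"
        using complex_Re_le_cmod cinner_Cauchy_Schwarz by (rule order_trans)
      also have "\<dots> \<le> norm x * norm x" by (intro mult_right_mono Zle) simp
      finally show ?thesis by (simp add: power2_eq_square)
    qed
    ultimately show ?thesis
      by (simp add: S_def complex_nonneg_iff cinner.diff_left cinner_self del: of_real_power)
  qed
  then have posS: "positive_op S" using linS by (simp add: positive_op_def)
  have SS: "S (S x) = A x" for x
  proof -
    have "2 *\<^sub>R Z x = 2 *\<^sub>R ((1/2) *\<^sub>R (C x + Z (Z x)))"
      by (subst (1) fixpoint) (simp add: blinfun.bilinear_simps)
    then have "Z x + Z x = C x + Z (Z x)" by (simp add: scaleR_2)
    then show ?thesis
      by (simp add: S_def blinfun.bilinear_simps C algebra_simps)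
  qed
  have "D \<circ> S = S \<circ> D" if "bounded_clinear D" "D \<circ> A = A \<circ> D" for D
    using comm[of D] that
    by (auto simp: fun_eq_iff S_def bounded_clinear_diff bounded_clinear_bounded_linear)
  then show ?thesis using posS SS by (intro exI[of _ S]) auto
qed

text \<open>For \<open>y = S x - B x\<close> commutation gives \<open>S y + B y = S\<^sup>2 x - B\<^sup>2 x = 0\<close>. Two nonnegative forms whose sum
  vanishes at \<open>y\<close> both vanish there, so \<open>S y = B y = 0\<close> and \<open>\<parallel>y\<parallel>\<^sup>2 = cinner x (S y - B y) = 0\<close>.\<close>

lemma positive_sqrt_unique:
  fixes A :: "'a::chilbert_space \<Rightarrow> 'a"
  assumes S: "positive_op S" "S \<circ> S = A" and B: "positive_op B" "B \<circ> B = A" and comm: "B \<circ> S = S \<circ> B"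
  shows "B = S"
proof
  fix x
  note linS = positive_op_bounded_clinear[OF S(1)] and linB = positive_op_bounded_clinear[OF B(1)]
  define y where "y = S x - B x"
  have "S y + B y = 0"
    using S(2) B(2) comm
    by (simp add: y_def bounded_clinear_diff[OF linS] bounded_clinear_diff[OF linB] fun_eq_iff)
  then have sum0: "cinner (S y) y + cinner (B y) y = 0"
    by (simp flip: cinner_add_left)
  then have "cinner (S y) y = 0" "cinner (B y) y = 0"
    using positive_op_Re[OF S(1), of y] positive_op_Im[OF S(1), of y]
      positive_op_Re[OF B(1), of y] positive_op_Im[OF B(1), of y]
    by (auto simp: complex_eq_iff)
  then have "S y = 0" "B y = 0"
    using positive_op_eq_0 S(1) B(1) by blast+
  then have "cinner y y = 0"
    unfolding y_def[THEN arg_cong, of "\<lambda>u. cinner u y"]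
    by (simp add: cinner.diff_left positive_op_selfadjoint[OF S(1)] positive_op_selfadjoint[OF B(1)])
  then show "B x = S x" by (simp add: cinner_self_eq_0 y_def)
qed

lemma op_sqrt_eqI:
  fixes A :: "'a::chilbert_space \<Rightarrow> 'a"
  assumes A: "positive_op A" "\<And>x. norm (x - A x) \<le> norm x"
    and B: "positive_op B" "B \<circ> B = A"
  shows "op_sqrt A = B"
proof -
  obtain S where S: "positive_op S" "S \<circ> S = A"
    and comm: "\<And>D. bounded_clinear D \<Longrightarrow> D \<circ> A = A \<circ> D \<Longrightarrow> D \<circ> S = S \<circ> D"
    using positive_sqrt_exists[OF A] by blast
  have uniq: "D = S" if "positive_op D" "D \<circ> D = A" for D
    using S that
  proof (rule positive_sqrt_unique)
    have "D \<circ> A = A \<circ> D" by (simp add: comp_assoc flip: that(2))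
    then show "D \<circ> S = S \<circ> D" by (rule comm[OF positive_op_bounded_clinear[OF that(1)]])
  qed
  show ?thesis
    unfolding op_sqrt_def using B uniq by (intro the_equality) auto
qed

lemma
  fixes A :: "'a::chilbert_space \<Rightarrow> 'a"
  assumes A: "positive_op A" "\<And>x. norm (x - A x) \<le> norm x"
  shows positive_op_sqrt: "positive_op (op_sqrt A)"
    and op_sqrt_op_sqrt: "op_sqrt A (op_sqrt A x) = A x"
proof -
  obtain S where S: "positive_op S" "S \<circ> S = A"
    using positive_sqrt_exists[OF A] by blast
  have "op_sqrt A = S" by (rule op_sqrt_eqI[OF A S])
  with S show "positive_op (op_sqrt A)" "op_sqrt A (op_sqrt A x) = A x" by auto
qed


section \<open>Extension from a dense subspace\<close>

text \<open>The bound passes to limits, so the closure of the relation \<open>G\<close> is again single-valued; completeness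
  makes it total.\<close>

lemma bounded_extension:
  fixes G :: "('a::chilbert_space \<times> 'b::chilbert_space) set"
  assumes add: "\<And>x y x' y'. (x, y) \<in> G \<Longrightarrow> (x', y') \<in> G \<Longrightarrow> (x + x', y + y') \<in> G"
    and scale: "\<And>c x y. (x, y) \<in> G \<Longrightarrow> (c *\<^sub>C x, c *\<^sub>C y) \<in> G"
    and bound: "\<And>x y. (x, y) \<in> G \<Longrightarrow> norm y \<le> K * norm x"
    and dense: "closure (fst ` G) = UNIV"
  shows "\<exists>B. bounded_clinear B \<and> (\<forall>(x, y)\<in>G. B x = y) \<and> (\<forall>x. norm (B x) \<le> K * norm x)"
proof -
  have diff: "(x - x', y - y') \<in> G" if "(x, y) \<in> G" "(x', y') \<in> G" for x y x' y'
    using add[OF that(1) scale[OF that(2), of "-1"]] by simp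
  define R where "R x y \<longleftrightarrow> (\<exists>f g. (\<forall>n::nat. (f n, g n) \<in> G) \<and> f \<longlonglongrightarrow> x \<and> g \<longlonglongrightarrow> y)" for x y
  have R_ex: "\<exists>y. R x y" for x
  proof -
    obtain f where f: "\<And>n::nat. f n \<in> fst ` G" "f \<longlonglongrightarrow> x"
      using closure_sequential[of x "fst ` G"] unfolding dense by blast
    have "\<forall>n. \<exists>y. (f n, y) \<in> G" using f(1) by force
    then obtain g where g: "\<And>n. (f n, g n) \<in> G" by metis
    have "Cauchy g"
    proof (rule CauchyI)
      fix e :: real assume "e > 0"
      have "Cauchy f" using f(2) by (rule LIMSEQ_imp_Cauchy)
      then obtain M where M: "\<And>m n. m \<ge> M \<Longrightarrow> n \<ge> M \<Longrightarrow> norm (f m - f n) < e / (\<bar>K\<bar> + 1)"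
        using CauchyD[of f "e / (\<bar>K\<bar> + 1)"] \<open>e > 0\<close> by auto
      have "norm (g m - g n) < e" if "m \<ge> M" "n \<ge> M" for m n
      proof -
        have "norm (g m - g n) \<le> K * norm (f m - f n)" by (rule bound[OF diff[OF g g]])
        also have "\<dots> \<le> (\<bar>K\<bar> + 1) * norm (f m - f n)" by (intro mult_right_mono) auto
        also have "\<dots> < e" using M[OF that] by (simp add: field_simps)
        finally show ?thesis .
      qed
      then show "\<exists>M. \<forall>m\<ge>M. \<forall>n\<ge>M. norm (g m - g n) < e" by blast
    qed
    then obtain y where "g \<longlonglongrightarrow> y" by (auto simp: Cauchy_convergent_iff convergent_def)
    then show ?thesis using f g unfolding R_def by blast
  qed
  have R_bound: "norm y \<le> K * norm x" if "R x y" for x y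
  proof -
    obtain f g where fg: "\<And>n::nat. (f n, g n) \<in> G" "f \<longlonglongrightarrow> x" "g \<longlonglongrightarrow> y"
      using \<open>R x y\<close> unfolding R_def by blast
    have "(\<lambda>n. K * norm (f n)) \<longlonglongrightarrow> K * norm x" "(\<lambda>n. norm (g n)) \<longlonglongrightarrow> norm y"
      by (intro tendsto_intros fg)+
    then show ?thesis using bound[OF fg(1)] by (intro LIMSEQ_le) auto
  qed
  have R_add: "R (x + x') (y + y')" if R: "R x y" "R x' y'" for x y x' y'
  proof -
    obtain f g where "\<And>n::nat. (f n, g n) \<in> G" "f \<longlonglongrightarrow> x" "g \<longlonglongrightarrow> y"
      using R(1) unfolding R_def by blast
    moreover obtain f' g' where "\<And>n::nat. (f' n, g' n) \<in> G" "f' \<longlonglongrightarrow> x'" "g' \<longlonglongrightarrow> y'"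
      using R(2) unfolding R_def by blast
    ultimately show ?thesis unfolding R_def
      by (intro exI[of _ "\<lambda>n. f n + f' n"] exI[of _ "\<lambda>n. g n + g' n"]) (simp add: add tendsto_add)
  qed
  have R_scale: "R (c *\<^sub>C x) (c *\<^sub>C y)" if R: "R x y" for c x y
  proof -
    obtain f g where "\<And>n::nat. (f n, g n) \<in> G" "f \<longlonglongrightarrow> x" "g \<longlonglongrightarrow> y"
      using R unfolding R_def by blast
    then show ?thesis unfolding R_def
      by (intro exI[of _ "\<lambda>n. c *\<^sub>C f n"] exI[of _ "\<lambda>n. c *\<^sub>C g n"]) (simp add: scale tendsto_scaleC)
  qed
  have R_unique: "y = y'" if "R x y" "R x y'" for x y y'
  proof -
    have "R (x + (-1) *\<^sub>C x) (y + (-1) *\<^sub>C y')" by (intro R_add R_scale that)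
    then show ?thesis using R_bound by fastforce
  qed
  have R_G: "R x y" if "(x, y) \<in> G" for x y
    unfolding R_def using that by (intro exI[of _ "\<lambda>_. x"] exI[of _ "\<lambda>_. y"]) simp
  obtain B where B: "\<And>x. R x (B x)" using R_ex by metis
  have "bounded_clinear B"
  proof (rule bounded_clinearI)
    show "norm (B x) \<le> K * norm x" for x by (rule R_bound[OF B])
    show "B (x + y) = B x + B y" for x y by (rule R_unique[OF B R_add[OF B B]])
    show "B (c *\<^sub>C x) = c *\<^sub>C B x" for c x by (rule R_unique[OF B R_scale[OF B]])
  qed
  then show ?thesis using R_bound[OF B] R_unique[OF B R_G] by blast
qed

text \<open>The prescription \<open>t s \<mapsto> u s\<close> is well defined on linear combinations because of the bound, even if
  the vectors \<open>t s\<close> are linearly dependent, as elementary tensors are.\<close>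

lemma bounded_extension_family:
  fixes t :: "'s \<Rightarrow> 'a::chilbert_space" and u :: "'s \<Rightarrow> 'b::chilbert_space"
  assumes bound: "\<And>F c. finite F \<Longrightarrow> F \<subseteq> I \<Longrightarrow>
      norm (\<Sum>s\<in>F. c s *\<^sub>C u s) \<le> K * norm (\<Sum>s\<in>F. c s *\<^sub>C t s)"
    and dense: "closure (complex_vector.span (t ` I)) = UNIV"
  shows "\<exists>B. bounded_clinear B \<and> (\<forall>s\<in>I. B (t s) = u s) \<and> (\<forall>x. norm (B x) \<le> K * norm x)"
proof -
  define G where "G = {(\<Sum>s\<in>F. c s *\<^sub>C t s, \<Sum>s\<in>F. c s *\<^sub>C u s) |F c. finite F \<and> F \<subseteq> I}"
  have add: "(x + x', y + y') \<in> G" if G: "(x, y) \<in> G" "(x', y') \<in> G" for x y x' y'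
  proof -
    obtain F c F' c' where F: "finite F" "F \<subseteq> I" "x = (\<Sum>s\<in>F. c s *\<^sub>C t s)" "y = (\<Sum>s\<in>F. c s *\<^sub>C u s)"
      and F': "finite F'" "F' \<subseteq> I" "x' = (\<Sum>s\<in>F'. c' s *\<^sub>C t s)" "y' = (\<Sum>s\<in>F'. c' s *\<^sub>C u s)"
      using G unfolding G_def by blast
    let ?c = "\<lambda>s. (if s \<in> F then c s else 0) + (if s \<in> F' then c' s else 0)"
    have eq: "(\<Sum>s\<in>F \<union> F'. ?c s *\<^sub>C w s) = (\<Sum>s\<in>F. c s *\<^sub>C w s) + (\<Sum>s\<in>F'. c' s *\<^sub>C w s)"
      for w :: "'s \<Rightarrow> 'z::chilbert_space"
      unfolding scaleC_add_left sum.distrib using F(1) F'(1)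
      by (intro arg_cong2[where f = "(+)"] sum.mono_neutral_cong_right) auto
    have "(x + x', y + y') = (\<Sum>s\<in>F \<union> F'. ?c s *\<^sub>C t s, \<Sum>s\<in>F \<union> F'. ?c s *\<^sub>C u s)"
      unfolding eq F F' by simp
    then show ?thesis
      unfolding G_def using F(1,2) F'(1,2) by (intro CollectI exI[of _ "F \<union> F'"] exI[of _ ?c]) simp
  qed
  have scale: "(a *\<^sub>C x, a *\<^sub>C y) \<in> G" if G: "(x, y) \<in> G" for a x y
  proof -
    obtain F c where F: "finite F" "F \<subseteq> I" "x = (\<Sum>s\<in>F. c s *\<^sub>C t s)" "y = (\<Sum>s\<in>F. c s *\<^sub>C u s)"
      using G unfolding G_def by blast
    have "(a *\<^sub>C x, a *\<^sub>C y) = (\<Sum>s\<in>F. (a * c s) *\<^sub>C t s, \<Sum>s\<in>F. (a * c s) *\<^sub>C u s)"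
      by (simp add: F complex_vector.scale_sum_right)
    then show ?thesis
      unfolding G_def using F(1,2) by (intro CollectI exI[of _ F] exI[of _ "\<lambda>s. a * c s"]) simp
  qed
  have base: "(t s, u s) \<in> G" if "s \<in> I" for s
    unfolding G_def using that by (intro CollectI exI[of _ "{s}"] exI[of _ "\<lambda>_. 1"]) simp
  have "complex_vector.subspace (fst ` G)"
    unfolding complex_vector.subspace_def
  proof (intro conjI ballI allI)
    have "(0, 0) \<in> G" unfolding G_def by (intro CollectI exI[of _ "{}"]) simp
    then show "0 \<in> fst ` G" by force
  next
    fix x y assume "x \<in> fst ` G" "y \<in> fst ` G"
    then show "x + y \<in> fst ` G" using add by force
  next
    fix c x assume "x \<in> fst ` G"
    then show "c *\<^sub>C x \<in> fst ` G" using scale by force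
  qed
  moreover have "t ` I \<subseteq> fst ` G" using base by force
  ultimately have "complex_vector.span (t ` I) \<subseteq> fst ` G"
    by (intro complex_vector.span_minimal)
  then have "closure (fst ` G) = UNIV" using dense closure_mono by blast
  moreover have "norm y \<le> K * norm x" if "(x, y) \<in> G" for x y
    using that bound unfolding G_def by blast
  ultimately have "\<exists>B. bounded_clinear B \<and> (\<forall>(x, y)\<in>G. B x = y) \<and> (\<forall>x. norm (B x) \<le> K * norm x)"
    using add scale by (intro bounded_extension)
  then obtain B where B: "bounded_clinear B" "\<forall>(x, y)\<in>G. B x = y" "\<forall>x. norm (B x) \<le> K * norm x"
    by blast
  have "B (t s) = u s" if "s \<in> I" for s using bspec[OF B(2) base[OF that]] by simp
  then show ?thesis using B by blast
qed


section \<open>Finite orthonormal sets\<close>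

definition orthonormal :: "'a::complex_inner set \<Rightarrow> bool" where
  "orthonormal E \<longleftrightarrow> (\<forall>x\<in>E. \<forall>y\<in>E. cinner x y = (if x = y then 1 else 0))"

lemma orthonormalD: "orthonormal E \<Longrightarrow> x \<in> E \<Longrightarrow> y \<in> E \<Longrightarrow> cinner x y = (if x = y then 1 else 0)"
  by (simp add: orthonormal_def)

lemma cinner_sum_orthonormal:
  assumes "orthonormal E" "finite E" "e \<in> E"
  shows "cinner (\<Sum>x\<in>E. c x *\<^sub>C x) e = c e"
proof -
  have "cinner (\<Sum>x\<in>E. c x *\<^sub>C x) e = (\<Sum>x\<in>E. if x = e then c x else 0)"
    unfolding cinner.sum_left cinner_scaleC_left
    by (intro sum.cong) (use assms in \<open>auto simp: orthonormalD\<close>)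
  then show ?thesis using assms by simp
qed

lemma norm_sq_sum_orthonormal:
  assumes E: "orthonormal E" "finite E"
  shows "(norm (\<Sum>x\<in>E. c x *\<^sub>C x))\<^sup>2 = (\<Sum>x\<in>E. (cmod (c x))\<^sup>2)"
proof -
  have "norm x = 1" if "x \<in> E" for x
    using orthonormalD[OF E(1) that that] norm_sq_eq_Re_cinner[of x] power2_eq_imp_eq[of "norm x" 1]
    by simp
  moreover have "(norm (\<Sum>x\<in>E. c x *\<^sub>C x))\<^sup>2 = (\<Sum>x\<in>E. (norm (c x *\<^sub>C x))\<^sup>2)"
    by (rule norm_sum_orth) (use E in \<open>auto simp: cinner_scaleC_left cinner_scaleC_right orthonormalD\<close>)
  ultimately show ?thesis by simp
qed

lemma orth_residual:
  assumes "orthonormal E" "finite E" "e \<in> E"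
  shows "cinner (k - (\<Sum>x\<in>E. cinner k x *\<^sub>C x)) e = 0"
  using cinner_sum_orthonormal[OF assms, of "cinner k"] by (simp add: cinner.diff_left)

lemma Bessel_finite:
  assumes E: "orthonormal E" "finite E"
  shows "(\<Sum>e\<in>E. (cmod (cinner x e))\<^sup>2) \<le> (norm x)\<^sup>2"
proof -
  let ?p = "\<Sum>e\<in>E. cinner x e *\<^sub>C e"
  have "cinner (x - ?p) ?p = 0"
    unfolding cinner.sum_right
    by (intro sum.neutral) (simp add: cinner_scaleC_right orth_residual[OF E])
  then have "(norm (x - ?p + ?p))\<^sup>2 = (norm (x - ?p))\<^sup>2 + (norm ?p)\<^sup>2" by (rule norm_add_orth)
  then show ?thesis by (simp add: norm_sq_sum_orthonormal[OF E])
qed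

text \<open>The conclusion says that \<open>E\<close> spans \<open>K\<close> in the form in which it is used: as expansions in \<open>E\<close>.\<close>

lemma Gram_Schmidt:
  assumes "finite K"
  shows "\<exists>E. finite E \<and> orthonormal E \<and> E \<subseteq> complex_vector.span K \<and> (\<forall>k\<in>K. k = (\<Sum>e\<in>E. cinner k e *\<^sub>C e))"
  using assms
proof (induction K rule: finite_induct)
  case empty
  show ?case by (intro exI[of _ "{}"]) (simp add: orthonormal_def)
next
  case (insert k K)
  then obtain E where E: "finite E" "orthonormal E" "E \<subseteq> complex_vector.span K"
    and K: "\<And>k. k \<in> K \<Longrightarrow> k = (\<Sum>e\<in>E. cinner k e *\<^sub>C e)" by blast
  have span: "E \<subseteq> complex_vector.span (insert k K)"
    using E(3) complex_vector.span_mono[of K "insert k K"] by blast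
  define r where "r = k - (\<Sum>e\<in>E. cinner k e *\<^sub>C e)"
  have rE: "cinner r e = 0" if "e \<in> E" for e
    unfolding r_def by (rule orth_residual[OF E(2,1) that])
  show ?case
  proof (cases "r = 0")
    case True
    then show ?thesis using E K span by (intro exI[of _ E]) (auto simp: r_def)
  next
    case False
    define a where "a = complex_of_real (inverse (norm r))"
    define e0 where "e0 = a *\<^sub>C r"
    have "r \<in> complex_vector.span (insert k K)"
      unfolding r_def
      by (intro complex_vector.span_diff complex_vector.span_sum complex_vector.span_scale
          complex_vector.span_base subsetD[OF span]) auto
    then have e0_span: "e0 \<in> complex_vector.span (insert k K)"
      unfolding e0_def by (rule complex_vector.span_scale)
    have e0: "cinner e0 e0 = 1"
    proof -
      have "norm e0 = 1" using False by (simp add: e0_def a_def norm_inverse)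
      then show ?thesis by (simp add: cinner_self)
    qed
    have e0E: "cinner e0 e = 0" if "e \<in> E" for e
      by (simp add: e0_def cinner_scaleC_left rE that)
    have Ee0: "cinner e e0 = 0" if "e \<in> E" for e
      using e0E[OF that] by (metis cinner_commute complex_cnj_zero)
    have "e0 \<notin> E" using e0 e0E by force
    have K0: "cinner k' e0 = 0" if "k' \<in> K" for k'
      by (subst K[OF that], unfold cinner.sum_left, intro sum.neutral)
        (simp add: cinner_scaleC_left Ee0)
    have "cinner k e0 *\<^sub>C e0 = r"
    proof -
      have k: "k = r + (\<Sum>e\<in>E. cinner k e *\<^sub>C e)" by (simp add: r_def)
      have "cinner k e0 = cinner r e0 + cinner (\<Sum>e\<in>E. cinner k e *\<^sub>C e) e0"
        by (subst k, rule cinner_add_left)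
      also have "cinner (\<Sum>e\<in>E. cinner k e *\<^sub>C e) e0 = 0"
        unfolding cinner.sum_left by (intro sum.neutral) (simp add: cinner_scaleC_left Ee0)
      finally have "cinner k e0 *\<^sub>C e0 = (a * (cnj a * complex_of_real ((norm r)\<^sup>2))) *\<^sub>C r"
        by (simp add: e0_def cinner_scaleC_right cinner_self mult_ac)
      also have "a * (cnj a * complex_of_real ((norm r)\<^sup>2)) = 1"
        using False by (simp add: a_def power2_eq_square field_simps)
      finally show ?thesis by simp
    qed
    then have k: "k = (\<Sum>e\<in>insert e0 E. cinner k e *\<^sub>C e)"
      using \<open>e0 \<notin> E\<close> E(1) by (simp add: r_def)
    have "k' = (\<Sum>e\<in>insert e0 E. cinner k' e *\<^sub>C e)" if "k' \<in> K" for k'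
      using \<open>e0 \<notin> E\<close> E(1) K[OF that] K0[OF that] by simp
    then have "\<forall>k'\<in>insert k K. k' = (\<Sum>e\<in>insert e0 E. cinner k' e *\<^sub>C e)"
      using k by blast
    moreover have "orthonormal (insert e0 E)"
      using E(2) e0 e0E Ee0 \<open>e0 \<notin> E\<close> by (auto simp: orthonormal_def)
    ultimately show ?thesis
      using E(1) span e0_span by (intro exI[of _ "insert e0 E"]) blast
  qed
qed


section \<open>Tensor products of bounded operators\<close>

text \<open>The inner product identity of \<^const>\<open>hilbert_tensor\<close> without the density of the elementary tensors;
  it is all that is required of the target of an operator \<open>X \<otimes> A\<close>.\<close>

definition tensor_map ::
    "('g::complex_inner \<Rightarrow> 'k::complex_inner \<Rightarrow> 'e::complex_inner) \<Rightarrow> bool" where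
  "tensor_map t \<longleftrightarrow> (\<forall>g g' k k'. cinner (t g k) (t g' k') = cinner g g' * cinner k k')"

lemma hilbert_tensor_tensor_map: "hilbert_tensor t \<Longrightarrow> tensor_map t"
  and hilbert_tensor_dense: "hilbert_tensor t \<Longrightarrow> closure (complex_vector.span {t g k |g k. True}) = UNIV"
  by (auto simp: hilbert_tensor_def tensor_map_def)

context
  fixes t :: "'g::complex_inner \<Rightarrow> 'k::complex_inner \<Rightarrow> 'e::complex_inner"
  assumes t: "tensor_map t"
begin

lemma tensor_cinner: "cinner (t g k) (t g' k') = cinner g g' * cinner k k'"
  using t by (simp add: tensor_map_def)

text \<open>By the inner product identity the difference \<open>d\<close> of the two sides satisfies \<open>cinner d d = 0\<close>; the same
  holds for the other bilinearity laws.\<close>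

lemma tensor_add_left: "t (g + g') k = t g k + t g' k"
proof -
  let ?d = "t (g + g') k - (t g k + t g' k)"
  have "cinner ?d ?d = 0"
    by (simp add: cinner.diff_left cinner.diff_right cinner_add_left cinner_add_right
        tensor_cinner algebra_simps)
  then show ?thesis by (simp add: cinner_self_eq_0)
qed

lemma tensor_add_right: "t g (k + k') = t g k + t g k'"
proof -
  let ?d = "t g (k + k') - (t g k + t g k')"
  have "cinner ?d ?d = 0"
    by (simp add: cinner.diff_left cinner.diff_right cinner_add_left cinner_add_right
        tensor_cinner algebra_simps)
  then show ?thesis by (simp add: cinner_self_eq_0)
qed

lemma tensor_scaleC_left: "t (c *\<^sub>C g) k = c *\<^sub>C t g k"
proof -
  let ?d = "t (c *\<^sub>C g) k - c *\<^sub>C t g k"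
  have "cinner ?d ?d = 0"
    by (simp add: cinner.diff_left cinner.diff_right cinner_scaleC_left cinner_scaleC_right
        tensor_cinner algebra_simps)
  then show ?thesis by (simp add: cinner_self_eq_0)
qed

lemma tensor_scaleC_right: "t g (c *\<^sub>C k) = c *\<^sub>C t g k"
proof -
  let ?d = "t g (c *\<^sub>C k) - c *\<^sub>C t g k"
  have "cinner ?d ?d = 0"
    by (simp add: cinner.diff_left cinner.diff_right cinner_scaleC_left cinner_scaleC_right
        tensor_cinner algebra_simps)
  then show ?thesis by (simp add: cinner_self_eq_0)
qed

lemma tensor_zero_left: "t 0 k = 0"
  using tensor_scaleC_left[of 0 0 k] by simp

lemma tensor_zero_right: "t g 0 = 0"
  using tensor_scaleC_right[of g 0 0] by simp

lemma tensor_sum_left: "t (\<Sum>i\<in>F. f i) k = (\<Sum>i\<in>F. t (f i) k)"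
  by (induction F rule: infinite_finite_induct) (simp_all add: tensor_zero_left tensor_add_left)

lemma tensor_sum_right: "t g (\<Sum>i\<in>F. f i) = (\<Sum>i\<in>F. t g (f i))"
  by (induction F rule: infinite_finite_induct) (simp_all add: tensor_zero_right tensor_add_right)

lemma tensor_norm: "norm (t g k) = norm g * norm k"
proof -
  have "cinner (t g k) (t g k) = complex_of_real ((norm g * norm k)\<^sup>2)"
    by (subst tensor_cinner) (simp add: cinner_self power_mult_distrib)
  then have "(norm (t g k))\<^sup>2 = (norm g * norm k)\<^sup>2"
    by (simp only: cinner_self of_real_eq_iff)
  then show ?thesis by (rule power2_eq_imp_eq) simp_all
qed

end

text \<open>Expanding the second factors in an orthonormal basis \<open>E\<close> of their span turns a finite sum of
  elementary tensors into \<open>\<Sum>e. \<gamma> e \<otimes> e\<close>, of squared norm \<open>\<Sum>e. \<parallel>\<gamma> e\<parallel>\<^sup>2\<close>. Applying \<open>X\<close> to the first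
  factors and then expanding these in an orthonormal basis gives the bound for \<open>X \<otimes> A\<close>.\<close>

lemma tensor_norm_bound:
  fixes t :: "'g::chilbert_space \<Rightarrow> 'k::chilbert_space \<Rightarrow> 'e::chilbert_space"
    and u :: "'g'::chilbert_space \<Rightarrow> 'l::chilbert_space \<Rightarrow> 'f::chilbert_space"
  assumes t: "tensor_map t" and u: "tensor_map u"
    and X: "bounded_clinear X" "\<And>g. norm (X g) \<le> a * norm g" "a \<ge> 0"
    and A: "bounded_clinear A" "\<And>k. norm (A k) \<le> b * norm k" "b \<ge> 0"
    and F: "finite F"
  shows "norm (\<Sum>s\<in>F. c s *\<^sub>C u (X (g s)) (A (k s))) \<le> a * b * norm (\<Sum>s\<in>F. c s *\<^sub>C t (g s) (k s))"
proof -
  obtain E where E: "finite E" "orthonormal E"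
    and kE: "\<And>s. s \<in> F \<Longrightarrow> k s = (\<Sum>e\<in>E. cinner (k s) e *\<^sub>C e)"
    using Gram_Schmidt[of "k ` F"] F by auto
  define \<gamma> where "\<gamma> e = (\<Sum>s\<in>F. (c s * cinner (k s) e) *\<^sub>C g s)" for e
  have X\<gamma>: "X (\<gamma> e) = (\<Sum>s\<in>F. (c s * cinner (k s) e) *\<^sub>C X (g s))" for e
    by (simp add: \<gamma>_def bounded_clinear_sum[OF X(1)] bounded_clinear_scaleC[OF X(1)])
  have "(\<Sum>s\<in>F. c s *\<^sub>C t (g s) (k s)) = (\<Sum>s\<in>F. \<Sum>e\<in>E. (c s * cinner (k s) e) *\<^sub>C t (g s) e)"
  proof (rule sum.cong[OF refl])
    fix s assume "s \<in> F"
    have "t (g s) (k s) = (\<Sum>e\<in>E. cinner (k s) e *\<^sub>C t (g s) e)"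
      by (subst kE[OF \<open>s \<in> F\<close>]) (simp add: tensor_sum_right[OF t] tensor_scaleC_right[OF t])
    then show "c s *\<^sub>C t (g s) (k s) = (\<Sum>e\<in>E. (c s * cinner (k s) e) *\<^sub>C t (g s) e)"
      by (simp add: complex_vector.scale_sum_right)
  qed
  also have "\<dots> = (\<Sum>e\<in>E. t (\<gamma> e) e)"
    by (subst sum.swap) (simp add: \<gamma>_def tensor_sum_left[OF t] tensor_scaleC_left[OF t])
  finally have lhs: "(norm (\<Sum>s\<in>F. c s *\<^sub>C t (g s) (k s)))\<^sup>2 = (norm (\<Sum>e\<in>E. t (\<gamma> e) e))\<^sup>2"
    by simp
  also have "\<dots> = (\<Sum>e\<in>E. (norm (t (\<gamma> e) e))\<^sup>2)"
    by (rule norm_sum_orth) (use E in \<open>auto simp: tensor_cinner[OF t] orthonormalD\<close>)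
  also have "\<dots> = (\<Sum>e\<in>E. (norm (\<gamma> e))\<^sup>2)"
  proof (intro sum.cong refl)
    fix e assume "e \<in> E"
    then have "(norm e)\<^sup>2 = 1" using orthonormalD[OF E(2)] by (simp add: norm_sq_eq_Re_cinner)
    then show "(norm (t (\<gamma> e) e))\<^sup>2 = (norm (\<gamma> e))\<^sup>2"
      by (simp add: tensor_norm[OF t] power_mult_distrib)
  qed
  finally have tnorm: "(norm (\<Sum>s\<in>F. c s *\<^sub>C t (g s) (k s)))\<^sup>2 = (\<Sum>e\<in>E. (norm (\<gamma> e))\<^sup>2)" .
  have 1: "(\<Sum>s\<in>F. c s *\<^sub>C u (X (g s)) (A (k s))) = (\<Sum>e\<in>E. u (X (\<gamma> e)) (A e))"
  proof -
    have "(\<Sum>s\<in>F. c s *\<^sub>C u (X (g s)) (A (k s)))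
        = (\<Sum>s\<in>F. \<Sum>e\<in>E. (c s * cinner (k s) e) *\<^sub>C u (X (g s)) (A e))"
    proof (rule sum.cong[OF refl])
      fix s assume "s \<in> F"
      have "u (X (g s)) (A (k s)) = (\<Sum>e\<in>E. cinner (k s) e *\<^sub>C u (X (g s)) (A e))"
        by (subst kE[OF \<open>s \<in> F\<close>]) (simp add: tensor_sum_right[OF u] tensor_scaleC_right[OF u]
            bounded_clinear_sum[OF A(1)] bounded_clinear_scaleC[OF A(1)])
      then show "c s *\<^sub>C u (X (g s)) (A (k s)) = (\<Sum>e\<in>E. (c s * cinner (k s) e) *\<^sub>C u (X (g s)) (A e))"
        by (simp add: complex_vector.scale_sum_right)
    qed
    also have "\<dots> = (\<Sum>e\<in>E. u (X (\<gamma> e)) (A e))"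
      by (subst sum.swap) (simp add: X\<gamma> tensor_sum_left[OF u] tensor_scaleC_left[OF u])
    finally show ?thesis .
  qed
  obtain H where H: "finite H" "orthonormal H"
    and XH: "\<And>e. e \<in> E \<Longrightarrow> X (\<gamma> e) = (\<Sum>f\<in>H. cinner (X (\<gamma> e)) f *\<^sub>C f)"
    using Gram_Schmidt[of "(\<lambda>e. X (\<gamma> e)) ` E"] E by auto
  define \<kappa> where "\<kappa> f = (\<Sum>e\<in>E. cinner (X (\<gamma> e)) f *\<^sub>C e)" for f
  have "(\<Sum>e\<in>E. u (X (\<gamma> e)) (A e)) = (\<Sum>e\<in>E. \<Sum>f\<in>H. cinner (X (\<gamma> e)) f *\<^sub>C u f (A e))"
    by (intro sum.cong refl, subst XH) (simp_all add: tensor_sum_left[OF u] tensor_scaleC_left[OF u])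
  also have "\<dots> = (\<Sum>f\<in>H. u f (A (\<kappa> f)))"
    by (subst sum.swap) (simp add: \<kappa>_def tensor_sum_right[OF u] tensor_scaleC_right[OF u]
        bounded_clinear_sum[OF A(1)] bounded_clinear_scaleC[OF A(1)])
  finally have "(norm (\<Sum>e\<in>E. u (X (\<gamma> e)) (A e)))\<^sup>2 = (norm (\<Sum>f\<in>H. u f (A (\<kappa> f))))\<^sup>2"
    by simp
  also have "\<dots> = (\<Sum>f\<in>H. (norm (u f (A (\<kappa> f))))\<^sup>2)"
    by (rule norm_sum_orth) (use H in \<open>auto simp: tensor_cinner[OF u] orthonormalD\<close>)
  also have "\<dots> \<le> (\<Sum>f\<in>H. b\<^sup>2 * (norm (\<kappa> f))\<^sup>2)"
  proof (rule sum_mono)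
    fix f assume "f \<in> H"
    then have "(norm f)\<^sup>2 = 1" using orthonormalD[OF H(2)] by (simp add: norm_sq_eq_Re_cinner)
    then have "(norm (u f (A (\<kappa> f))))\<^sup>2 = (norm (A (\<kappa> f)))\<^sup>2"
      by (simp add: tensor_norm[OF u] power_mult_distrib)
    also have "\<dots> \<le> (b * norm (\<kappa> f))\<^sup>2" by (rule power_mono[OF A(2)]) simp
    finally show "(norm (u f (A (\<kappa> f))))\<^sup>2 \<le> b\<^sup>2 * (norm (\<kappa> f))\<^sup>2"
      by (simp add: power_mult_distrib)
  qed
  also have "\<dots> = b\<^sup>2 * (\<Sum>e\<in>E. (norm (X (\<gamma> e)))\<^sup>2)"
  proof -
    have "(norm (X (\<gamma> e)))\<^sup>2 = (\<Sum>f\<in>H. (cmod (cinner (X (\<gamma> e)) f))\<^sup>2)" if "e \<in> E" for e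
      by (subst XH[OF that]) (rule norm_sq_sum_orthonormal[OF H(2,1)])
    then have "(\<Sum>e\<in>E. (norm (X (\<gamma> e)))\<^sup>2) = (\<Sum>f\<in>H. \<Sum>e\<in>E. (cmod (cinner (X (\<gamma> e)) f))\<^sup>2)"
      by (subst sum.swap) simp
    then show ?thesis
      by (simp add: \<kappa>_def norm_sq_sum_orthonormal[OF E(2,1)] sum_distrib_left)
  qed
  also have "\<dots> \<le> b\<^sup>2 * (\<Sum>e\<in>E. a\<^sup>2 * (norm (\<gamma> e))\<^sup>2)"
    using power_mono[OF X(2) norm_ge_zero, of _ 2]
    by (intro mult_left_mono sum_mono) (simp_all add: power_mult_distrib)
  also have "\<dots> = (a * b * norm (\<Sum>s\<in>F. c s *\<^sub>C t (g s) (k s)))\<^sup>2"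
    by (simp add: power_mult_distrib tnorm sum_distrib_left mult_ac)
  finally have "(norm (\<Sum>s\<in>F. c s *\<^sub>C u (X (g s)) (A (k s))))\<^sup>2
      \<le> (a * b * norm (\<Sum>s\<in>F. c s *\<^sub>C t (g s) (k s)))\<^sup>2"
    unfolding 1 .
  then show ?thesis by (rule power2_le_imp_le) (simp add: X A)
qed

lemma tensor_op_exists:
  fixes t :: "'g::chilbert_space \<Rightarrow> 'k::chilbert_space \<Rightarrow> 'e::chilbert_space"
    and u :: "'g'::chilbert_space \<Rightarrow> 'l::chilbert_space \<Rightarrow> 'f::chilbert_space"
  assumes t: "hilbert_tensor t" and u: "tensor_map u"
    and X: "bounded_clinear X" "\<And>g. norm (X g) \<le> a * norm g" "a \<ge> 0"
    and A: "bounded_clinear A" "\<And>k. norm (A k) \<le> b * norm k" "b \<ge> 0"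
  shows "\<exists>B. bounded_clinear B \<and> (\<forall>g k. B (t g k) = u (X g) (A k)) \<and> (\<forall>z. norm (B z) \<le> a * b * norm z)"
proof -
  have im: "(\<lambda>(g, k). t g k) ` UNIV = {t g k |g k. True}" by auto
  have "\<exists>B. bounded_clinear B \<and> (\<forall>s\<in>UNIV. B (case s of (g, k) \<Rightarrow> t g k) = (case s of (g, k) \<Rightarrow> u (X g) (A k)))
      \<and> (\<forall>x. norm (B x) \<le> a * b * norm x)"
  proof (rule bounded_extension_family)
    fix F :: "('g \<times> 'k) set" and c assume "finite F"
    then show "norm (\<Sum>s\<in>F. c s *\<^sub>C (case s of (g, k) \<Rightarrow> u (X g) (A k)))
        \<le> a * b * norm (\<Sum>s\<in>F. c s *\<^sub>C (case s of (g, k) \<Rightarrow> t g k))"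
      using tensor_norm_bound[OF hilbert_tensor_tensor_map[OF t] u X A, of F c fst snd]
      by (simp add: case_prod_beta)
  next
    show "closure (complex_vector.span ((\<lambda>(g, k). t g k) ` UNIV)) = UNIV"
      unfolding im by (rule hilbert_tensor_dense[OF t])
  qed
  then show ?thesis by auto
qed

lemma op_tensor_eqI:
  fixes t :: "'g::chilbert_space \<Rightarrow> 'k::chilbert_space \<Rightarrow> 'e::chilbert_space"
    and B :: "'e \<Rightarrow> 'f::complex_inner"
  assumes t: "hilbert_tensor t" and B: "bounded_clinear B" "\<And>g k. B (t g k) = u (X g) (A k)"
  shows "op_tensor t u X A = B"
  unfolding op_tensor_def
proof (rule the_equality)
  fix B' assume B': "bounded_clinear B' \<and> (\<forall>g k. B' (t g k) = u (X g) (A k))"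
  show "B' = B"
    by (rule bounded_clinear_eq_on_dense[OF _ B(1) hilbert_tensor_dense[OF t]])
      (use B B' in auto)
qed (use B in auto)

lemma
  fixes t :: "'g::chilbert_space \<Rightarrow> 'k::chilbert_space \<Rightarrow> 'e::chilbert_space"
    and u :: "'g'::chilbert_space \<Rightarrow> 'l::chilbert_space \<Rightarrow> 'f::chilbert_space"
  assumes t: "hilbert_tensor t" and u: "tensor_map u"
    and X: "bounded_clinear X" and A: "bounded_clinear A"
  shows bounded_clinear_op_tensor: "bounded_clinear (op_tensor t u X A)"
    and op_tensor_apply: "op_tensor t u X A (t g k) = u (X g) (A k)"
    and norm_op_tensor_le: "\<And>a b z. (\<And>g. norm (X g) \<le> a * norm g) \<Longrightarrow> a \<ge> 0 \<Longrightarrow>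
      (\<And>k. norm (A k) \<le> b * norm k) \<Longrightarrow> b \<ge> 0 \<Longrightarrow> norm (op_tensor t u X A z) \<le> a * b * norm z"
proof -
  obtain a where a: "a \<ge> 0" "\<And>g. norm (X g) \<le> a * norm g"
    by (rule bounded_clinear_nonneg_bound[OF X]) (rule that)
  obtain b where b: "b \<ge> 0" "\<And>g. norm (A g) \<le> b * norm g"
    by (rule bounded_clinear_nonneg_bound[OF A]) (rule that)
  obtain B where B: "bounded_clinear B" "\<And>g k. B (t g k) = u (X g) (A k)"
    using tensor_op_exists[OF t u X a(2,1) A b(2,1)] by blast
  have eq: "op_tensor t u X A = B" by (rule op_tensor_eqI[OF t B(1)]) (rule B(2))
  show "bounded_clinear (op_tensor t u X A)" "op_tensor t u X A (t g k) = u (X g) (A k)"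
    unfolding eq by (rule B)+
  fix a b z assume "\<And>g. norm (X g) \<le> a * norm g" "a \<ge> 0" "\<And>k. norm (A k) \<le> b * norm k" "b \<ge> 0"
  then obtain B' where B': "bounded_clinear B'" "\<And>g k. B' (t g k) = u (X g) (A k)"
    "\<And>z. norm (B' z) \<le> a * b * norm z"
    using tensor_op_exists[OF t u X _ _ A] by blast
  have "op_tensor t u X A = B'" by (rule op_tensor_eqI[OF t B'(1)]) (rule B'(2))
  then show "norm (op_tensor t u X A z) \<le> a * b * norm z" using B'(3) by simp
qed


section \<open>Row contractions and their defect operators\<close>

lemma norm_sq_vec: "(norm (v::'a::real_normed_vector ^ 'n::finite))\<^sup>2 = (\<Sum>i\<in>UNIV. (norm (v $ i))\<^sup>2)"
  by (simp add: norm_vec_def L2_set_def sum_nonneg)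

lemma cadj_row_op:
  fixes T :: "'n::finite \<Rightarrow> 'h::chilbert_space \<Rightarrow> 'k::chilbert_space"
  assumes "\<And>i. bounded_clinear (T i)"
  shows "cadj (row_op T) = (\<lambda>h. \<chi> i. cadj (T i) h)"
  by (rule cadj_unique)
    (simp add: row_op_def cinner_vec_def cinner.sum_left cinner_cadj_right[OF assms])

lemma row_op_cadj:
  fixes T :: "'n::finite \<Rightarrow> 'h::chilbert_space \<Rightarrow> 'k::chilbert_space"
  assumes "\<And>i. bounded_clinear (T i)"
  shows "row_op T (cadj (row_op T) h) = (\<Sum>i\<in>UNIV. T i (cadj (T i) h))"
  by (simp add: cadj_row_op[OF assms] row_op_def)

lemma cinner_row_cadj:
  fixes T :: "'n::finite \<Rightarrow> 'h::chilbert_space \<Rightarrow> 'k::chilbert_space"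
  assumes "\<And>i. bounded_clinear (T i)"
  shows "cinner (\<Sum>i\<in>UNIV. T i (cadj (T i) h)) h = complex_of_real (\<Sum>i\<in>UNIV. (norm (cadj (T i) h))\<^sup>2)"
  by (simp add: cinner.sum_left cinner_cadj_right[OF assms, symmetric] cinner_self)

locale row_contr =
  fixes T :: "'n::finite \<Rightarrow> 'h::chilbert_space \<Rightarrow> 'h"
  assumes contraction: "row_contraction T"
begin

abbreviation "Tadj \<equiv> \<lambda>i. cadj (T i)"

lemma lin: "bounded_clinear (T i)"
  using contraction by (simp add: row_contraction_def)

lemma lin_adj: "bounded_clinear (Tadj i)"
  by (rule bounded_clinear_cadj[OF lin])

lemma lin_row: "bounded_clinear (row_op T)"
  by (rule bounded_clinear_row_op[OF lin])

lemma sum_norm_Tadj: "(\<Sum>i\<in>UNIV. (norm (Tadj i h))\<^sup>2) \<le> (norm h)\<^sup>2"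
proof -
  have "0 \<le> Re (cinner (h - (\<Sum>i\<in>UNIV. T i (Tadj i h))) h)"
    by (rule positive_op_Re) (use contraction in \<open>simp add: row_contraction_def\<close>)
  then show ?thesis
    by (simp add: cinner.diff_left cinner_row_cadj[OF lin] norm_sq_eq_Re_cinner[symmetric])
qed

lemma norm_cadj_row: "norm (cadj (row_op T) h) \<le> norm h"
proof (rule power2_le_imp_le)
  show "(norm (cadj (row_op T) h))\<^sup>2 \<le> (norm h)\<^sup>2"
    using sum_norm_Tadj[of h] by (simp add: norm_sq_vec cadj_row_op[OF lin])
qed simp

lemma norm_row: "norm (row_op T v) \<le> norm v"
  using norm_cadj_le[OF bounded_clinear_cadj[OF lin_row], of 1 v] norm_cadj_row
  by (simp add: cadj_cadj[OF lin_row])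

lemma
  shows positive_defect: "positive_op (defect T)"
    and defect_defect: "defect T (defect T h) = h - (\<Sum>i\<in>UNIV. T i (Tadj i h))"
    and defect_eqI: "\<And>B. positive_op B \<Longrightarrow> (\<And>h. B (B h) = h - (\<Sum>i\<in>UNIV. T i (Tadj i h))) \<Longrightarrow> defect T = B"
proof -
  have pos: "positive_op (\<lambda>h. h - (\<Sum>i\<in>UNIV. T i (Tadj i h)))"
    using contraction by (simp add: row_contraction_def)
  have le: "norm (x - (x - (\<Sum>i\<in>UNIV. T i (Tadj i x)))) \<le> norm x" for x
    using order_trans[OF norm_row norm_cadj_row, of x] by (simp add: row_op_cadj[OF lin])
  show "positive_op (defect T)" unfolding defect_def by (rule positive_op_sqrt[OF pos le])
  show "defect T (defect T h) = h - (\<Sum>i\<in>UNIV. T i (Tadj i h))"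
    unfolding defect_def by (rule op_sqrt_op_sqrt[OF pos le])
  show "defect T = B" if "positive_op B" "\<And>h. B (B h) = h - (\<Sum>i\<in>UNIV. T i (Tadj i h))" for B
    unfolding defect_def by (rule op_sqrt_eqI[OF pos le that(1)]) (simp add: fun_eq_iff that(2))
qed

lemma
  shows positive_defect_star: "positive_op (defect_star T)"
    and defect_star_defect_star: "defect_star T (defect_star T v) = v - cadj (row_op T) (row_op T v)"
proof -
  have "cinner (v - cadj (row_op T) (row_op T v)) v = complex_of_real ((norm v)\<^sup>2 - (norm (row_op T v))\<^sup>2)" for v
    by (simp add: cinner.diff_left cinner_cadj_left[OF lin_row] cinner_self)
  then have "0 \<le> cinner (v - cadj (row_op T) (row_op T v)) v" for v
    using power_mono[OF norm_row[of v] norm_ge_zero, of 2]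
    by (simp add: complex_nonneg_iff del: of_real_power of_real_diff)
  moreover have "bounded_clinear (\<lambda>v. v - cadj (row_op T) (row_op T v))"
    by (intro bounded_clinear_minus bounded_clinear_id bounded_clinear_compose[OF bounded_clinear_cadj] lin_row)
  ultimately have pos: "positive_op (\<lambda>v. v - cadj (row_op T) (row_op T v))"
    by (simp add: positive_op_def)
  have le: "norm (x - (x - cadj (row_op T) (row_op T x))) \<le> norm x" for x
    using order_trans[OF norm_cadj_row norm_row, of x] by simp
  show "positive_op (defect_star T)" unfolding defect_star_def by (rule positive_op_sqrt[OF pos le])
  show "defect_star T (defect_star T v) = v - cadj (row_op T) (row_op T v)"
    unfolding defect_star_def by (rule op_sqrt_op_sqrt[OF pos le])
qed

lemmas lin_defect = positive_op_bounded_clinear[OF positive_defect]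
lemmas lin_defect_star = positive_op_bounded_clinear[OF positive_defect_star]

lemma norm_sq_defect: "(norm (defect T h))\<^sup>2 = (norm h)\<^sup>2 - (\<Sum>i\<in>UNIV. (norm (Tadj i h))\<^sup>2)"
proof -
  have "cinner (defect T h) (defect T h) = cinner (defect T (defect T h)) h"
    by (simp add: positive_op_selfadjoint[OF positive_defect])
  then show ?thesis
    by (simp add: defect_defect cinner.diff_left cinner_row_cadj[OF lin] norm_sq_eq_Re_cinner
        flip: of_real_sum of_real_power)
qed

end

lemma csubspace_range:
  assumes "bounded_clinear A"
  shows "complex_vector.subspace (range A)"
  unfolding complex_vector.subspace_def
  using bounded_clinear_zero[OF assms] bounded_clinear_add[OF assms] bounded_clinear_scaleC[OF assms]
  by (metis (no_types, lifting) rangeE rangeI)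

lemma positive_op_0_on_orth_range:
  assumes S: "positive_op S" and x: "\<And>y. cinner x (S y) = 0"
  shows "S x = 0"
  by (rule cinner_eqI) (simp add: x positive_op_selfadjoint[OF S])

text \<open>The component of \<open>x\<close> orthogonal to the range of the self-adjoint operator \<open>S\<close> lies in its kernel.\<close>

lemma in_closure_range_if_orth_kernel:
  fixes S :: "'a::chilbert_space \<Rightarrow> 'a"
  assumes S: "positive_op S" and x: "\<And>y. S y = 0 \<Longrightarrow> cinner x y = 0"
  shows "x \<in> closure (range S)"
proof -
  obtain p where p: "p \<in> closure (range S)" "x - p \<in> orth_compl (closure (range S))"
    using orthogonal_decomposition[OF closure_csubspace[OF csubspace_range] closed_closure, of S x]
      positive_op_bounded_clinear[OF S] by blast
  have "S (x - p) = 0"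
    by (rule positive_op_0_on_orth_range[OF S])
      (use p(2) closure_subset[of "range S"] in \<open>auto simp: orth_compl_def\<close>)
  then have "cinner x (x - p) = 0" by (rule x)
  moreover have "cinner p (x - p) = 0"
  proof -
    have "cinner (x - p) p = 0" using p by (auto simp: orth_compl_def)
    then show ?thesis by (subst cinner_commute) simp
  qed
  ultimately have "cinner (x - p) (x - p) = 0" by (simp add: cinner.diff_left)
  then have "x = p" by (simp add: cinner_self_eq_0)
  then show ?thesis by (simp add: p(1))
qed

lemma orth_closure_rangeD:
  assumes "x \<in> orth_compl (closure (range S))" "positive_op S"
  shows "S x = 0"
  by (rule positive_op_0_on_orth_range[OF assms(2)])
    (use assms(1) closure_subset[of "range S"] in \<open>auto simp: orth_compl_def\<close>)

lemma orth_closure_rangeI: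
  assumes S: "positive_op S" and x: "S x = 0"
  shows "x \<in> orth_compl (closure (range S))"
proof -
  have "cinner x y = 0" if y: "y \<in> closure (range S)" for y
  proof -
    obtain f where f: "\<And>n::nat. f n \<in> range S" "f \<longlonglongrightarrow> y"
      using y unfolding closure_sequential by blast
    have "cinner x (f n) = 0" for n
    proof -
      obtain z where "f n = S z" using f(1)[of n] by blast
      then show ?thesis by (simp add: x positive_op_selfadjoint[OF S, symmetric])
    qed
    moreover have "(\<lambda>n. cinner x (f n)) \<longlonglongrightarrow> cinner x y"
      by (intro cinner.tendsto tendsto_const f)
    ultimately show ?thesis by (simp add: LIMSEQ_const_iff)
  qed
  then show ?thesis by (simp add: orth_compl_def)
qed

lemma cinner_eq_on_dense:
  fixes x y :: "'a::chilbert_space"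
  assumes dense: "closure (complex_vector.span S) = UNIV"
    and eq: "\<And>z. z \<in> S \<Longrightarrow> cinner x z = cinner y z"
  shows "x = y"
proof -
  have "cinner z (x - y) = 0" if "z \<in> S" for z
    using eq[OF that] by (subst cinner_commute) (simp add: cinner.diff_left)
  then have "(\<lambda>z. cinner z (x - y)) = (\<lambda>_. 0)"
    by (intro bounded_clinear_eq_on_dense[OF _ bounded_clinear_0 dense]
        bounded_clinearI[where K = "norm (x - y)"])
      (simp_all add: cinner_add_left cinner_scaleC_left scaleC_complex_def mult.commute
        order_trans[OF cinner_Cauchy_Schwarz])
  then have "cinner (x - y) (x - y) = 0" by (rule fun_cong)
  then show ?thesis by (simp add: cinner_self_eq_0)
qed

context row_contr
begin

lemma csubspace_defect_star_space: "complex_vector.subspace (defect_star_space T)"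
  unfolding defect_star_space_def by (rule closure_csubspace[OF csubspace_range[OF lin_defect_star]])

lemma closed_defect_star_space: "closed (defect_star_space T)"
  by (simp add: defect_star_space_def)

text \<open>The defect operator annihilates the orthogonal complement of the defect space, so restricting it to
  this space does not change it.\<close>

lemma op_restrict_defect_star: "op_restrict (defect_star T) (defect_star_space T) = defect_star T"
proof
  fix v
  have "v - orth_proj (defect_star_space T) v \<in> orth_compl (defect_star_space T)"
    by (rule orth_proj_compl[OF csubspace_defect_star_space closed_defect_star_space])
  then have "defect_star T (v - orth_proj (defect_star_space T) v) = 0"
    unfolding defect_star_space_def by (rule orth_closure_rangeD[OF _ positive_defect_star])
  then show "op_restrict (defect_star T) (defect_star_space T) v = defect_star T v"
    by (simp add: op_restrict_def bounded_clinear_diff[OF lin_defect_star])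
qed

lemma lin_row_restrict: "bounded_clinear (op_restrict (row_op T) (defect_star_space T))"
  unfolding op_restrict_def
  by (intro bounded_clinear_comp lin_row bounded_clinear_orth_proj csubspace_defect_star_space
      closed_defect_star_space)

text \<open>If \<open>\<Delta>\<^sub>T x = 0\<close> then \<open>x = TT\<^sup>*x\<close>, hence \<open>T\<^sup>*x\<close> is in the kernel of \<open>I - T\<^sup>*T\<close>. So \<open>T\<close> maps
  the defect space of \<open>T\<^sup>*\<close> into that of \<open>T\<close>.\<close>

lemma row_defect_star_space:
  assumes v: "v \<in> defect_star_space T"
  shows "row_op T v \<in> defect_space T"
  unfolding defect_space_def
proof (rule in_closure_range_if_orth_kernel[OF positive_defect])
  fix x assume "defect T x = 0"
  then have "x = row_op T (cadj (row_op T) x)"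
    using defect_defect[of x] by (simp add: bounded_clinear_zero[OF lin_defect] row_op_cadj[OF lin])
  then have "defect_star T (defect_star T (cadj (row_op T) x)) = 0"
    by (simp add: defect_star_defect_star)
  then have "cinner (defect_star T (cadj (row_op T) x)) (defect_star T (cadj (row_op T) x)) = 0"
    by (simp flip: positive_op_selfadjoint[OF positive_defect_star])
  then have "defect_star T (cadj (row_op T) x) = 0" by (simp add: cinner_self_eq_0)
  then have "cadj (row_op T) x \<in> orth_compl (defect_star_space T)"
    unfolding defect_star_space_def by (rule orth_closure_rangeI[OF positive_defect_star])
  then have "cinner (cadj (row_op T) x) v = 0" using v by (auto simp: orth_compl_def)
  then have "cinner x (row_op T v) = 0" by (simp add: cinner_cadj_left[OF lin_row])
  then show "cinner (row_op T v) x = 0" by (subst cinner_commute) simp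
qed

end


section \<open>The expansion of the characteristic function\<close>

lemma word_op_append: "word_op X (\<alpha> @ \<beta>) = word_op X \<alpha> \<circ> word_op X \<beta>"
  by (induction \<alpha>) auto

text \<open>The coefficients of the characteristic function, read off from the Neumann series
  \<open>(I - \<Sum>i. X\<^sub>i \<otimes> T\<^sub>i\<^sup>*)\<^sup>-\<^sup>1 = \<Sum>\<alpha>. X\<^sub>\<alpha> \<otimes> T\<^sup>*\<^sub>\<alpha>\<close>: the
  row \<open>[X\<^sub>i \<otimes> I]\<close> to its right appends the last letter \<open>i\<close> to the word \<open>\<alpha>\<close> and selects the component
  \<open>i\<close> of \<open>\<Delta>\<^sub>T\<^sub>*\<close>.\<close>

definition theta_coeff ::
    "('n::finite \<Rightarrow> 'h::chilbert_space \<Rightarrow> 'h) \<Rightarrow> 'n list \<Rightarrow> 'h ^ 'n \<Rightarrow> 'h" where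
  "theta_coeff T \<gamma> v = (if \<gamma> = [] then - op_restrict (row_op T) (defect_star_space T) v
     else defect T (word_op (\<lambda>i. cadj (T i)) (butlast \<gamma>) (defect_star T v $ last \<gamma>)))"

context row_contr
begin

lemma lin_theta_coeff: "bounded_clinear (theta_coeff T \<gamma>)"
proof (cases "\<gamma> = []")
  case True
  then show ?thesis by (simp add: theta_coeff_def[abs_def] bounded_clinear_uminus[OF lin_row_restrict])
next
  case False
  then show ?thesis
    by (simp add: theta_coeff_def[abs_def]) (intro bounded_clinear_compose[OF lin_defect]
        bounded_clinear_compose[OF bounded_clinear_word_op[OF lin_adj]]
        bounded_clinear_compose[OF bounded_clinear_vec_nth lin_defect_star])
qed

lemma theta_coeff_ops_between:
  "theta_coeff T \<gamma> \<in> ops_between (defect_star_space T) (defect_space T)"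
  unfolding ops_between_def
proof (intro CollectI conjI lin_theta_coeff ballI)
  have sub: "complex_vector.subspace (defect_space T)"
    unfolding defect_space_def by (rule closure_csubspace[OF csubspace_range[OF lin_defect]])
  show "range (theta_coeff T \<gamma>) \<subseteq> defect_space T"
  proof (cases "\<gamma> = []")
    case True
    have "row_op T (orth_proj (defect_star_space T) v) \<in> defect_space T" for v
      by (intro row_defect_star_space orth_proj_in csubspace_defect_star_space closed_defect_star_space)
    then show ?thesis
      using True by (auto simp: theta_coeff_def op_restrict_def complex_vector.subspace_neg[OF sub])
  next
    case False
    then show ?thesis
      using closure_subset[of "range (defect T)"] by (auto simp: theta_coeff_def defect_space_def)
  qed
  fix x assume x: "x \<in> orth_compl (defect_star_space T)"
  then have "defect_star T x = 0"
    unfolding defect_star_space_def by (rule orth_closure_rangeD[OF _ positive_defect_star])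
  moreover have "orth_proj (defect_star_space T) x = 0"
    using x by (intro orth_proj_eqI csubspace_defect_star_space)
      (auto simp: complex_vector.subspace_0[OF csubspace_defect_star_space])
  ultimately show "theta_coeff T \<gamma> x = 0"
    by (simp add: theta_coeff_def op_restrict_def bounded_clinear_zero[OF lin_row]
        bounded_clinear_zero[OF lin_defect] bounded_clinear_zero[OF bounded_clinear_word_op[OF lin_adj]])
qed

end

lemma op_tensor_comp:
  fixes t :: "'g::chilbert_space \<Rightarrow> 'k::chilbert_space \<Rightarrow> 'e::chilbert_space"
    and u :: "'g'::chilbert_space \<Rightarrow> 'l::chilbert_space \<Rightarrow> 'f::chilbert_space"
    and w :: "'g''::chilbert_space \<Rightarrow> 'm::chilbert_space \<Rightarrow> 'd::chilbert_space"
  assumes t: "hilbert_tensor t" and u: "hilbert_tensor u" and w: "tensor_map w"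
    and X: "bounded_clinear X" and A: "bounded_clinear A"
    and Y: "bounded_clinear Y" and B: "bounded_clinear B"
  shows "op_tensor u w Y B (op_tensor t u X A z) = op_tensor t w (\<lambda>g. Y (X g)) (\<lambda>k. B (A k)) z"
proof -
  note u' = hilbert_tensor_tensor_map[OF u]
  have "op_tensor t w (\<lambda>g. Y (X g)) (\<lambda>k. B (A k)) = (\<lambda>z. op_tensor u w Y B (op_tensor t u X A z))"
    by (rule op_tensor_eqI[OF t])
      (simp_all add: bounded_clinear_compose bounded_clinear_op_tensor op_tensor_apply t u u' w X A Y B)
  then show ?thesis by simp
qed

lemma op_tensor_tensor_vec_nth:
  fixes t :: "'g::chilbert_space \<Rightarrow> 'k::chilbert_space \<Rightarrow> 'e::chilbert_space"
    and u :: "'g'::chilbert_space \<Rightarrow> 'l::chilbert_space \<Rightarrow> 'f::chilbert_space"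
    and B :: "'k \<Rightarrow> 'l ^ 'n::finite"
  assumes t: "hilbert_tensor t" and u: "hilbert_tensor u"
    and X: "bounded_clinear X" and B: "bounded_clinear B"
  shows "op_tensor t (tensor_vec u) X B z $ i = op_tensor t u X (\<lambda>v. B v $ i) z"
proof -
  have uv: "tensor_map (tensor_vec u :: _ \<Rightarrow> 'l ^ 'n \<Rightarrow> _)"
    by (rule hilbert_tensor_tensor_map[OF hilbert_tensor_tensor_vec[OF u]])
  have "op_tensor t u X (\<lambda>v. B v $ i) = (\<lambda>z. op_tensor t (tensor_vec u) X B z $ i)"
    by (rule op_tensor_eqI[OF t bounded_clinear_compose[OF bounded_clinear_vec_nth
          bounded_clinear_op_tensor[OF t uv X B]]])
      (simp only: op_tensor_apply[OF t uv X B], simp add: tensor_vec_def)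
  then show ?thesis by simp
qed

text \<open>Writing \<open>\<Sum>i. X\<^sub>i \<otimes> T\<^sub>i\<^sup>*\<close> as the product of the row \<open>[X\<^sub>i \<otimes> I]\<close> (the adjoint of the column
  \<open>[X\<^sub>i\<^sup>* \<otimes> I]\<close>) and the column \<open>[I \<otimes> T\<^sub>i\<^sup>*]\<close>, which is a contraction, bounds its norm by that of the row \<open>X\<close>.\<close>

lemma (in row_contr) norm_sum_op_tensor_le:
  fixes t :: "'g::chilbert_space \<Rightarrow> 'h \<Rightarrow> 'e::chilbert_space"
  assumes t: "hilbert_tensor t" and X: "strict_row_contraction X"
  obtains r where "0 \<le> r" "r < 1"
    "\<And>z. norm (\<Sum>i\<in>UNIV. op_tensor t t (X i) (Tadj i) z) \<le> r * norm z"
proof -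
  have linX: "bounded_clinear (X i)" for i
    using X by (simp add: strict_row_contraction_def)
  note t' = hilbert_tensor_tensor_map[OF t]
  note tens = tensor_cinner[OF t']
  let ?Q = "\<lambda>g. \<Sum>i\<in>UNIV. X i (cadj (X i) g)"
  define \<rho> where "\<rho> = onorm ?Q"
  have linQ: "bounded_linear ?Q"
    by (intro bounded_clinear_bounded_linear bounded_clinear_setsum
        bounded_clinear_compose[OF linX bounded_clinear_cadj[OF linX]])
  have \<rho>: "0 \<le> \<rho>" "\<rho> < 1"
    using X onorm_pos_le[OF linQ] by (simp_all add: \<rho>_def strict_row_contraction_def)
  define C where "C = cadj (row_op X)"
  have linC: "bounded_clinear C"
    unfolding C_def by (rule bounded_clinear_cadj[OF bounded_clinear_row_op[OF linX]])
  have C: "C g = (\<chi> i. cadj (X i) g)" for g by (simp add: C_def cadj_row_op[OF linX])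
  have normC: "norm (C g) \<le> sqrt \<rho> * norm g" for g
  proof (rule power2_le_imp_le)
    have "(norm (C g))\<^sup>2 = Re (cinner (?Q g) g)"
      by (simp only: norm_sq_vec C cinner_row_cadj[OF linX] Re_complex_of_real vec_lambda_beta)
    also have "\<dots> \<le> norm (?Q g) * norm g"
      using complex_Re_le_cmod cinner_Cauchy_Schwarz by (rule order_trans)
    also have "\<dots> \<le> (\<rho> * norm g) * norm g"
      unfolding \<rho>_def by (intro mult_right_mono onorm[OF linQ]) simp
    also have "\<dots> = (sqrt \<rho> * norm g)\<^sup>2"
      using \<rho> by (simp add: power_mult_distrib) (simp add: power2_eq_square)
    finally show "(norm (C g))\<^sup>2 \<le> (sqrt \<rho> * norm g)\<^sup>2" .
  qed (use \<rho> in simp)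
  define t2 :: "'g ^ 'n \<Rightarrow> 'h \<Rightarrow> 'e ^ 'n" where "t2 v k = (\<chi> i. t (v $ i) k)" for v k
  have t2: "tensor_map t2"
    by (simp add: tensor_map_def t2_def cinner_vec_def tens sum_distrib_right)
  have tv: "tensor_map (tensor_vec t :: _ \<Rightarrow> 'h ^ 'n \<Rightarrow> _)"
    by (rule hilbert_tensor_tensor_map[OF hilbert_tensor_tensor_vec[OF t]])
  define c1 where "c1 = op_tensor t t2 C id"
  define c2 where "c2 = op_tensor t (tensor_vec t) id (cadj (row_op T))"
  note lin_cadj_row = bounded_clinear_cadj[OF lin_row]
  note id = bounded_clinear_id(1)
  have c1: "bounded_clinear c1" "\<And>g k. c1 (t g k) = t2 (C g) k" "\<And>z. norm (c1 z) \<le> sqrt \<rho> * norm z"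
    unfolding c1_def using bounded_clinear_op_tensor[OF t t2 linC id] op_tensor_apply[OF t t2 linC id]
      norm_op_tensor_le[OF t t2 linC id normC, of 1] \<rho> by simp_all
  have c2: "bounded_clinear c2" "\<And>g k. c2 (t g k) = tensor_vec t g (cadj (row_op T) k)"
    "\<And>z. norm (c2 z) \<le> norm z"
    unfolding c2_def using bounded_clinear_op_tensor[OF t tv id lin_cadj_row]
      op_tensor_apply[OF t tv id lin_cadj_row]
      norm_op_tensor_le[OF t tv id lin_cadj_row, of 1 1] norm_cadj_row by simp_all
  let ?W = "\<lambda>z. \<Sum>i\<in>UNIV. op_tensor t t (X i) (Tadj i) z"
  have linW: "bounded_clinear ?W"
    by (intro bounded_clinear_setsum bounded_clinear_op_tensor t t' linX lin_adj)
  have W: "cadj c1 (c2 (t g k)) = ?W (t g k)" for g k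
  proof (rule cinner_eq_on_dense[OF hilbert_tensor_dense[OF t]])
    fix z assume "z \<in> {t g k |g k. True}"
    then obtain g' k' where z: "z = t g' k'" by blast
    show "cinner (cadj c1 (c2 (t g k))) z = cinner (?W (t g k)) z"
      unfolding z cinner_cadj_left[OF c1(1)] c1(2) c2(2)
      by (simp add: tensor_vec_def t2_def cadj_row_op[OF lin] cinner_vec_def cinner.sum_left tens C
          op_tensor_apply[OF t t' linX lin_adj] cinner_cadj_right[OF linX])
  qed
  have "?W = (\<lambda>z. cadj c1 (c2 z))"
    by (rule bounded_clinear_eq_on_dense[OF linW bounded_clinear_compose[OF bounded_clinear_cadj[OF c1(1)] c2(1)]
          hilbert_tensor_dense[OF t]]) (use W in auto)
  then have "norm (?W z) \<le> sqrt \<rho> * norm z" for z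
    using norm_cadj_le[OF c1(1,3), of "c2 z"] \<rho> mult_left_mono[OF c2(3), of "sqrt \<rho>" z]
    by (simp add: fun_eq_iff)
  then show ?thesis using that[of "sqrt \<rho>"] \<rho> by simp
qed


lemma funpow_norm_le:
  fixes W :: "'a::real_normed_vector \<Rightarrow> 'a"
  assumes "0 \<le> r" "\<And>z. norm (W z) \<le> r * norm z"
  shows "norm ((W ^^ k) z) \<le> r ^ k * norm z"
proof (induction k)
  case (Suc k)
  then show ?case
    using assms(2)[of "(W ^^ k) z"] mult_left_mono[OF Suc assms(1)] by (simp add: mult_ac)
qed simp

text \<open>\<open>I - W\<close> is bounded below by \<open>1 - r\<close>, hence injective; it is onto by Banach's fixed point theorem for
  \<open>z \<mapsto> y + W z\<close>. The exact remainder of the Neumann series gives convergence at the rate \<open>r ^ N\<close> in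
  operator norm without any infinite sums of operators.\<close>

lemma Neumann:
  fixes W :: "'e::chilbert_space \<Rightarrow> 'e"
  assumes W: "bounded_clinear W" and r: "0 \<le> r" "r < 1" "\<And>z. norm (W z) \<le> r * norm z"
  defines "R \<equiv> inv (\<lambda>z. z - W z)"
  shows "bounded_clinear R" "R y = (\<Sum>k<N. (W ^^ k) y) + R ((W ^^ N) y)"
proof -
  let ?M = "\<lambda>z. z - W z"
  have lower: "(1 - r) * norm z \<le> norm (?M z)" for z
    using r(3)[of z] norm_triangle_ineq2[of z "W z"] by (simp add: algebra_simps)
  have linM: "bounded_clinear ?M" by (intro bounded_clinear_minus bounded_clinear_id W)
  have inj: "inj ?M"
  proof (rule injI)
    fix x y assume "?M x = ?M y"
    then have "?M (x - y) = 0" by (simp add: bounded_clinear_diff[OF W] algebra_simps)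
    then have "(1 - r) * norm (x - y) \<le> 0" using lower[of "x - y"] by simp
    then show "x = y" using r(2) by (simp add: mult_le_0_iff)
  qed
  have "\<exists>z. ?M z = y" for y
  proof -
    have "\<exists>!z. y + W z = z"
      by (rule banach_fix_type[OF r(1,2)])
        (use r(3) in \<open>simp add: dist_norm flip: bounded_clinear_diff[OF W]\<close>)
    then obtain z where "y + W z = z" by blast
    then show ?thesis by (intro exI[of _ z]) (simp add: algebra_simps)
  qed
  then have MR: "R y - W (R y) = y" for y
    unfolding R_def by (intro f_inv_into_f[of y ?M UNIV]) (metis rangeI)
  have unique: "R y = z" if "z - W z = y" for y z
    by (rule injD[OF inj]) (simp only: MR that)
  show "bounded_clinear R"
  proof (rule bounded_clinearI)
    show "R (x + y) = R x + R y" for x y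
      by (rule unique) (simp add: bounded_clinear_add[OF W] add_diff_add MR)
    show "R (c *\<^sub>C x) = c *\<^sub>C R x" for c x
      by (rule unique) (simp add: bounded_clinear_scaleC[OF W] MR flip: scaleC_diff_right)
    show "norm (R x) \<le> (1 / (1 - r)) * norm x" for x
      using lower[of "R x"] r(2) by (simp add: MR field_simps)
  qed
  show "R y = (\<Sum>k<N. (W ^^ k) y) + R ((W ^^ N) y)"
  proof (rule unique)
    let ?s = "\<Sum>k<N. (W ^^ k) y" and ?w = "(W ^^ N) y"
    have "?s - W ?s = y - ?w"
      by (induction N) (simp_all add: bounded_clinear_zero[OF W] bounded_clinear_add[OF W] add_diff_add)
    moreover have "?s + R ?w - W (?s + R ?w) = (?s - W ?s) + (R ?w - W (R ?w))"
      by (simp only: bounded_clinear_add[OF W] add_diff_add)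
    ultimately show "?s + R ?w - W (?s + R ?w) = y" by (simp only: MR) simp
  qed
qed

lemma finite_words: "finite {\<alpha> :: 'n::finite list. length \<alpha> = k}"
  using finite_lists_length_eq[of "UNIV :: 'n set" k] by simp

lemma finite_words_less: "finite {\<alpha> :: 'n::finite list. length \<alpha> < k}"
  by (rule finite_subset[OF _ finite_lists_length_le[of UNIV k]]) auto

lemma sum_words_Suc:
  fixes f :: "'n::finite list \<Rightarrow> 'z::comm_monoid_add"
  shows "(\<Sum>\<alpha> | length \<alpha> = Suc k. f \<alpha>) = (\<Sum>i\<in>UNIV. \<Sum>\<alpha> | length \<alpha> = k. f (i # \<alpha>))"
  unfolding sum.cartesian_product
  by (rule sum.reindex_bij_witness[of _ "\<lambda>(i, \<alpha>). i # \<alpha>" "\<lambda>\<alpha>. (hd \<alpha>, tl \<alpha>)"])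
    (auto simp: length_Suc_conv)

lemma sum_words_snoc:
  fixes f :: "'n::finite list \<Rightarrow> 'z::comm_monoid_add"
  shows "(\<Sum>\<alpha> | length \<alpha> = Suc k. f \<alpha>) = (\<Sum>\<alpha> | length \<alpha> = k. \<Sum>i\<in>UNIV. f (\<alpha> @ [i]))"
  unfolding sum.cartesian_product
  by (rule sum.reindex_bij_witness[of _ "\<lambda>(\<alpha>, i). \<alpha> @ [i]" "\<lambda>\<alpha>. (butlast \<alpha>, last \<alpha>)"])
    (auto simp: length_Suc_conv_rev)

context row_contr
begin

context
  fixes t :: "'g::chilbert_space \<Rightarrow> 'h \<Rightarrow> 'e::chilbert_space" and X :: "'n \<Rightarrow> 'g \<Rightarrow> 'g"
  assumes t: "hilbert_tensor t" and X: "strict_row_contraction X"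
begin

lemma lin_X: "bounded_clinear (X i)"
  using X by (simp add: strict_row_contraction_def)

lemma tensor_t: "tensor_map t"
  by (rule hilbert_tensor_tensor_map[OF t])

lemma hilbert_tv: "hilbert_tensor (tensor_vec t :: _ \<Rightarrow> 'h ^ 'n \<Rightarrow> _)"
  by (rule hilbert_tensor_tensor_vec[OF t])

lemma tensor_tv: "tensor_map (tensor_vec t :: _ \<Rightarrow> 'h ^ 'n \<Rightarrow> _)"
  by (rule hilbert_tensor_tensor_map[OF hilbert_tv])

text \<open>The operators \<open>\<Sum>i. X\<^sub>i \<otimes> T\<^sub>i\<^sup>*\<close> and \<open>[X\<^sub>1 \<otimes> I, \<dots>, X\<^sub>n \<otimes> I] (I \<otimes> \<Delta>\<^sub>T\<^sub>*)\<close>, of which \<open>\<Theta>\<^sub>T(X)\<close> is composed.\<close>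

definition pencil :: "'e \<Rightarrow> 'e" where
  "pencil z = (\<Sum>i\<in>UNIV. op_tensor t t (X i) (Tadj i) z)"

definition inner_factor :: "'e ^ 'n \<Rightarrow> 'e" where
  "inner_factor y = row_op (\<lambda>i. op_tensor t t (X i) id) (op_tensor (tensor_vec t) (tensor_vec t) id (defect_star T) y)"

lemma lin_pencil: "bounded_clinear pencil"
  unfolding pencil_def[abs_def]
  by (intro bounded_clinear_setsum bounded_clinear_op_tensor t tensor_t lin_X lin_adj)

lemma lin_inner_factor: "bounded_clinear inner_factor"
  unfolding inner_factor_def[abs_def]
  by (intro bounded_clinear_compose[OF bounded_clinear_row_op] bounded_clinear_op_tensor t tensor_t hilbert_tv tensor_tv lin_X
      bounded_clinear_id lin_defect_star)

lemma pencil_power: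
  "(pencil ^^ k) z = (\<Sum>\<alpha> | length \<alpha> = k. op_tensor t t (word_op X \<alpha>) (word_op Tadj \<alpha>) z)"
proof (induction k)
  case 0
  have "op_tensor t t id id = (\<lambda>z. z)"
    by (rule op_tensor_eqI[OF t]) (auto simp: bounded_clinear_id)
  then show ?case by (simp add: id_def)
next
  case (Suc k)
  note wX = bounded_clinear_word_op[OF lin_X] and wT = bounded_clinear_word_op[OF lin_adj]
  have "(pencil ^^ Suc k) z = (\<Sum>i\<in>UNIV. \<Sum>\<alpha> | length \<alpha> = k.
      op_tensor t t (X i) (Tadj i) (op_tensor t t (word_op X \<alpha>) (word_op Tadj \<alpha>) z))"
    by (simp add: Suc pencil_def[of "sum _ _"]
        bounded_clinear_sum[OF bounded_clinear_op_tensor[OF t tensor_t lin_X lin_adj]])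
  then show ?case
    by (simp add: sum_words_Suc op_tensor_comp[OF t t tensor_t wX wT lin_X lin_adj] o_def)
qed

text \<open>The homogeneous part of degree \<open>k + 1\<close>: in the expansion of the power over words \<open>\<alpha>\<close> of length \<open>k\<close>,
  the factor \<open>[X\<^sub>i \<otimes> I]\<close> appends a letter to \<open>\<alpha>\<close>.\<close>

lemma defect_pencil_term:
  "op_tensor t t id (defect T) ((pencil ^^ k) (inner_factor y))
    = (\<Sum>\<alpha> | length \<alpha> = Suc k. op_tensor (tensor_vec t) t (word_op X \<alpha>) (theta_coeff T \<alpha>) y)"
proof -
  note wX = bounded_clinear_word_op[OF lin_X] and wT = bounded_clinear_word_op[OF lin_adj]
  note id = bounded_clinear_id(1)
  note D = lin_defect
  have Ds: "bounded_clinear (\<lambda>v. defect_star T v $ i)" for i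
    by (rule bounded_clinear_compose[OF bounded_clinear_vec_nth lin_defect_star])
  have inn: "inner_factor y = (\<Sum>i\<in>UNIV. op_tensor (tensor_vec t) t (X i) (\<lambda>v. defect_star T v $ i) y)"
    by (simp add: inner_factor_def row_op_def op_tensor_tensor_vec_nth[OF hilbert_tv t id lin_defect_star]
        op_tensor_comp[OF hilbert_tv t tensor_t id Ds lin_X id])
  have XwX: "bounded_clinear (\<lambda>g. word_op X \<alpha> (X i g))" for \<alpha> i
    by (rule bounded_clinear_compose[OF wX lin_X])
  have TwT: "bounded_clinear (\<lambda>v. word_op Tadj \<alpha> (defect_star T v $ i))" for \<alpha> i
    by (rule bounded_clinear_compose[OF wT Ds])
  have word: "word_op X (\<alpha> @ [i]) = (\<lambda>g. word_op X \<alpha> (X i g))" for \<alpha> i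
    by (simp add: word_op_append o_def)
  have coeff: "theta_coeff T (\<alpha> @ [i]) = (\<lambda>v. defect T (word_op Tadj \<alpha> (defect_star T v $ i)))" for \<alpha> i
    by (simp add: theta_coeff_def[abs_def])
  have "op_tensor t t id (defect T) ((pencil ^^ k) (inner_factor y)) = (\<Sum>\<alpha> | length \<alpha> = k. \<Sum>i\<in>UNIV.
     op_tensor t t id (defect T) (op_tensor t t (word_op X \<alpha>) (word_op Tadj \<alpha>)
       (op_tensor (tensor_vec t) t (X i) (\<lambda>v. defect_star T v $ i) y)))"
    unfolding pencil_power inn
    by (simp only: bounded_clinear_sum[OF bounded_clinear_op_tensor[OF t tensor_t id D]]
        bounded_clinear_sum[OF bounded_clinear_op_tensor[OF t tensor_t wX wT]])
  then show ?thesis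
    unfolding sum_words_snoc op_tensor_comp[OF hilbert_tv t tensor_t lin_X Ds wX wT]
      op_tensor_comp[OF hilbert_tv t tensor_t XwX TwT id D] word coeff by simp
qed

lemma char_fun_eq:
  "char_fun t T X y = op_tensor (tensor_vec t) t id (theta_coeff T []) y
     + op_tensor t t id (defect T) (inv (\<lambda>z. z - pencil z) (inner_factor y))"
proof -
  note lin1 = bounded_clinear_op_tensor[OF hilbert_tv tensor_t bounded_clinear_id(1) lin_row_restrict]
  have "op_tensor (tensor_vec t) t id (theta_coeff T [])
      = (\<lambda>y. - op_tensor (tensor_vec t) t id (op_restrict (row_op T) (defect_star_space T)) y)"
    by (rule op_tensor_eqI[OF hilbert_tv bounded_clinear_uminus[OF lin1]])
      (simp only: op_tensor_apply[OF hilbert_tv tensor_t bounded_clinear_id(1) lin_row_restrict], simp add: theta_coeff_def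
        tensor_scaleC_right[OF tensor_t, of _ "-1", simplified])
  then show ?thesis
    by (simp add: char_fun_def pencil_def[abs_def] inner_factor_def op_restrict_defect_star)
qed

lemma pencil_contraction:
  obtains r where "0 \<le> r" "r < 1" "\<And>z. norm (pencil z) \<le> r * norm z"
  using norm_sum_op_tensor_le[OF t X] unfolding pencil_def by blast

lemma lin_char_fun: "bounded_clinear (char_fun t T X)"
proof -
  obtain r where r: "0 \<le> r" "r < 1" "\<And>z. norm (pencil z) \<le> r * norm z"
    by (rule pencil_contraction) (rule that)
  show ?thesis
    unfolding char_fun_eq[abs_def]
    by (intro bounded_clinear_plus bounded_clinear_op_tensor hilbert_tv t tensor_t lin_theta_coeff bounded_clinear_id
        bounded_clinear_compose[OF bounded_clinear_op_tensor[OF t tensor_t]]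
        bounded_clinear_compose[OF Neumann(1)[OF lin_pencil r]] lin_defect lin_inner_factor)
qed

text \<open>With \<open>N + 1\<close> terms the difference is \<open>(I \<otimes> \<Delta>\<^sub>T) (I - W)\<^sup>-\<^sup>1 W\<^sup>N\<close> times a fixed operator, where \<open>W = \<Sum>i. X\<^sub>i \<otimes> T\<^sub>i\<^sup>*\<close> has norm
  at most \<open>r < 1\<close>.\<close>

lemma char_fun_remainder:
  "(\<lambda>N. onorm (\<lambda>y. char_fun t T X y - (\<Sum>k<N. \<Sum>\<alpha> | length \<alpha> = k.
      op_tensor (tensor_vec t) t (word_op X \<alpha>) (theta_coeff T \<alpha>) y))) \<longlonglongrightarrow> 0"
proof -
  obtain r where r: "0 \<le> r" "r < 1" "\<And>z. norm (pencil z) \<le> r * norm z"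
    by (rule pencil_contraction) (rule that)
  define R where "R = inv (\<lambda>z. z - pencil z)"
  note Neu = Neumann[OF lin_pencil r, folded R_def]
  note linD = bounded_clinear_op_tensor[OF t tensor_t bounded_clinear_id(1) lin_defect]
  define L where "L z = op_tensor t t id (defect T) (R z)" for z
  have linL: "bounded_clinear L"
    unfolding L_def[abs_def] by (rule bounded_clinear_compose[OF linD Neu(1)])
  obtain a where a: "a \<ge> 0" "\<And>z. norm (L z) \<le> a * norm z"
    by (rule bounded_clinear_nonneg_bound[OF linL]) (rule that)
  obtain b where b: "b \<ge> 0" "\<And>z. norm (inner_factor z) \<le> b * norm z"
    by (rule bounded_clinear_nonneg_bound[OF lin_inner_factor]) (rule that)
  let ?r = "\<lambda>N y. char_fun t T X y - (\<Sum>k<N. \<Sum>\<alpha> | length \<alpha> = k.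
      op_tensor (tensor_vec t) t (word_op X \<alpha>) (theta_coeff T \<alpha>) y)"
  have rem: "?r (Suc N) y = L ((pencil ^^ N) (inner_factor y))" for N y
  proof -
    have "(\<Sum>k<Suc N. \<Sum>\<alpha> | length \<alpha> = k. op_tensor (tensor_vec t) t (word_op X \<alpha>) (theta_coeff T \<alpha>) y)
      = op_tensor (tensor_vec t) t id (theta_coeff T []) y
        + op_tensor t t id (defect T) (\<Sum>k<N. (pencil ^^ k) (inner_factor y))"
      unfolding sum.lessThan_Suc_shift by (simp add: bounded_clinear_sum[OF linD] defect_pencil_term)
    then show ?thesis
      by (simp add: char_fun_eq L_def bounded_clinear_add[OF linD] Neu(2)[of "inner_factor y" N]
          flip: R_def)
  qed
  have linr: "bounded_linear (?r N)" for N
    by (intro bounded_clinear_bounded_linear bounded_clinear_minus lin_char_fun bounded_clinear_setsum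
        bounded_clinear_op_tensor hilbert_tv tensor_t lin_theta_coeff bounded_clinear_word_op lin_X)
  have "onorm (?r (Suc N)) \<le> a * b * r ^ N" for N
  proof (rule onorm_bound)
    fix y
    have "norm (?r (Suc N) y) \<le> a * (r ^ N * (b * norm y))"
      unfolding rem
      using a(2) funpow_norm_le[of r pencil N "inner_factor y"] r b(2)[of y]
      by (smt (verit, best) a(1) mult_left_mono zero_le_power)
    then show "norm (?r (Suc N) y) \<le> a * b * r ^ N * norm y" by (simp add: mult_ac)
  qed (use a b r in simp)
  moreover have "(\<lambda>N. a * b * r ^ N) \<longlonglongrightarrow> a * b * 0"
    using r by (intro tendsto_intros LIMSEQ_realpow_zero)
  ultimately have "(\<lambda>N. onorm (?r (Suc N))) \<longlonglongrightarrow> 0"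
    by (intro tendsto_sandwich[OF _ _ tendsto_const, of 0 "\<lambda>N. onorm (?r (Suc N))" sequentially "\<lambda>N. a * b * r ^ N"])
      (auto simp del: sum.lessThan_Suc intro!: always_eventually onorm_pos_le[OF linr])
  then show ?thesis by (rule LIMSEQ_imp_Suc)
qed

end

lemma char_expansion_theta_coeff:
  assumes "hilbert_tensor (t :: 'g::chilbert_space \<Rightarrow> 'h \<Rightarrow> 'e::chilbert_space)"
  shows "char_expansion t T (theta_coeff T)"
  unfolding char_expansion_def
  using theta_coeff_ops_between char_fun_remainder[OF assms] by blast

end


section \<open>Uniqueness of the coefficients\<close>

lemma Rep_ell2_sum: "Rep_ell2 (sum f F) s = (\<Sum>x\<in>F. Rep_ell2 (f x) s)"
  by (induction F rule: infinite_finite_induct) (simp_all add: zero_ell2.rep_eq plus_ell2.rep_eq)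

lemma norm_Rep_ell2_le: "norm (Rep_ell2 x s) \<le> norm (x :: ('s, 'a::real_inner) ell2)"
  using ell2_finite_norm_le[of "{s}" x] by (intro power2_le_imp_le[of "norm (Rep_ell2 x s)"]) simp_all

lift_definition left_creation :: "'n \<Rightarrow> 'n fock \<Rightarrow> 'n fock"
  is "\<lambda>i f w. case w of [] \<Rightarrow> 0 | j # v \<Rightarrow> if j = i then f v else 0"
proof -
  fix i :: 'n and f :: "'n list \<Rightarrow> complex"
  assume f: "(\<lambda>s. (cmod (f s))\<^sup>2) summable_on UNIV"
  let ?g = "\<lambda>w. case w of [] \<Rightarrow> 0 | j # v \<Rightarrow> if j = i then f v else 0"
  have "(\<lambda>w. (cmod (?g w))\<^sup>2) summable_on range ((#) i)"
    using f by (subst summable_on_reindex) (auto simp: o_def inj_on_def)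
  then show "(\<lambda>w. (cmod (?g w))\<^sup>2) summable_on UNIV"
    by (rule summable_on_cong_neutral[THEN iffD1, rotated -1]) (auto split: list.splits)
qed

lemma norm_left_creation: "norm (left_creation i f) \<le> norm f"
proof (rule ell2_norm_leI)
  fix F :: "'a list set" assume F: "finite F"
  have "(\<Sum>w\<in>F. (cmod (Rep_ell2 (left_creation i f) w))\<^sup>2)
      = (\<Sum>w\<in>F \<inter> range ((#) i). (cmod (Rep_ell2 (left_creation i f) w))\<^sup>2)"
    using F by (intro sum.mono_neutral_right) (auto simp: left_creation.rep_eq split: list.splits)
  also have "\<dots> = (\<Sum>v\<in>(#) i -` F. (cmod (Rep_ell2 f v))\<^sup>2)"
    by (rule sum.reindex_bij_witness[of _ "(#) i" tl]) (auto simp: left_creation.rep_eq)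
  also have "\<dots> \<le> (norm f)\<^sup>2"
    using F by (intro ell2_finite_norm_le finite_vimageI) (auto simp: inj_on_def)
  finally show "(\<Sum>w\<in>F. (cmod (Rep_ell2 (left_creation i f) w))\<^sup>2) \<le> (norm f)\<^sup>2" .
qed simp

lemma bounded_clinear_left_creation: "bounded_clinear (left_creation i)"
proof (rule bounded_clinearI[where K = 1])
  show "left_creation i (x + y) = left_creation i x + left_creation i y" for x y :: "'a fock"
    by transfer (auto split: list.splits)
  show "left_creation i (c *\<^sub>C x) = c *\<^sub>C left_creation i x" for c and x :: "'a fock"
    by transfer (auto split: list.splits simp: scaleC_complex_def)
qed (simp add: norm_left_creation)

lemma left_creation_unit: "left_creation i (ell2_unit \<alpha>) = ell2_unit (i # \<alpha>)"
  by transfer (auto split: list.splits)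

text \<open>The factor \<open>1 / (2 n)\<close> makes the sum of the \<open>n\<close> operators \<open>X\<^sub>i X\<^sub>i\<^sup>*\<close> a strict contraction.\<close>

definition scaled_creation :: "'n::finite \<Rightarrow> 'n fock \<Rightarrow> 'n fock" where
  "scaled_creation i f = complex_of_real (1 / (2 * real CARD('n))) *\<^sub>C left_creation i f"

lemma strict_row_contraction_scaled_creation:
  "strict_row_contraction (scaled_creation :: 'n::finite \<Rightarrow> 'n fock \<Rightarrow> 'n fock)"
proof -
  let ?S = "scaled_creation :: 'n \<Rightarrow> 'n fock \<Rightarrow> 'n fock"
  let ?c = "1 / (2 * real CARD('n))"
  have lin: "bounded_clinear (?S i)" for i
    unfolding scaled_creation_def[abs_def] by (rule bounded_clinear_scale[OF bounded_clinear_left_creation])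
  have le: "norm (?S i f) \<le> ?c * norm f" for i f
    using norm_left_creation[of i f] by (simp add: scaled_creation_def norm_divide divide_right_mono)
  have "onorm (\<lambda>g. \<Sum>i\<in>UNIV. ?S i (cadj (?S i) g)) \<le> 1 / 4"
  proof (rule onorm_bound)
    fix g
    have "norm (\<Sum>i\<in>UNIV. ?S i (cadj (?S i) g)) \<le> (\<Sum>i\<in>(UNIV::'n set). ?c * (?c * norm g))"
      by (intro sum_norm_le order_trans[OF le] mult_left_mono norm_cadj_le[OF lin le]) simp_all
    also have "\<dots> = 1 / 4 * (1 / real CARD('n)) * norm g"
      by simp
    also have "\<dots> \<le> 1 / 4 * 1 * norm g"
      by (intro mult_right_mono mult_left_mono) (simp_all add: Suc_leI)
    finally show "norm (\<Sum>i\<in>UNIV. ?S i (cadj (?S i) g)) \<le> 1 / 4 * norm g" by simp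
  qed simp
  then show ?thesis using lin by (simp add: strict_row_contraction_def)
qed

lemma word_op_scaled_creation:
  "\<exists>c. c \<noteq> 0 \<and> word_op scaled_creation \<alpha> (ell2_unit []) = c *\<^sub>C ell2_unit (\<alpha> :: 'n::finite list)"
proof (induction \<alpha>)
  case Nil
  then show ?case by (intro exI[of _ 1]) simp
next
  case (Cons i \<alpha>)
  then obtain c where c: "c \<noteq> 0" "word_op scaled_creation \<alpha> (ell2_unit []) = c *\<^sub>C ell2_unit \<alpha>" by blast
  then show ?case
    by (intro exI[of _ "complex_of_real (1 / (2 * real CARD('n))) * c"])
      (simp add: scaled_creation_def[of i] bounded_clinear_scaleC[OF bounded_clinear_left_creation] left_creation_unit)
qed

text \<open>At the scaled creation operators and the vector \<open>e\<^sub>\<emptyset> \<otimes> v\<close>, the word \<open>\<alpha>\<close> contributes a nonzero multiple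
  of \<open>e\<^sub>\<alpha> \<otimes> A\<^sub>\<alpha> v\<close>. So the coordinate \<open>\<beta>\<close> of all long enough partial sums is a fixed nonzero multiple of
  \<open>A\<^sub>\<beta> v\<close>.\<close>

lemma (in row_contr) char_expansion_unique:
  assumes A: "char_expansion (ell2_tensor :: 'n fock \<Rightarrow> 'h \<Rightarrow> _) T A"
    and B: "char_expansion (ell2_tensor :: 'n fock \<Rightarrow> 'h \<Rightarrow> _) T B"
  shows "A = B"
proof (intro ext)
  fix \<beta> :: "'n list" and v :: "'h ^ 'n"
  let ?t = "ell2_tensor :: 'n fock \<Rightarrow> 'h \<Rightarrow> _"
  let ?X = "scaled_creation :: 'n \<Rightarrow> 'n fock \<Rightarrow> 'n fock"
  note t = hilbert_tensor_ell2_tensor[where ?'s = "'n list" and ?'k = 'h]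
  note X = strict_row_contraction_scaled_creation[where ?'n = 'n]
  let ?y = "tensor_vec ?t (ell2_unit []) v"
  let ?P = "\<lambda>A N y. \<Sum>k<N. \<Sum>\<alpha> | length \<alpha> = k. op_tensor (tensor_vec ?t) ?t (word_op ?X \<alpha>) (A \<alpha>) y"
  obtain c where c: "c \<noteq> 0" "word_op ?X \<beta> (ell2_unit []) = c *\<^sub>C ell2_unit \<beta>"
    using word_op_scaled_creation by blast
  define P where "P C N = ?P C N ?y" for C N
  define \<theta> where "\<theta> = char_fun ?t T ?X ?y"
  have tail: "Rep_ell2 (P C N) \<beta> = c *\<^sub>C C \<beta> v" and conv: "(\<lambda>N. norm (\<theta> - P C N)) \<longlonglongrightarrow> 0"
    if C: "char_expansion ?t T C" and N: "N > length \<beta>" for C N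
  proof -
    have linC: "bounded_clinear (C \<alpha>)" for \<alpha>
      using C by (auto simp: char_expansion_def ops_between_def)
    have linP: "bounded_clinear (op_tensor (tensor_vec ?t) ?t (word_op ?X \<alpha>) (C \<alpha>))" for \<alpha>
      by (intro bounded_clinear_op_tensor hilbert_tv[OF t X] tensor_t[OF t X] bounded_clinear_word_op lin_X[OF t X] linC)
    have coord: "Rep_ell2 (op_tensor (tensor_vec ?t) ?t (word_op ?X \<alpha>) (C \<alpha>) ?y) \<beta>
        = (if \<alpha> = \<beta> then c *\<^sub>C C \<beta> v else 0)" for \<alpha>
    proof -
      obtain d where d: "word_op ?X \<alpha> (ell2_unit []) = d *\<^sub>C ell2_unit \<alpha>"
        using word_op_scaled_creation by blast
      show ?thesis
        unfolding op_tensor_apply[OF hilbert_tv[OF t X] tensor_t[OF t X] bounded_clinear_word_op[OF lin_X[OF t X]] linC]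
        using c d by (cases "\<alpha> = \<beta>") (auto simp: ell2_tensor.rep_eq scaleC_ell2.rep_eq ell2_unit.rep_eq
            scaleC_complex_def)
    qed
    have "Rep_ell2 (?P C N ?y) \<beta> = (\<Sum>k<N. \<Sum>\<alpha> | length \<alpha> = k. if \<alpha> = \<beta> then c *\<^sub>C C \<beta> v else 0)"
      unfolding Rep_ell2_sum coord ..
    also have "\<dots> = (\<Sum>k<N. if k = length \<beta> then c *\<^sub>C C \<beta> v else 0)"
      by (intro sum.cong refl) (auto simp: sum.delta[OF finite_words])
    also have "\<dots> = c *\<^sub>C C \<beta> v" using N by simp
    finally show "Rep_ell2 (P C N) \<beta> = c *\<^sub>C C \<beta> v" unfolding P_def .
    have lin: "bounded_linear (\<lambda>y. char_fun ?t T ?X y - ?P C N y)" for N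
      by (intro bounded_clinear_bounded_linear bounded_clinear_minus lin_char_fun[OF t X]
          bounded_clinear_setsum linP)
    have "(\<lambda>N. onorm (\<lambda>y. char_fun ?t T ?X y - ?P C N y) * norm ?y) \<longlonglongrightarrow> 0 * norm ?y"
      using C X unfolding char_expansion_def by (intro tendsto_mult tendsto_const) blast
    then have lim: "(\<lambda>N. onorm (\<lambda>y. char_fun ?t T ?X y - ?P C N y) * norm ?y) \<longlonglongrightarrow> 0"
      by (simp only: mult_zero_left)
    show "(\<lambda>N. norm (\<theta> - P C N)) \<longlonglongrightarrow> 0"
      unfolding P_def \<theta>_def
    proof (rule Lim_null_comparison[OF always_eventually lim], rule allI)
      show "norm (norm (char_fun ?t T ?X ?y - ?P C N ?y)) \<le> onorm (\<lambda>y. char_fun ?t T ?X y - ?P C N y) * norm ?y" for N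
        unfolding real_norm_def abs_norm_cancel by (rule onorm[OF lin])
    qed
  qed
  have swap: "norm (a - b) = norm ((d - a) - (d - b))" for a b d :: "('n list, 'h) ell2"
    by (simp add: norm_minus_commute)
  have "(\<lambda>N. norm (\<theta> - P A N) + norm (\<theta> - P B N)) \<longlonglongrightarrow> 0 + 0"
    by (intro tendsto_add conv[OF _ lessI] A B)
  moreover have "norm (c *\<^sub>C A \<beta> v - c *\<^sub>C B \<beta> v)
     \<le> norm (\<theta> - P A N) + norm (\<theta> - P B N)" if "N > length \<beta>" for N
  proof -
    have "c *\<^sub>C A \<beta> v - c *\<^sub>C B \<beta> v = Rep_ell2 (P A N - P B N) \<beta>"
      unfolding minus_ell2.rep_eq tail[OF A that] tail[OF B that] ..
    also have "norm \<dots> \<le> norm (P A N - P B N)" by (rule norm_Rep_ell2_le)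
    also have "\<dots> = norm ((\<theta> - P A N) - (\<theta> - P B N))"
      by (rule swap)
    also have "\<dots> \<le> norm (\<theta> - P A N) + norm (\<theta> - P B N)"
      by (rule norm_triangle_ineq4)
    finally show ?thesis .
  qed
  then have "\<exists>M. \<forall>N\<ge>M. norm (c *\<^sub>C A \<beta> v - c *\<^sub>C B \<beta> v)
     \<le> norm (\<theta> - P A N) + norm (\<theta> - P B N)"
    by (intro exI[of _ "Suc (length \<beta>)"] allI impI) (simp only: Suc_le_eq)
  ultimately have "norm (c *\<^sub>C A \<beta> v - c *\<^sub>C B \<beta> v) \<le> 0 + 0"
    by (rule LIMSEQ_le_const)
  then have "norm (c *\<^sub>C (A \<beta> v - B \<beta> v)) \<le> 0" by (simp only: scaleC_diff_right add_0)
  then show "A \<beta> v = B \<beta> v" using c(1) by (simp add: mult_le_0_iff)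
qed

context row_contr
begin

lemma char_coeff_eq: "char_coeff T = theta_coeff T"
  unfolding char_coeff_def
  by (intro the_equality char_expansion_theta_coeff hilbert_tensor_ell2_tensor)
    (rule char_expansion_unique[OF _ char_expansion_theta_coeff[OF hilbert_tensor_ell2_tensor]])

text \<open>The constant term does not count for the degree, so the condition is on the words \<open>\<alpha> @ [i]\<close>.\<close>

lemma char_degree_eq_0_iff:
  "char_degree T = 0 \<longleftrightarrow> (\<forall>\<alpha> i v. defect T (word_op Tadj \<alpha> (defect_star T v $ i)) = 0)"
proof -
  let ?S = "{\<alpha>. theta_coeff T \<alpha> \<noteq> (\<lambda>_. 0)}"
  have "char_degree T = 0 \<longleftrightarrow> ?S \<subseteq> {[]}"
  proof
    assume deg: "char_degree T = 0"
    then have fin: "finite ?S" and max: "Max (insert 0 (length ` ?S)) = 0"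
      by (auto simp: char_degree_def char_coeff_eq zero_enat_def Let_def split: if_splits)
    have "length \<alpha> \<le> 0" if "\<alpha> \<in> ?S" for \<alpha>
      using Max_ge[of "insert 0 (length ` ?S)" "length \<alpha>"] fin that unfolding max by blast
    then show "?S \<subseteq> {[]}" by blast
  next
    assume sub: "?S \<subseteq> {[]}"
    then have "finite ?S" using finite_subset by blast
    moreover have eq: "insert 0 (length ` ?S) = {0}" using sub by force
    have "Max (insert 0 (length ` ?S)) = 0" unfolding eq by simp
    ultimately show "char_degree T = 0"
      by (simp add: char_degree_def char_coeff_eq zero_enat_def Let_def)
  qed
  also have "\<dots> \<longleftrightarrow> (\<forall>\<alpha> i. theta_coeff T (\<alpha> @ [i]) = (\<lambda>_. 0))"
    by (auto simp: subset_iff) (metis append_butlast_last_id)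
  finally show ?thesis by (simp add: theta_coeff_def fun_eq_iff)
qed

end


section \<open>The kernel of the Poisson kernel\<close>

text \<open>This identifies the coordinates of the infinite sum that defines the Poisson kernel.\<close>

lemma ell2_has_sum:
  fixes x :: "('s, 'k::chilbert_space) ell2"
  shows "((\<lambda>s. ell2_tensor (ell2_unit s) (Rep_ell2 x s)) has_sum x) UNIV"
  unfolding has_sum_def tendsto_iff
proof (intro allI impI)
  fix e :: real assume "e > 0"
  let ?f = "\<lambda>s. ell2_tensor (ell2_unit s) (Rep_ell2 x s)"
  have Rep_y: "Rep_ell2 (sum ?f F) r = (if r \<in> F then Rep_ell2 x r else 0)" if "finite F" for F r
  proof -
    have "Rep_ell2 (sum ?f F) r = (\<Sum>s\<in>F. if r = s then Rep_ell2 x s else 0)"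
      unfolding Rep_ell2_sum by (intro sum.cong) (auto simp: ell2_tensor.rep_eq ell2_unit.rep_eq)
    then show ?thesis using that by simp
  qed
  have smb: "(\<lambda>s. (norm (Rep_ell2 x s))\<^sup>2) summable_on UNIV"
    using Rep_ell2[of x] by simp
  define I where "I = (\<Sum>\<^sub>\<infinity>s. (norm (Rep_ell2 x s))\<^sup>2)"
  have "(sum (\<lambda>s. (norm (Rep_ell2 x s))\<^sup>2) \<longlongrightarrow> I) (finite_subsets_at_top UNIV)"
    using has_sum_infsum[OF smb] by (simp add: has_sum_def I_def)
  then have ev: "eventually (\<lambda>F. sum (\<lambda>s. (norm (Rep_ell2 x s))\<^sup>2) F > I - (e / 2)\<^sup>2)
      (finite_subsets_at_top UNIV)"
    by (rule order_tendstoD) (use \<open>e > 0\<close> in simp)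
  have dist: "dist (sum ?f F) x < e"
    if F: "finite F" "sum (\<lambda>s. (norm (Rep_ell2 x s))\<^sup>2) F > I - (e / 2)\<^sup>2" for F
  proof -
    have "norm (sum ?f F - x) \<le> e / 2"
    proof (rule ell2_norm_leI)
      fix G :: "'s set" assume "finite G"
      have "(\<Sum>s\<in>G. (norm (Rep_ell2 (sum ?f F - x) s))\<^sup>2) = (\<Sum>s\<in>G - F. (norm (Rep_ell2 x s))\<^sup>2)"
        using \<open>finite G\<close> F(1)
        by (intro sum.mono_neutral_cong_right) (auto simp: minus_ell2.rep_eq Rep_y)
      also have "\<dots> = (\<Sum>s\<in>G \<union> F. (norm (Rep_ell2 x s))\<^sup>2) - (\<Sum>s\<in>F. (norm (Rep_ell2 x s))\<^sup>2)"
        using \<open>finite G\<close> F(1) by (subst sum_diff[symmetric]) (auto intro: sum.cong)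
      also have "\<dots> \<le> I - (\<Sum>s\<in>F. (norm (Rep_ell2 x s))\<^sup>2)"
        unfolding I_def using \<open>finite G\<close> F(1)
        by (intro diff_right_mono finite_sum_le_infsum smb) auto
      finally show "(\<Sum>s\<in>G. (norm (Rep_ell2 (sum ?f F - x) s))\<^sup>2) \<le> (e / 2)\<^sup>2"
        using F(2) by linarith
    qed (use \<open>e > 0\<close> in simp)
    then show ?thesis using \<open>e > 0\<close> by (simp add: dist_norm)
  qed
  show "eventually (\<lambda>F. dist (sum ?f F) x < e) (finite_subsets_at_top UNIV)"
  proof (rule eventually_elim2[OF _ ev])
    show "eventually finite (finite_subsets_at_top (UNIV :: 's set))"
      by (rule eventually_finite_subsets_at_top_weakI)
  qed (rule dist)
qed

context row_contr
begin

definition adj_word :: "'n list \<Rightarrow> 'h \<Rightarrow> 'h" where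
  "adj_word \<alpha> = cadj (word_op T \<alpha>)"

lemma adj_word_eq: "adj_word \<alpha> = word_op Tadj (rev \<alpha>)"
  by (simp add: adj_word_def cadj_word_op[OF lin])

lemma lin_adj_word: "bounded_clinear (adj_word \<alpha>)"
  unfolding adj_word_eq by (rule bounded_clinear_word_op[OF lin_adj])

lemma lin_word: "bounded_clinear (word_op T \<alpha>)"
  by (rule bounded_clinear_word_op[OF lin])

lemma adj_word_simps: "adj_word [] h = h" "adj_word (i # \<alpha>) h = adj_word \<alpha> (Tadj i h)"
  "adj_word (\<alpha> @ [i]) h = Tadj i (adj_word \<alpha> h)"
  by (simp_all add: adj_word_eq word_op_append)

lemma cinner_adj_word: "cinner (adj_word \<alpha> x) y = cinner x (word_op T \<alpha> y)"
  unfolding adj_word_def by (rule cinner_cadj_left[OF lin_word])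

text \<open>Iterating \<open>\<parallel>h\<parallel>\<^sup>2 = \<parallel>\<Delta>\<^sub>T h\<parallel>\<^sup>2 + \<Sum>i. \<parallel>T\<^sub>i\<^sup>*h\<parallel>\<^sup>2\<close> gives
  \<open>K\<^sub>T\<^sup>*K\<^sub>T = I - lim\<^sub>N \<Sum>|\<alpha>|=N. T\<^sub>\<alpha>T\<^sub>\<alpha>\<^sup>*\<close>.\<close>

lemma defect_words_sum:
  "(\<Sum>\<alpha> | length \<alpha> < N. (norm (defect T (adj_word \<alpha> h)))\<^sup>2)
    + (\<Sum>\<alpha> | length \<alpha> = N. (norm (adj_word \<alpha> h))\<^sup>2) = (norm h)\<^sup>2"
proof (induction N)
  case 0
  then show ?case by (simp add: adj_word_simps)
next
  case (Suc N)
  let ?d = "\<lambda>\<alpha>. (norm (defect T (adj_word \<alpha> h)))\<^sup>2" and ?s = "\<lambda>\<alpha>. (norm (adj_word \<alpha> h))\<^sup>2"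
  have "{\<alpha> :: 'n list. length \<alpha> < Suc N} = {\<alpha>. length \<alpha> < N} \<union> {\<alpha>. length \<alpha> = N}" by auto
  then have "(\<Sum>\<alpha> | length \<alpha> < Suc N. ?d \<alpha>) = (\<Sum>\<alpha> | length \<alpha> < N. ?d \<alpha>) + (\<Sum>\<alpha> | length \<alpha> = N. ?d \<alpha>)"
    by (simp add: sum.union_disjoint[OF finite_words_less finite_words] disjoint_iff)
  moreover have "(\<Sum>\<alpha> | length \<alpha> = Suc N. ?s \<alpha>) = (\<Sum>\<alpha> | length \<alpha> = N. ?s \<alpha>) - (\<Sum>\<alpha> | length \<alpha> = N. ?d \<alpha>)"
    by (simp add: sum_words_snoc adj_word_simps norm_sq_defect sum_subtractf)
  ultimately show ?case using Suc by simp
qed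

lemma adj_words_sum_le: "(\<Sum>\<alpha> | length \<alpha> = N. (norm (adj_word \<alpha> h))\<^sup>2) \<le> (norm h)\<^sup>2"
  using defect_words_sum[where N = N and h = h] sum_nonneg[of "{\<alpha>. length \<alpha> < N}" "\<lambda>\<alpha>. (norm (defect T (adj_word \<alpha> h)))\<^sup>2"]
  by simp

lemma poisson_summable: "(\<lambda>\<alpha>. (norm (defect T (adj_word \<alpha> h)))\<^sup>2) summable_on UNIV"
proof (rule nonneg_bdd_above_summable_on)
  have "(\<Sum>\<alpha>\<in>F. (norm (defect T (adj_word \<alpha> h)))\<^sup>2) \<le> (norm h)\<^sup>2" if "finite F" for F
  proof -
    define N where "N = Suc (Max (insert 0 (length ` F)))"
    have sub: "F \<subseteq> {\<alpha>. length \<alpha> < N}"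
      using that by (auto simp: N_def less_Suc_eq_le)
    have "(\<Sum>\<alpha>\<in>F. (norm (defect T (adj_word \<alpha> h)))\<^sup>2) \<le> (\<Sum>\<alpha> | length \<alpha> < N. (norm (defect T (adj_word \<alpha> h)))\<^sup>2)"
      by (rule sum_mono2[OF finite_words_less sub]) simp
    also have "\<dots> \<le> (norm h)\<^sup>2"
      using defect_words_sum[where N = N and h = h] sum_nonneg[of "{\<alpha>. length \<alpha> = N}" "\<lambda>\<alpha>. (norm (adj_word \<alpha> h))\<^sup>2"]
      by simp
    finally show ?thesis .
  qed
  then show "bdd_above (sum (\<lambda>\<alpha>. (norm (defect T (adj_word \<alpha> h)))\<^sup>2) ` {F. F \<subseteq> UNIV \<and> finite F})"
    by (intro bdd_aboveI[of _ "(norm h)\<^sup>2"]) auto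
qed simp

lemma poisson_kernel_eq_0_iff: "poisson_kernel T h = 0 \<longleftrightarrow> (\<forall>\<alpha>. defect T (adj_word \<alpha> h) = 0)"
proof -
  let ?x = "Abs_ell2 (\<lambda>\<alpha>. defect T (adj_word \<alpha> h))"
  have Rep: "Rep_ell2 ?x = (\<lambda>\<alpha>. defect T (adj_word \<alpha> h))"
    using poisson_summable by (intro Abs_ell2_inverse) simp
  have "poisson_kernel T h = ?x"
    unfolding poisson_kernel_def
    using infsumI[OF ell2_has_sum[of ?x]] by (simp add: Rep flip: adj_word_def)
  moreover have "?x = 0 \<longleftrightarrow> Rep_ell2 ?x = Rep_ell2 0" by (simp add: Rep_ell2_inject)
  ultimately show ?thesis by (simp add: Rep zero_ell2.rep_eq fun_eq_iff)
qed

end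

lemma hdim_eq_0_iff:
  assumes "0 \<in> S"
  shows "hdim S = 0 \<longleftrightarrow> S = {0}"
proof
  assume "hdim S = 0"
  then obtain B where B: "finite B" "complex_vector.span B = S" and dim: "complex_vector.dim S = 0"
    by (auto simp: hdim_def zero_enat_def split: if_splits)
  obtain b where b: "b \<subseteq> S" "complex_vector.independent b" "S \<subseteq> complex_vector.span b"
    "card b = complex_vector.dim S"
    by (rule complex_vector.basis_exists) (rule that)
  have "finite b"
    using complex_vector.independent_span_bound[OF B(1) b(2)] b(1) B(2) by blast
  then have "b = {}" using b(4) dim by simp
  then show "S = {0}" using b(3) assms by auto
next
  assume "S = {0}"
  have "complex_vector.span {} = S" using \<open>S = {0}\<close> by simp
  moreover have "complex_vector.dim S = 0"
    using complex_vector.dim_unique[of "{}" S 0] \<open>S = {0}\<close> by (simp add: complex_vector.independent_empty)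
  ultimately show "hdim S = 0"
    unfolding hdim_def zero_enat_def by (metis finite.emptyI)
qed


section \<open>Row isometries\<close>

context row_contr
begin

text \<open>Vectors supported in the component \<open>j\<close> recover \<open>T\<^sub>i\<^sup>*T\<^sub>j\<close> from \<open>T\<^sup>*T\<close>.\<close>

lemma row_isometry_iff: "row_isometry T \<longleftrightarrow> (\<forall>v. cadj (row_op T) (row_op T v) = v)"
proof
  assume iso: "row_isometry T"
  have "Tadj i (T j h) = (if i = j then h else 0)" for i j h
    using iso by (auto simp: row_isometry_def fun_eq_iff)
  then show "\<forall>v. cadj (row_op T) (row_op T v) = v"
    by (simp add: cadj_row_op[OF lin] row_op_def vec_eq_iff bounded_clinear_sum[OF lin_adj])
next
  assume iso: "\<forall>v. cadj (row_op T) (row_op T v) = v"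
  have "Tadj i (T j h) = (if i = j then h else 0)" for i j h
  proof -
    have "row_op T (axis j h) = T j h"
    proof -
      have "row_op T (axis j h) = (\<Sum>k\<in>UNIV. if k = j then T j h else 0)"
        unfolding row_op_def axis_def by (intro sum.cong) (auto simp: bounded_clinear_zero[OF lin])
      then show ?thesis by simp
    qed
    then have "Tadj i (T j h) = cadj (row_op T) (row_op T (axis j h)) $ i"
      by (simp add: cadj_row_op[OF lin])
    also have "\<dots> = axis j h $ i" using iso by simp
    finally show ?thesis by (simp add: axis_def)
  qed
  then show "row_isometry T" by (auto simp: row_isometry_def fun_eq_iff)
qed

lemma row_isometry_iff_defect_star: "row_isometry T \<longleftrightarrow> (\<forall>v. defect_star T v = 0)"
proof
  assume "row_isometry T"
  then have "defect_star T (defect_star T v) = 0" for v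
    by (simp add: row_isometry_iff defect_star_defect_star)
  then have "cinner (defect_star T v) (defect_star T v) = 0" for v
    by (simp flip: positive_op_selfadjoint[OF positive_defect_star])
  then show "\<forall>v. defect_star T v = 0" by (simp add: cinner_self_eq_0)
next
  assume "\<forall>v. defect_star T v = 0"
  then show "row_isometry T"
    using defect_star_defect_star by (simp add: row_isometry_iff)
qed

text \<open>If \<open>K\<^sub>T h = 0\<close> then \<open>\<parallel>h\<parallel>\<^sup>2 = \<Sum>|\<alpha>|=N. \<parallel>T\<^sub>\<alpha>\<^sup>*h\<parallel>\<^sup>2\<close> for all \<open>N\<close>, and purity sends the right-hand side to \<open>0\<close>.\<close>

lemma poisson_injective_if_pure:
  assumes "pure_row T" "\<And>\<alpha>. defect T (adj_word \<alpha> h) = 0"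
  shows "h = 0"
proof -
  have "(\<Sum>\<alpha> | length \<alpha> = N. (norm (adj_word \<alpha> h))\<^sup>2) = (norm h)\<^sup>2" for N
    using defect_words_sum[where N = N and h = h] assms(2) by simp
  moreover have "(\<lambda>N. \<Sum>\<alpha> | length \<alpha> = N. (norm (adj_word \<alpha> h))\<^sup>2) \<longlonglongrightarrow> 0"
    using assms(1) unfolding pure_row_def adj_word_def by blast
  ultimately have "(\<lambda>N::nat. (norm h)\<^sup>2) \<longlonglongrightarrow> 0" by (simp only:)
  then have "(norm h)\<^sup>2 = 0" by (rule LIMSEQ_unique[OF tendsto_const])
  then show ?thesis by simp
qed

end

locale row_iso = row_contr T for T :: "'n::finite \<Rightarrow> 'h::chilbert_space \<Rightarrow> 'h" +
  assumes isometry: "row_isometry T"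
begin

lemma Tadj_T: "Tadj i (T j h) = (if i = j then h else 0)"
  using isometry by (auto simp: row_isometry_def fun_eq_iff)

lemma Tadj_wandering: "Tadj i (h - (\<Sum>j\<in>UNIV. T j (Tadj j h))) = 0"
  by (simp add: bounded_clinear_diff[OF lin_adj] bounded_clinear_sum[OF lin_adj] Tadj_T)

text \<open>For an isometry, \<open>I - TT\<^sup>*\<close> is idempotent, so it is its own square root.\<close>

lemma defect_eq: "defect T h = h - (\<Sum>j\<in>UNIV. T j (Tadj j h))"
proof -
  have "positive_op (\<lambda>h. h - (\<Sum>i\<in>UNIV. T i (Tadj i h)))"
    using contraction by (simp add: row_contraction_def)
  then have "defect T = (\<lambda>h. h - (\<Sum>i\<in>UNIV. T i (Tadj i h)))"
    by (rule defect_eqI) (simp only: Tadj_wandering, simp add: bounded_clinear_zero[OF lin])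
  then show ?thesis by simp
qed

lemma Tadj_defect: "Tadj i (defect T h) = 0"
  unfolding defect_eq by (rule Tadj_wandering)

lemma defect_if_Tadj_0: "(\<And>i. Tadj i h = 0) \<Longrightarrow> defect T h = h"
  by (simp add: defect_eq bounded_clinear_zero[OF lin])

lemma range_defect_iff: "h \<in> range (defect T) \<longleftrightarrow> (\<forall>i. Tadj i h = 0)"
  using Tadj_defect defect_if_Tadj_0 by (metis rangeE rangeI)

lemma closed_range_defect: "closure (range (defect T)) = range (defect T)"
proof -
  have "range (defect T) = (\<Inter>i. {h. Tadj i h = 0})"
    using range_defect_iff by auto
  also have "closed \<dots>"
    by (intro closed_INT ballI closed_Collect_eq continuous_on_const linear_continuous_on
        bounded_clinear_bounded_linear lin_adj)
  finally show ?thesis by simp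
qed

text \<open>A vector \<open>x\<close> orthogonal to all \<open>T\<^sub>\<beta>\<Delta>\<^sub>T h\<close> satisfies \<open>\<Delta>\<^sub>T T\<^sub>\<beta>\<^sup>*x = 0\<close> for all \<open>\<beta>\<close>, that is, \<open>K\<^sub>T x = 0\<close>.\<close>

lemma dense_words:
  assumes ker: "\<And>h. (\<And>\<alpha>. defect T (adj_word \<alpha> h) = 0) \<Longrightarrow> h = 0"
  shows "closure (complex_vector.span {word_op T \<beta> (defect T h) |\<beta> h. 0 \<le> length \<beta>}) = UNIV"
proof (rule dense_span_if_orth_compl_trivial)
  fix x assume x: "\<And>y. y \<in> {word_op T \<beta> (defect T h) |\<beta> h. 0 \<le> length \<beta>} \<Longrightarrow> cinner x y = 0"
  show "x = 0"
  proof (rule ker)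
    fix \<alpha>
    show "defect T (adj_word \<alpha> x) = 0"
    proof (rule positive_op_0_on_orth_range[OF positive_defect])
      show "cinner (adj_word \<alpha> x) (defect T y) = 0" for y
        unfolding cinner_adj_word by (rule x) blast
    qed
  qed
qed

text \<open>The vectors \<open>x\<close> with \<open>\<Sum>|\<alpha>|=k. \<parallel>T\<^sub>\<alpha>\<^sup>*x\<parallel>\<^sup>2 \<rightarrow> 0\<close> form a closed subspace, which contains
  \<open>T\<^sub>\<beta>\<Delta>\<^sub>T h\<close> because there the sum vanishes for \<open>k > |\<beta>|\<close>.\<close>

lemma pure_if_poisson_injective:
  assumes ker: "\<And>h. (\<And>\<alpha>. defect T (adj_word \<alpha> h) = 0) \<Longrightarrow> h = 0"
  shows "pure_row T"
proof -
  define S where "S k x = (\<Sum>\<alpha> | length \<alpha> = k. (norm (adj_word \<alpha> x))\<^sup>2)" for k :: nat and x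
  have S_nonneg: "0 \<le> S k x" for k x unfolding S_def by (rule sum_nonneg) simp
  have S_le: "S k x \<le> (norm x)\<^sup>2" for k x unfolding S_def by (rule adj_words_sum_le)
  have S_add: "S k (x + y) \<le> 2 * S k x + 2 * S k y" for k x y
  proof -
    have "(norm (a + b))\<^sup>2 \<le> 2 * (norm a)\<^sup>2 + 2 * (norm b)\<^sup>2" for a b :: 'h
    proof -
      have "(norm (a + b))\<^sup>2 + (norm (a - b))\<^sup>2 = 2 * (norm a)\<^sup>2 + 2 * (norm b)\<^sup>2"
        by (simp add: power2_norm_eq_inner inner_add_left inner_add_right inner_diff_left
            inner_diff_right inner_commute)
      then show ?thesis using zero_le_power2[of "norm (a - b)"] by linarith
    qed
    then show ?thesis
      unfolding S_def bounded_clinear_add[OF lin_adj_word] sum_distrib_left sum.distrib[symmetric]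
      by (intro sum_mono)
  qed
  have S_scale: "S k (c *\<^sub>C x) = (cmod c)\<^sup>2 * S k x" for k c x
    by (simp add: S_def bounded_clinear_scaleC[OF lin_adj_word] power_mult_distrib sum_distrib_left)
  define Z where "Z = {x. (\<lambda>k. S k x) \<longlonglongrightarrow> 0}"
  have S0: "S k 0 = 0" for k using S_le[of k 0] S_nonneg[of k 0] by simp
  have sub: "complex_vector.subspace Z"
    unfolding complex_vector.subspace_def
  proof (intro conjI ballI allI)
    show "0 \<in> Z" by (simp add: Z_def S0)
  next
    fix x y assume "x \<in> Z" "y \<in> Z"
    then have "(\<lambda>k. 2 * S k x + 2 * S k y) \<longlonglongrightarrow> 2 * 0 + 2 * 0"
      unfolding Z_def by (intro tendsto_intros) auto
    then have "(\<lambda>k. 2 * S k x + 2 * S k y) \<longlonglongrightarrow> 0" by simp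
    then have "(\<lambda>k. S k (x + y)) \<longlonglongrightarrow> 0"
      by (rule Lim_null_comparison[rotated]) (simp add: S_nonneg S_add always_eventually)
    then show "x + y \<in> Z" by (simp add: Z_def)
  next
    fix c x assume "x \<in> Z"
    then have "(\<lambda>k. (cmod c)\<^sup>2 * S k x) \<longlonglongrightarrow> (cmod c)\<^sup>2 * 0"
      unfolding Z_def by (intro tendsto_intros) auto
    then show "c *\<^sub>C x \<in> Z" by (simp add: Z_def S_scale)
  qed
  have closure_Z: "x \<in> Z" if "x \<in> closure Z" for x
  proof -
    have "eventually (\<lambda>k. dist (S k x) 0 < e) sequentially" if "e > 0" for e
    proof -
      obtain y where y: "y \<in> Z" "dist y x < sqrt (e / 4)"
        using \<open>x \<in> closure Z\<close> \<open>e > 0\<close> unfolding closure_approachable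
        by (metis divide_pos_pos real_sqrt_gt_0_iff zero_less_numeral)
      have "(norm (x - y))\<^sup>2 < (sqrt (e / 4))\<^sup>2"
        using y(2) by (intro power_strict_mono) (simp_all add: dist_norm norm_minus_commute)
      then have small: "(norm (x - y))\<^sup>2 < e / 4" using \<open>e > 0\<close> by simp
      have "eventually (\<lambda>k. dist (S k y) 0 < e / 4) sequentially"
        using y(1) \<open>e > 0\<close> unfolding Z_def by (intro tendstoD) auto
      then show ?thesis
      proof (rule eventually_mono)
        fix k assume "dist (S k y) 0 < e / 4"
        then have "S k y < e / 4" by (simp add: dist_norm)
        moreover have "S k x \<le> 2 * S k y + 2 * S k (x - y)" using S_add[of k y "x - y"] by simp
        ultimately have "S k x < e" using S_le[of k "x - y"] small by linarith
        then show "dist (S k x) 0 < e" by (simp add: dist_norm S_nonneg)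
      qed
    qed
    then show ?thesis unfolding Z_def tendsto_iff by blast
  qed
  have word: "word_op T \<beta> (defect T h) \<in> Z" for \<beta> h
  proof (induction \<beta>)
    case Nil
    have "S (Suc k) (defect T h) = 0" for k
      by (simp add: S_def sum_words_Suc adj_word_simps Tadj_defect bounded_clinear_zero[OF lin_adj_word])
    then have "(\<lambda>k. S k (defect T h)) \<longlonglongrightarrow> 0"
      by (simp add: LIMSEQ_imp_Suc)
    then show ?case by (simp add: Z_def)
  next
    case (Cons i \<beta>)
    have "S (Suc k) (T i x) = S k x" for k x
    proof -
      have "S (Suc k) (T i x) = (\<Sum>j\<in>UNIV. if j = i then S k x else 0)"
        unfolding S_def sum_words_Suc adj_word_simps Tadj_T
        by (intro sum.cong refl) (simp add: bounded_clinear_zero[OF lin_adj_word])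
      then show ?thesis by simp
    qed
    then have "(\<lambda>k. S (Suc k) (T i (word_op T \<beta> (defect T h)))) \<longlonglongrightarrow> 0"
      using Cons by (simp add: Z_def)
    then have "(\<lambda>k. S k (T i (word_op T \<beta> (defect T h)))) \<longlonglongrightarrow> 0" by (rule LIMSEQ_imp_Suc)
    then show ?case by (simp add: Z_def)
  qed
  have "complex_vector.span {word_op T \<beta> (defect T h) |\<beta> h. 0 \<le> length \<beta>} \<subseteq> Z"
    by (rule complex_vector.span_minimal[OF _ sub]) (use word in auto)
  then have "closure Z = UNIV"
    using dense_words[OF ker] closure_mono by blast
  then have "x \<in> Z" for x using closure_Z by blast
  then show ?thesis
    unfolding pure_row_def Z_def S_def adj_word_def by blast
qed

text \<open>Here \<open>\<D>\<^sub>0\<close> is the whole space, and orthogonality of \<open>x\<close> to \<open>\<D>\<^sub>1\<close> says that every \<open>T\<^sub>i\<^sup>*x\<close> is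
  orthogonal to \<open>\<D>\<^sub>0\<close>, hence zero.\<close>

lemma defect_tail_diff:
  assumes ker: "\<And>h. (\<And>\<alpha>. defect T (adj_word \<alpha> h) = 0) \<Longrightarrow> h = 0"
  shows "defect_tail T 0 \<inter> orth_compl (defect_tail T (Suc 0)) = range (defect T)"
proof -
  have "defect_tail T 0 = UNIV" unfolding defect_tail_def by (rule dense_words[OF ker])
  moreover have "orth_compl (defect_tail T (Suc 0)) = range (defect T)"
  proof (intro equalityI subsetI)
    fix x assume x: "x \<in> orth_compl (defect_tail T (Suc 0))"
    have "Tadj i x = 0" for i
    proof (rule ker)
      fix \<alpha>
      show "defect T (adj_word \<alpha> (Tadj i x)) = 0"
      proof (rule positive_op_0_on_orth_range[OF positive_defect])
        fix y
        have "word_op T (i # \<alpha>) (defect T y) \<in> {word_op T \<beta> (defect T h) |\<beta> h. Suc 0 \<le> length \<beta>}"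
          by (intro CollectI exI[of _ "i # \<alpha>"] exI[of _ y]) simp
        then have "word_op T (i # \<alpha>) (defect T y) \<in> defect_tail T (Suc 0)"
          unfolding defect_tail_def by (intro subsetD[OF closure_subset] complex_vector.span_base)
        then have "cinner x (word_op T (i # \<alpha>) (defect T y)) = 0"
          using x by (simp add: orth_compl_def)
        then show "cinner (adj_word \<alpha> (Tadj i x)) (defect T y) = 0"
          by (simp only: flip: cinner_adj_word adj_word_simps)
      qed
    qed
    then show "x \<in> range (defect T)" by (simp add: range_defect_iff)
  next
    fix x assume x: "x \<in> range (defect T)"
    let ?M = "{y. cinner y x = 0}"
    have "complex_vector.subspace ?M"
      by (auto simp: complex_vector.subspace_def cinner_add_left cinner_scaleC_left)
    moreover have "closed ?M"
      by (intro closed_Collect_eq continuous_on_const linear_continuous_on cinner.bounded_linear_left)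
    moreover have "{word_op T \<beta> (defect T h) |\<beta> h. Suc 0 \<le> length \<beta>} \<subseteq> ?M"
    proof
      fix z assume "z \<in> {word_op T \<beta> (defect T h) |\<beta> h. Suc 0 \<le> length \<beta>}"
      then obtain \<beta> h where z: "z = word_op T \<beta> (defect T h)" "Suc 0 \<le> length \<beta>" by blast
      obtain i \<gamma> where "\<beta> = i # \<gamma>" using z(2) by (cases \<beta>) auto
      then have "cinner z x = cinner (word_op T \<gamma> (defect T h)) (Tadj i x)"
        by (simp add: z(1) cinner_cadj_right[OF lin])
      then show "z \<in> ?M" using x by (simp add: range_defect_iff)
    qed
    ultimately have "defect_tail T (Suc 0) \<subseteq> ?M"
      unfolding defect_tail_def by (intro closure_minimal complex_vector.span_minimal)
    then have "cinner y x = 0" if "y \<in> defect_tail T (Suc 0)" for y using that by blast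
    then have "cinner x y = 0" if "y \<in> defect_tail T (Suc 0)" for y
      using that by (subst cinner_commute) simp
    then show "x \<in> orth_compl (defect_tail T (Suc 0))" by (simp add: orth_compl_def)
  qed
  ultimately show ?thesis by simp
qed

end

context row_contr
begin

lemma Gamma_map_snd_iff:
  "Gamma_map T \<in> UNIV \<times> {0} \<times> {0} \<longleftrightarrow>
     char_degree T = 0 \<and> (\<forall>h. (\<forall>\<alpha>. defect T (adj_word \<alpha> h) = 0) \<longrightarrow> h = 0)"
proof -
  have "hdim {h. poisson_kernel T h = 0} = 0 \<longleftrightarrow> {h. poisson_kernel T h = 0} = {0}"
    by (rule hdim_eq_0_iff)
      (simp add: poisson_kernel_eq_0_iff bounded_clinear_zero[OF lin_adj_word] bounded_clinear_zero[OF lin_defect])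
  also have "\<dots> \<longleftrightarrow> (\<forall>h. (\<forall>\<alpha>. defect T (adj_word \<alpha> h) = 0) \<longrightarrow> h = 0)"
    using bounded_clinear_zero[OF lin_adj_word] bounded_clinear_zero[OF lin_defect]
    by (auto simp: poisson_kernel_eq_0_iff)
  finally show ?thesis by (simp add: Gamma_map_def)
qed

text \<open>If \<open>\<Theta>\<^sub>T\<close> is constant, all \<open>\<Delta>\<^sub>T T\<^sub>\<alpha>\<^sup>* P\<^sub>i \<Delta>\<^sub>T\<^sub>* v\<close> vanish, so the components of \<open>\<Delta>\<^sub>T\<^sub>* v\<close> lie in the
  kernel of \<open>K\<^sub>T\<close>.\<close>

lemma row_isometry_if_degree_0:
  assumes deg: "char_degree T = 0"
    and ker: "\<And>h. (\<And>\<alpha>. defect T (adj_word \<alpha> h) = 0) \<Longrightarrow> h = 0"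
  shows "row_isometry T"
proof -
  have "defect_star T v $ i = 0" for v i
  proof (rule ker)
    show "defect T (adj_word \<alpha> (defect_star T v $ i)) = 0" for \<alpha>
      using deg by (simp add: char_degree_eq_0_iff adj_word_eq)
  qed
  then show ?thesis by (simp add: row_isometry_iff_defect_star vec_eq_iff)
qed

lemma pure_isometry_iff:
  "pure_isometry T \<longleftrightarrow> char_degree T = 0 \<and> (\<forall>h. (\<forall>\<alpha>. defect T (adj_word \<alpha> h) = 0) \<longrightarrow> h = 0)"
proof
  assume pure: "pure_isometry T"
  then have "\<forall>v. defect_star T v = 0"
    by (simp add: pure_isometry_def row_isometry_iff_defect_star)
  then have "char_degree T = 0"
    by (simp add: char_degree_eq_0_iff bounded_clinear_zero[OF bounded_clinear_word_op[OF lin_adj]]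
        bounded_clinear_zero[OF lin_defect])
  then show "char_degree T = 0 \<and> (\<forall>h. (\<forall>\<alpha>. defect T (adj_word \<alpha> h) = 0) \<longrightarrow> h = 0)"
    using pure poisson_injective_if_pure by (auto simp: pure_isometry_def)
next
  assume *: "char_degree T = 0 \<and> (\<forall>h. (\<forall>\<alpha>. defect T (adj_word \<alpha> h) = 0) \<longrightarrow> h = 0)"
  then have iso: "row_isometry T" using row_isometry_if_degree_0 by blast
  interpret row_iso T by unfold_locales (rule iso)
  have "pure_row T" by (rule pure_if_poisson_injective) (use * in blast)
  then show "pure_isometry T" using iso contraction by (simp add: pure_isometry_def)
qed

end


section \<open>Orthonormal bases and Hilbert dimension\<close>

lemma orthonormal_subset: "orthonormal E \<Longrightarrow> F \<subseteq> E \<Longrightarrow> orthonormal F"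
  unfolding orthonormal_def by blast

lemma orthonormal_independent:
  assumes E: "orthonormal E"
  shows "complex_vector.independent E"
  unfolding complex_vector.independent_explicit_module
proof (intro allI impI)
  fix F u v assume F: "finite F" "F \<subseteq> E" "(\<Sum>w\<in>F. u w *\<^sub>C w) = 0" "v \<in> F"
  have "u v = cinner (\<Sum>w\<in>F. u w *\<^sub>C w) v"
    by (rule cinner_sum_orthonormal[OF orthonormal_subset[OF E F(2)] F(1,4), symmetric])
  then show "u v = 0" by (simp add: F(3))
qed

lemma exists_maximal_orthonormal:
  fixes D :: "'a::complex_inner set"
  assumes D: "complex_vector.subspace D"
  obtains E where "E \<subseteq> D" "orthonormal E" "\<forall>x\<in>D. (\<forall>e\<in>E. cinner x e = 0) \<longrightarrow> x = 0"
proof -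
  let ?A = "{E. E \<subseteq> D \<and> orthonormal E}"
  have "\<exists>E\<in>?A. \<forall>F\<in>?A. E \<subseteq> F \<longrightarrow> F = E"
  proof (rule subset_Zorn')
    fix \<C> assume C: "subset.chain ?A \<C>"
    have "orthonormal (\<Union>\<C>)"
      unfolding orthonormal_def
    proof (intro ballI)
      fix x y assume "x \<in> \<Union>\<C>" "y \<in> \<Union>\<C>"
      then obtain X Y where XY: "x \<in> X" "X \<in> \<C>" "y \<in> Y" "Y \<in> \<C>" by blast
      then have "X \<subseteq> Y \<or> Y \<subseteq> X" using C by (auto simp: subset_chain_def)
      moreover have "orthonormal X" "orthonormal Y" using C XY by (auto simp: subset_chain_def)
      ultimately show "cinner x y = (if x = y then 1 else 0)"
        using XY by (auto simp: orthonormal_def)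
    qed
    moreover have "\<Union>\<C> \<subseteq> D" using C by (auto simp: subset_chain_def)
    ultimately show "\<Union>\<C> \<in> ?A" by blast
  qed
  then obtain E where "E \<in> ?A" and max': "\<forall>F\<in>?A. E \<subseteq> F \<longrightarrow> F = E" by (rule bexE)
  then have E: "E \<subseteq> D" "orthonormal E" by simp_all
  have max: "F = E" if "F \<subseteq> D" "orthonormal F" "E \<subseteq> F" for F
    using max' that by simp
  have "x = 0" if x: "x \<in> D" "\<And>e. e \<in> E \<Longrightarrow> cinner x e = 0" for x
  proof (rule ccontr)
    assume "x \<noteq> 0"
    define f where "f = complex_of_real (inverse (norm x)) *\<^sub>C x"
    have "norm f = 1" using \<open>x \<noteq> 0\<close> by (simp add: f_def norm_inverse)
    then have ff: "cinner f f = 1" by (simp add: cinner_self)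
    have fE: "cinner f e = 0" if "e \<in> E" for e by (simp add: f_def cinner_scaleC_left x(2)[OF that])
    have Ef: "cinner e f = 0" if "e \<in> E" for e using fE[OF that] by (subst cinner_commute) simp
    have "f \<in> D" unfolding f_def by (rule complex_vector.subspace_scale[OF D x(1)])
    moreover have "orthonormal (insert f E)"
      using E(2) ff fE Ef by (auto simp: orthonormal_def)
    ultimately have "insert f E = E" using E(1) by (intro max) auto
    then have "cinner f f = 0" using fE by blast
    then show False using ff by simp
  qed
  then show ?thesis by (intro that[OF E] ballI impI) blast
qed

text \<open>A finite maximal orthonormal set is a linear basis; an infinite one is an independent set too large
  for any finite spanning set.\<close>

lemma hdim_eq_card_orthonormal:
  assumes D: "complex_vector.subspace D" and E: "E \<subseteq> D" "orthonormal E"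
    and max: "\<And>x. x \<in> D \<Longrightarrow> (\<And>e. e \<in> E \<Longrightarrow> cinner x e = 0) \<Longrightarrow> x = 0"
  shows "hdim D = (if finite E then enat (card E) else \<infinity>)"
proof (cases "finite E")
  case True
  have "x \<in> complex_vector.span E" if "x \<in> D" for x
  proof -
    let ?p = "\<Sum>e\<in>E. cinner x e *\<^sub>C e"
    have p: "?p \<in> complex_vector.span E"
      by (intro complex_vector.span_sum complex_vector.span_scale complex_vector.span_base)
    have "complex_vector.span E \<subseteq> D" by (rule complex_vector.span_minimal[OF E(1) D])
    then have "x - ?p \<in> D" using p that complex_vector.subspace_diff[OF D] by blast
    then have "x - ?p = 0" by (rule max) (rule orth_residual[OF E(2) True])
    then have "x = ?p" by simp
    then show ?thesis using p by (rule ssubst)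
  qed
  then have span: "complex_vector.span E = D"
    using complex_vector.span_minimal[OF E(1) D] by blast
  have "complex_vector.dim D = card E"
    by (rule complex_vector.dim_unique[OF E(1) _ orthonormal_independent[OF E(2)] refl]) (simp add: span)
  then show ?thesis using True span by (auto simp: hdim_def)
next
  case False
  have "\<not> (\<exists>B. finite B \<and> complex_vector.span B = D)"
    using complex_vector.independent_span_bound[OF _ orthonormal_independent[OF E(2)]] E(1) False by blast
  then show ?thesis using False by (simp add: hdim_def)
qed

text \<open>By Bessel's inequality a vector is orthogonal to all but countably many members of an
  orthonormal set: the squared coefficients are summable.\<close>

lemma countable_nonorthogonal:
  assumes E: "orthonormal E"
  shows "countable {e\<in>E. cinner w e \<noteq> 0}"
proof -
  have "(\<lambda>e. (cmod (cinner w e))\<^sup>2) summable_on E"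
  proof (rule nonneg_bdd_above_summable_on)
    have "(\<Sum>e\<in>F. (cmod (cinner w e))\<^sup>2) \<le> (norm w)\<^sup>2" if "F \<subseteq> E" "finite F" for F
      by (rule Bessel_finite[OF orthonormal_subset[OF E that(1)] that(2)])
    then show "bdd_above (sum (\<lambda>e. (cmod (cinner w e))\<^sup>2) ` {F. F \<subseteq> E \<and> finite F})"
      by (intro bdd_aboveI[of _ "(norm w)\<^sup>2"]) auto
  qed simp
  then have "countable {e\<in>E. (cmod (cinner w e))\<^sup>2 \<noteq> 0}" by (rule summable_countable_real)
  then show ?thesis by simp
qed

lemma countable_ordLeq_infinite:
  assumes "countable A" "infinite B"
  shows "(card_of A, card_of B) \<in> ordLeq"
proof -
  have "(card_of A, card_of (UNIV :: nat set)) \<in> ordLeq"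
    unfolding card_of_ordLeq[symmetric] using assms(1) by (auto simp: countable_def)
  moreover have "(card_of (UNIV :: nat set), card_of B) \<in> ordLeq"
    using assms(2) infinite_iff_card_of_nat by blast
  ultimately show ?thesis by (rule ordLeq_transitive)
qed

text \<open>Every member of \<open>E\<close> is nonorthogonal to some \<open>w i\<close>, so \<open>E\<close> is a union of countable sets indexed by \<open>I\<close>.\<close>

lemma orthonormal_ordLeq_total:
  fixes E :: "'a::complex_inner set" and w :: "'i \<Rightarrow> 'a" and B :: "'b set"
  assumes E: "orthonormal E" and B: "infinite B" and I: "(card_of I, card_of B) \<in> ordLeq"
    and total: "\<And>x. (\<And>i. i \<in> I \<Longrightarrow> cinner (w i) x = 0) \<Longrightarrow> x = 0"
  shows "(card_of E, card_of B) \<in> ordLeq"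
proof -
  have "E \<subseteq> (\<Union>i\<in>I. {e\<in>E. cinner (w i) e \<noteq> 0})"
  proof
    fix e assume "e \<in> E"
    then have "e \<noteq> 0" using orthonormalD[OF E] by fastforce
    then obtain i where "i \<in> I" "cinner (w i) e \<noteq> 0" using total by blast
    then show "e \<in> (\<Union>i\<in>I. {e\<in>E. cinner (w i) e \<noteq> 0})" using \<open>e \<in> E\<close> by blast
  qed
  then have "(card_of E, card_of (\<Union>i\<in>I. {e\<in>E. cinner (w i) e \<noteq> 0})) \<in> ordLeq"
    by (rule card_of_mono1)
  moreover have "(card_of (\<Union>i\<in>I. {e\<in>E. cinner (w i) e \<noteq> 0}), card_of B) \<in> ordLeq"
    by (intro card_of_UNION_ordLeq_infinite[OF B I] ballI countable_ordLeq_infinite[OF _ B]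
        countable_nonorthogonal[OF E])
  ultimately show ?thesis by (rule ordLeq_transitive)
qed


section \<open>Unitary equivalence of pure isometries\<close>

text \<open>Polarisation gives the real part of the inner product; the imaginary part is, up to sign, the real
  part at \<open>\<i> *\<^sub>C x\<close>.\<close>

lemma norm_eq_imp_cinner_eq:
  fixes U :: "'a::complex_inner \<Rightarrow> 'b::complex_inner"
  assumes U: "bounded_clinear U" "\<And>x. norm (U x) = norm x"
  shows "cinner (U x) (U y) = cinner x y"
proof -
  have re: "inner (U x) (U y) = inner x y" for x y
  proof -
    have "(norm (U x + U y))\<^sup>2 = (norm (x + y))\<^sup>2"
      using U(2)[of "x + y"] by (simp add: bounded_clinear_add[OF U(1)])
    then have "inner (U x) (U x) + inner (U y) (U y) + 2 * inner (U x) (U y)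
        = inner x x + inner y y + 2 * inner x y"
      by (simp add: power2_norm_eq_inner inner_add_left inner_add_right inner_commute)
    moreover have "inner (U z) (U z) = inner z z" for z
      using U(2)[of z] by (metis power2_norm_eq_inner)
    ultimately show ?thesis by simp
  qed
  have im: "Im (cinner a b) = - inner (\<i> *\<^sub>C a) b" for a b :: "'c::complex_inner"
    by (simp add: inner_eq_Re_cinner cinner_scaleC_left)
  have "Im (cinner (U x) (U y)) = Im (cinner x y)"
    using re[of "\<i> *\<^sub>C x" y] by (simp add: im bounded_clinear_scaleC[OF U(1)])
  then show ?thesis using re[of x y] by (simp add: complex_eq_iff inner_eq_Re_cinner)
qed

text \<open>Corresponding linear combinations of the two families have equal norms, so the correspondence
  extends by continuity in both directions, and the two extensions are inverse to each other.\<close>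

lemma unitary_of_equal_Gram:
  fixes t :: "'s \<Rightarrow> 'a::chilbert_space" and u :: "'s \<Rightarrow> 'b::chilbert_space"
  assumes gram: "\<And>i j. i \<in> I \<Longrightarrow> j \<in> I \<Longrightarrow> cinner (u i) (u j) = cinner (t i) (t j)"
    and dense_t: "closure (complex_vector.span (t ` I)) = UNIV"
    and dense_u: "closure (complex_vector.span (u ` I)) = UNIV"
  obtains U where "unitary_op U" "\<And>i. i \<in> I \<Longrightarrow> U (t i) = u i"
proof -
  have norms: "norm (\<Sum>s\<in>F. c s *\<^sub>C u s) = norm (\<Sum>s\<in>F. c s *\<^sub>C t s)" if "F \<subseteq> I" for F c
  proof (rule norm_eq_if_cinner_eq)
    show "cinner (\<Sum>s\<in>F. c s *\<^sub>C u s) (\<Sum>s\<in>F. c s *\<^sub>C u s)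
        = cinner (\<Sum>s\<in>F. c s *\<^sub>C t s) (\<Sum>s\<in>F. c s *\<^sub>C t s)"
      unfolding cinner.sum_left cinner.sum_right cinner_scaleC_left cinner_scaleC_right
      by (intro sum.cong refl) (use gram that in \<open>simp add: subset_iff\<close>)
  qed
  have "\<exists>U. bounded_clinear U \<and> (\<forall>s\<in>I. U (t s) = u s) \<and> (\<forall>x. norm (U x) \<le> 1 * norm x)"
    by (rule bounded_extension_family[OF _ dense_t]) (simp add: norms)
  then obtain U where U: "bounded_clinear U" "\<And>s. s \<in> I \<Longrightarrow> U (t s) = u s" "\<And>x. norm (U x) \<le> norm x"
    by auto
  have "\<exists>V. bounded_clinear V \<and> (\<forall>s\<in>I. V (u s) = t s) \<and> (\<forall>x. norm (V x) \<le> 1 * norm x)"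
    by (rule bounded_extension_family[OF _ dense_u]) (simp add: norms)
  then obtain V where V: "bounded_clinear V" "\<And>s. s \<in> I \<Longrightarrow> V (u s) = t s" "\<And>x. norm (V x) \<le> norm x"
    by auto
  have VU: "V (U x) = x" for x
    by (rule fun_cong[OF bounded_clinear_eq_on_dense[OF bounded_clinear_compose[OF V(1) U(1)]
            bounded_clinear_id(2) dense_t]]) (auto simp: U V)
  have UV: "U (V x) = x" for x
    by (rule fun_cong[OF bounded_clinear_eq_on_dense[OF bounded_clinear_compose[OF U(1) V(1)]
            bounded_clinear_id(2) dense_u]]) (auto simp: U V)
  have "norm (U x) = norm x" for x
    using U(3)[of x] V(3)[of "U x"] by (simp add: VU)
  then have "unitary_op U"
    unfolding unitary_op_def using U(1) norm_eq_imp_cinner_eq[OF U(1)] UV by (metis surjI)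
  then show ?thesis using that U(2) by blast
qed

lemma (in row_iso) cinner_words:
  assumes "\<And>i. Tadj i x = 0" "\<And>i. Tadj i y = 0"
  shows "cinner (word_op T \<alpha> x) (word_op T \<beta> y) = (if \<alpha> = \<beta> then cinner x y else 0)"
proof (induction \<alpha> arbitrary: \<beta>)
  case Nil
  show ?case
    by (cases \<beta>) (simp_all add: assms flip: cinner_cadj_left[OF lin])
next
  case (Cons i \<alpha>)
  show ?case
  proof (cases \<beta>)
    case Nil
    then show ?thesis by (simp add: assms flip: cinner_cadj_right[OF lin])
  next
    case (Cons j \<gamma>)
    have "cinner (T i (word_op T \<alpha> x)) (T j (word_op T \<gamma> y)) = cinner (word_op T \<alpha> x) (Tadj i (T j (word_op T \<gamma> y)))"
      by (simp only: cinner_cadj_right[OF lin])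
    also have "\<dots> = (if i = j \<and> \<alpha> = \<gamma> then cinner x y else 0)"
      using Cons.IH[of \<gamma>] by (auto simp: Tadj_T)
    finally show ?thesis using Cons by simp
  qed
qed

text \<open>The set \<open>E\<close> is an orthonormal basis of the wandering space, the range of \<open>\<Delta>\<^sub>T\<close>. The vectors \<open>T\<^sub>\<alpha> e\<close> with
  \<open>e \<in> E\<close> then form an orthonormal basis of the whole space.\<close>

locale pure_iso = row_iso T for T :: "'n::finite \<Rightarrow> 'h::chilbert_space \<Rightarrow> 'h" +
  fixes E :: "'h set"
  assumes poisson_inj: "\<And>h. (\<And>\<alpha>. defect T (adj_word \<alpha> h) = 0) \<Longrightarrow> h = 0"
    and E_range: "E \<subseteq> range (defect T)" and E_orthonormal: "orthonormal E"
    and E_max: "\<And>x. x \<in> range (defect T) \<Longrightarrow> (\<And>e. e \<in> E \<Longrightarrow> cinner x e = 0) \<Longrightarrow> x = 0"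
begin

lemma cinner_basis_words:
  "e \<in> E \<Longrightarrow> f \<in> E \<Longrightarrow> cinner (word_op T \<alpha> e) (word_op T \<beta> f) = (if \<alpha> = \<beta> \<and> e = f then 1 else 0)"
  using E_range orthonormalD[OF E_orthonormal] by (subst cinner_words) (auto simp: range_defect_iff subset_iff)

lemma basis_words_total:
  assumes x: "\<And>\<alpha> e. e \<in> E \<Longrightarrow> cinner x (word_op T \<alpha> e) = 0"
  shows "x = 0"
proof (rule poisson_inj)
  fix \<alpha>
  show "defect T (adj_word \<alpha> x) = 0"
  proof (rule E_max)
    fix e assume "e \<in> E"
    then have "defect T e = e" using E_range defect_if_Tadj_0 by (auto simp: subset_iff range_defect_iff)
    then have "cinner (defect T (adj_word \<alpha> x)) e = cinner x (word_op T \<alpha> e)"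
      by (simp add: positive_op_selfadjoint[OF positive_defect] cinner_adj_word)
    then show "cinner (defect T (adj_word \<alpha> x)) e = 0" by (simp add: x[OF \<open>e \<in> E\<close>])
  qed simp
qed

lemma basis_words_dense: "closure (complex_vector.span ((\<lambda>(\<alpha>, e). word_op T \<alpha> e) ` (UNIV \<times> E))) = UNIV"
  by (rule dense_span_if_orth_compl_trivial) (rule basis_words_total, force)

lemma hdim_range_defect: "hdim (range (defect T)) = (if finite E then enat (card E) else \<infinity>)"
  by (rule hdim_eq_card_orthonormal[OF csubspace_range[OF lin_defect] E_range E_orthonormal E_max])

text \<open>If \<open>E\<close> is infinite, the countably many words do not increase the cardinality: the basis of all
  \<open>T\<^sub>\<alpha> e\<close> is no larger than \<open>E\<close>, and no orthonormal set of the space exceeds it.\<close>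

lemma orthonormal_ordLeq_basis:
  assumes "orthonormal (F :: 'h set)" "infinite E"
  shows "(card_of F, card_of E) \<in> ordLeq"
proof (rule orthonormal_ordLeq_total[OF assms, where w = "\<lambda>(\<alpha>, e). word_op T \<alpha> e"])
  show "(card_of ((UNIV :: 'n list set) \<times> E), card_of E) \<in> ordLeq"
    by (intro card_of_Sigma_ordLeq_infinite ballI assms(2) countable_ordLeq_infinite countableI_type
        card_of_mono1 order_refl)
  fix x assume x: "\<And>i. i \<in> (UNIV :: 'n list set) \<times> E \<Longrightarrow> cinner (case i of (\<alpha>, e) \<Rightarrow> word_op T \<alpha> e) x = 0"
  show "x = 0"
    by (rule basis_words_total) (use x in \<open>subst cinner_commute, force\<close>)
qed

end

text \<open>The unitary operator maps \<open>T\<^sub>\<alpha> e\<close> to \<open>T'\<^sub>\<alpha> (\<phi> e)\<close>; it intertwines because \<open>T\<^sub>i T\<^sub>\<alpha> = T\<^sub>i\<^sub>\<alpha>\<close>.\<close>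

lemma pure_iso_unitarily_equivalent:
  assumes "pure_iso T E" "pure_iso T' E'" and \<phi>: "bij_betw \<phi> E E'"
  shows "unitarily_equivalent T T'"
proof -
  interpret T: pure_iso T E by fact
  interpret T': pure_iso T' E' by fact
  let ?I = "UNIV \<times> E"
  let ?t = "\<lambda>(\<alpha>, e). word_op T \<alpha> e" and ?u = "\<lambda>(\<alpha>, e). word_op T' \<alpha> (\<phi> e)"
  have \<phi>E: "\<phi> e \<in> E'" if "e \<in> E" for e using \<phi> that by (rule bij_betwE[rule_format])
  have \<phi>_inj: "\<phi> e = \<phi> f \<longleftrightarrow> e = f" if "e \<in> E" "f \<in> E" for e f
    using \<phi> that by (auto simp: bij_betw_def inj_on_def)
  have im: "?u ` ?I = (\<lambda>(\<alpha>, e). word_op T' \<alpha> e) ` (UNIV \<times> E')"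
    using \<phi> by (force simp: bij_betw_def)
  obtain U where U: "unitary_op U" "\<And>i. i \<in> ?I \<Longrightarrow> U (?t i) = ?u i"
  proof (rule unitary_of_equal_Gram[of ?I ?u ?t])
    show "cinner (?u i) (?u j) = cinner (?t i) (?t j)" if "i \<in> ?I" "j \<in> ?I" for i j
      using that by (auto simp: T.cinner_basis_words T'.cinner_basis_words \<phi>E \<phi>_inj)
    show "closure (complex_vector.span (?t ` ?I)) = UNIV" by (rule T.basis_words_dense)
    show "closure (complex_vector.span (?u ` ?I)) = UNIV" unfolding im by (rule T'.basis_words_dense)
  qed (rule that)
  have linU: "bounded_clinear U" using U(1) by (simp add: unitary_op_def)
  have "U \<circ> T i = T' i \<circ> U" for i
  proof (rule bounded_clinear_eq_on_dense[OF bounded_clinear_comp[OF linU T.lin]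
        bounded_clinear_comp[OF T'.lin linU] T.basis_words_dense])
    fix x assume "x \<in> ?t ` ?I"
    then obtain \<alpha> e where x: "x = word_op T \<alpha> e" "e \<in> E" by auto
    show "(U \<circ> T i) x = (T' i \<circ> U) x"
      using U(2)[of "(\<alpha>, e)"] U(2)[of "(i # \<alpha>, e)"] x by simp
  qed
  then show ?thesis using U(1) by (auto simp: unitarily_equivalent_def)
qed

lemma exists_pure_iso:
  fixes T :: "'n::finite \<Rightarrow> 'h::chilbert_space \<Rightarrow> 'h"
  assumes T: "row_contraction T" and \<Gamma>: "Gamma_map T = (p, 0, 0)"
  obtains E where "pure_iso T E" "p = op_rank (defect T)" "p = (if finite E then enat (card E) else \<infinity>)"
proof -
  interpret row_contr T by unfold_locales (rule T)
  have deg: "char_degree T = 0" and ker: "\<And>h. (\<And>\<alpha>. defect T (adj_word \<alpha> h) = 0) \<Longrightarrow> h = 0"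
    using Gamma_map_snd_iff \<Gamma> by auto
  interpret row_iso T by unfold_locales (rule row_isometry_if_degree_0[OF deg ker])
  obtain E where E: "E \<subseteq> range (defect T)" "orthonormal E"
    "\<forall>x\<in>range (defect T). (\<forall>e\<in>E. cinner x e = 0) \<longrightarrow> x = 0"
    by (rule exists_maximal_orthonormal[OF csubspace_range[OF lin_defect]]) (rule that)
  interpret pure_iso T E
    by unfold_locales (use ker E(1,2) E(3)[rule_format] in blast)+
  have "p = hdim (defect_tail T 0 \<inter> orth_compl (defect_tail T (Suc 0)))"
    using \<Gamma> by (simp add: Gamma_map_def deg zero_enat_def)
  also have "\<dots> = hdim (range (defect T))" by (simp only: defect_tail_diff[OF ker])
  finally have "p = hdim (range (defect T))" .
  then show ?thesis
    using that[OF pure_iso_axioms] by (simp add: op_rank_def closed_range_defect hdim_range_defect)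
qed

theorem theorem2p2:
  fixes T :: "'n::finite \<Rightarrow> 'h::chilbert_space \<Rightarrow> 'h"
  assumes "row_contraction T"
  shows "(pure_isometry T \<longleftrightarrow> Gamma_map T \<in> UNIV \<times> {0} \<times> {0}) \<and>
    (\<forall>(T' :: 'n \<Rightarrow> 'h \<Rightarrow> 'h) p.
       row_contraction T' \<longrightarrow> Gamma_map T = (p, 0, 0) \<longrightarrow> Gamma_map T' = (p, 0, 0) \<longrightarrow>
       unitarily_equivalent T T' \<and> p = op_rank (defect T) \<and> p = op_rank (defect T'))"
proof (intro conjI allI impI)
  interpret row_contr T by unfold_locales (rule assms)
  show "pure_isometry T \<longleftrightarrow> Gamma_map T \<in> UNIV \<times> {0} \<times> {0}"
    by (simp only: pure_isometry_iff Gamma_map_snd_iff)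
next
  fix T' :: "'n \<Rightarrow> 'h \<Rightarrow> 'h" and p
  assume T': "row_contraction T'" and \<Gamma>: "Gamma_map T = (p, 0, 0)" and \<Gamma>': "Gamma_map T' = (p, 0, 0)"
  obtain E where E: "pure_iso T E" "p = op_rank (defect T)" "p = (if finite E then enat (card E) else \<infinity>)"
    by (rule exists_pure_iso[OF assms \<Gamma>]) (rule that)
  obtain E' where E': "pure_iso T' E'" "p = op_rank (defect T')" "p = (if finite E' then enat (card E') else \<infinity>)"
    by (rule exists_pure_iso[OF T' \<Gamma>']) (rule that)
  show "p = op_rank (defect T)" "p = op_rank (defect T')" by (rule E(2), rule E'(2))
  have "\<exists>\<phi>. bij_betw \<phi> E E'"
  proof (cases "finite E")
    case True
    then have "finite E'" "card E = card E'" using E(3) E'(3) by (auto split: if_splits)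
    then show ?thesis using True by (intro finite_same_card_bij)
  next
    case False
    \<comment> \<open>The value \<open>\<infinity>\<close> does not determine the cardinality. But \<open>E\<close> and \<open>E'\<close> are orthonormal sets of
      the same Hilbert space, so each is bounded by a basis built from the other.\<close>
    then have "infinite E'" using E(3) E'(3) by (auto split: if_splits)
    then show ?thesis
      unfolding card_of_ordIso ordIso_iff_ordLeq
      using False pure_iso.orthonormal_ordLeq_basis[OF E(1)] pure_iso.orthonormal_ordLeq_basis[OF E'(1)]
        pure_iso.E_orthonormal[OF E(1)] pure_iso.E_orthonormal[OF E'(1)] by blast
  qed
  then obtain \<phi> where "bij_betw \<phi> E E'" by blast
  then show "unitarily_equivalent T T'" by (rule pure_iso_unitarily_equivalent[OF E(1) E'(1)])
qed

end
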